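(* Let $n\ge 2$ and let $m_1<\cdots<m_n$ be an arithmetic sequence of positive integers, i.e. $m_i=m_1+(i-1)d$ for all $i\in\{1,\ldots,n\}$ with $d\in\mathbb{Z}^+$, and suppose $\gcd\{m_1,d\}=1$. Then $K[\mathcal{C}]$ is Cohen-Macaulay.
   Context: $K$ is an infinite field and $R=K[x_1,\ldots,x_{n+1}]$. For positive integers $m_1<\cdots<m_n$, the associated projective monomial curve $\mathcal{C}\subset\mathbb{P}^n_K$ is parametrically defined by $x_i=u^{m_i}v^{m_n-m_i}$ for $1\le i\le n$ and $x_{n+1}=v^{m_n}$. Its vanishing ideal $I(\mathcal{C})\subset R$ is the kernel of the $K$-algebra homomorphism $R\to K[u,v]$, $x_i\mapsto u^{m_i}v^{m_n-m_i}$ ($1\le i\le n$), $x_{n+1}\mapsto v^{m_n}$, and $K[\mathcal{C}]=R/I(\mathcal{C})$. *)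

theory Defs
  imports "HOL-Algebra.Algebra" "HOL-Library.Poly_Mapping" "HOL-Library.Extended_Nat"
begin

section \<open>Cohen-Macaulay rings\<close>

text \<open>
  The class of the fraction \<open>a / s\<close> in \<open>S\<^sup>-\<^sup>1 R\<close>: all pairs \<open>(b, t)\<close> with
  \<open>u (a t - b s) = 0\<close> for some \<open>u \<in> S\<close>, where \<open>S\<close> is a multiplicative subset of \<open>R\<close>.
\<close>

definition frac_class :: "('a, 'b) ring_scheme \<Rightarrow> 'a set \<Rightarrow> 'a \<Rightarrow> 'a \<Rightarrow> ('a \<times> 'a) set" where
  "frac_class R S a s =
     {(b, t). b \<in> carrier R \<and> t \<in> S \<and>
        (\<exists>u\<in>S. u \<otimes>\<^bsub>R\<^esub> (a \<otimes>\<^bsub>R\<^esub> t \<ominus>\<^bsub>R\<^esub> b \<otimes>\<^bsub>R\<^esub> s) = \<zero>\<^bsub>R\<^esub>)}"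

text \<open>
  The operations are unions over all representatives, as for \<^const>\<open>rcoset_mult\<close>; the sets
  in each union coincide (lemmas \<open>add_localization\<close> and \<open>mult_localization\<close> below).
\<close>

definition ring_of_fractions :: "('a, 'b) ring_scheme \<Rightarrow> 'a set \<Rightarrow> ('a \<times> 'a) set ring" where
  "ring_of_fractions R S =
     \<lparr>carrier = {frac_class R S a s | a s. a \<in> carrier R \<and> s \<in> S},
      monoid.mult = (\<lambda>F G. \<Union>x\<in>F. \<Union>y\<in>G. frac_class R S (fst x \<otimes>\<^bsub>R\<^esub> fst y) (snd x \<otimes>\<^bsub>R\<^esub> snd y)),
      monoid.one = frac_class R S \<one>\<^bsub>R\<^esub> \<one>\<^bsub>R\<^esub>,
      ring.zero = frac_class R S \<zero>\<^bsub>R\<^esub> \<one>\<^bsub>R\<^esub>,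
      ring.add = (\<lambda>F G. \<Union>x\<in>F. \<Union>y\<in>G.
               frac_class R S (fst x \<otimes>\<^bsub>R\<^esub> snd y \<oplus>\<^bsub>R\<^esub> fst y \<otimes>\<^bsub>R\<^esub> snd x)
                 (snd x \<otimes>\<^bsub>R\<^esub> snd y))\<rparr>"

definition localization :: "('a, 'b) ring_scheme \<Rightarrow> 'a set \<Rightarrow> ('a \<times> 'a) set ring" where
  "localization R P = ring_of_fractions R (carrier R - P)"

text \<open>The supremum of the lengths \<open>k\<close> of chains \<open>p\<^sub>0 \<subset> p\<^sub>1 \<subset> \<dots> \<subset> p\<^sub>k\<close> of prime ideals.\<close>

definition krull_dim :: "('a, 'b) ring_scheme \<Rightarrow> enat" where
  "krull_dim R =
     Sup {enat k | k. \<exists>p. (\<forall>i\<le>k. primeideal (p i) R) \<and> (\<forall>i<k. p i \<subset> p (Suc i))}"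

text \<open>
  \<open>f\<^sub>0, \<dots>, f\<^sub>r\<close> is regular if each \<open>f\<^sub>i\<close> is a non-zero-divisor on
  \<open>R / (f\<^sub>0, \<dots>, f\<^bsub>i-1\<^esub>)\<close> and \<open>(f\<^sub>0, \<dots>, f\<^sub>r) \<noteq> R\<close>.
\<close>

definition regular_sequence :: "('a, 'b) ring_scheme \<Rightarrow> 'a list \<Rightarrow> bool" where
  "regular_sequence R fs \<longleftrightarrow>
     set fs \<subseteq> carrier R \<and>
     (\<forall>i<length fs. \<forall>a\<in>carrier R.
        fs ! i \<otimes>\<^bsub>R\<^esub> a \<in> Idl\<^bsub>R\<^esub> (set (take i fs)) \<longrightarrow> a \<in> Idl\<^bsub>R\<^esub> (set (take i fs))) \<and>
     Idl\<^bsub>R\<^esub> (set fs) \<noteq> carrier R"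

definition depth :: "('a, 'b) ring_scheme \<Rightarrow> 'a set \<Rightarrow> enat" where
  "depth R I = Sup {enat (length fs) | fs. regular_sequence R fs \<and> set fs \<subseteq> I}"

definition cohen_macaulay_local_ring :: "('a, 'b) ring_scheme \<Rightarrow> bool" where
  "cohen_macaulay_local_ring A \<longleftrightarrow>
     cring A \<and> noetherian_ring A \<and>
     (\<exists>M. maximalideal M A \<and> (\<forall>N. maximalideal N A \<longrightarrow> N = M) \<and> depth A M = krull_dim A)"

definition cohen_macaulay_ring :: "('a, 'b) ring_scheme \<Rightarrow> bool" where
  "cohen_macaulay_ring R \<longleftrightarrow>
     cring R \<and> noetherian_ring R \<and>
     (\<forall>P. maximalideal P R \<longrightarrow> cohen_macaulay_local_ring (localization R P))"


section \<open>Polynomial rings\<close>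

text \<open>
  A monomial is a finitely supported exponent vector \<open>nat \<Rightarrow>\<^sub>0 nat\<close>, a polynomial a finitely
  supported family of coefficients; multiplication of \<^typ>\<open>'a \<Rightarrow>\<^sub>0 'b\<close> is convolution.
  The type has the variables \<open>x\<^sub>i\<close> for all \<open>i :: nat\<close>; \<open>mpoly_ring V\<close> is the polynomial ring
  in the variables \<open>x\<^sub>i\<close>, \<open>i \<in> V\<close>.
\<close>

type_synonym 'k mpoly = "(nat \<Rightarrow>\<^sub>0 nat) \<Rightarrow>\<^sub>0 'k"

definition mp_const :: "'k::field \<Rightarrow> 'k mpoly" where
  "mp_const c = Poly_Mapping.single 0 c"

definition mp_var :: "nat \<Rightarrow> 'k::field mpoly" where
  "mp_var i = Poly_Mapping.single (Poly_Mapping.single i 1) 1"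

definition mpoly_ring :: "nat set \<Rightarrow> 'k::field mpoly ring" where
  "mpoly_ring V =
     \<lparr>carrier = {p. \<forall>\<alpha>\<in>Poly_Mapping.keys p. Poly_Mapping.keys \<alpha> \<subseteq> V},
      monoid.mult = (*), monoid.one = 1, ring.zero = 0, ring.add = (+)\<rparr>"

text \<open>The \<open>K\<close>-algebra homomorphism determined by \<open>x\<^sub>i \<mapsto> \<theta> i\<close>; see \<open>mp_subst_hom\<close> below.\<close>

definition mp_subst :: "(nat \<Rightarrow> 'k::field mpoly) \<Rightarrow> 'k mpoly \<Rightarrow> 'k mpoly" where
  "mp_subst \<theta> p =
     (\<Sum>\<alpha>\<in>Poly_Mapping.keys p. mp_const (Poly_Mapping.lookup p \<alpha>) *
        (\<Prod>i\<in>Poly_Mapping.keys \<alpha>. \<theta> i ^ Poly_Mapping.lookup \<alpha> i))"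


section \<open>Projective monomial curves\<close>

text \<open>\<open>K[u, v]\<close> is \<open>mpoly_ring {1, 2}\<close>, with \<open>u\<close> and \<open>v\<close> its two variables.\<close>

abbreviation var_u :: "'k::field mpoly" where "var_u \<equiv> mp_var 1"
abbreviation var_v :: "'k::field mpoly" where "var_v \<equiv> mp_var 2"

definition curve_param :: "nat \<Rightarrow> (nat \<Rightarrow> nat) \<Rightarrow> nat \<Rightarrow> 'k::field mpoly" where
  "curve_param n m i =
     (if i = n + 1 then var_v ^ m n else var_u ^ m i * var_v ^ (m n - m i))"

definition curve_ideal :: "nat \<Rightarrow> (nat \<Rightarrow> nat) \<Rightarrow> 'k::field mpoly set" where
  "curve_ideal n m =
     a_kernel (mpoly_ring {1..n + 1}) (mpoly_ring {1, 2}) (mp_subst (curve_param n m))"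

definition curve_coordinate_ring :: "nat \<Rightarrow> (nat \<Rightarrow> nat) \<Rightarrow> 'k::field mpoly set ring" where
  "curve_coordinate_ring n m = mpoly_ring {1..n + 1} Quot curve_ideal n m"


section \<open>Well-definedness\<close>

lemma UN_UN_const:
  assumes "\<And>x y. x \<in> A \<Longrightarrow> y \<in> B \<Longrightarrow> h x y = C" "A \<noteq> {}" "B \<noteq> {}"
  shows "(\<Union>x\<in>A. \<Union>y\<in>B. h x y) = C"
  using assms by auto

locale mult_subset = cring R for R (structure) +
  fixes S
  assumes S_sub: "S \<subseteq> carrier R"
    and one_S: "\<one> \<in> S"
    and mult_S: "s \<in> S \<Longrightarrow> t \<in> S \<Longrightarrow> s \<otimes> t \<in> S"
begin

lemma S_carr [simp]: "s \<in> S \<Longrightarrow> s \<in> carrier R"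
  using S_sub by blast

lemma frac_rel_iff:
  assumes "a \<in> carrier R" "b \<in> carrier R" "s \<in> S" "t \<in> S" "u \<in> S"
  shows "u \<otimes> (a \<otimes> t \<ominus> b \<otimes> s) = \<zero> \<longleftrightarrow> u \<otimes> a \<otimes> t = u \<otimes> b \<otimes> s"
proof -
  have c: "a \<in> carrier R" "b \<in> carrier R" "s \<in> carrier R" "t \<in> carrier R" "u \<in> carrier R"
    using assms by auto
  have "u \<otimes> (a \<otimes> t \<ominus> b \<otimes> s) = u \<otimes> a \<otimes> t \<ominus> u \<otimes> b \<otimes> s"
    using c by algebra
  then show ?thesis using c by simp
qed

lemma mem_frac_class:
  assumes "a \<in> carrier R" "s \<in> S"
  shows "(b, t) \<in> frac_class R S a s \<longleftrightarrow>
    b \<in> carrier R \<and> t \<in> S \<and> (\<exists>u\<in>S. u \<otimes> a \<otimes> t = u \<otimes> b \<otimes> s)"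
  using assms frac_rel_iff unfolding frac_class_def by auto

lemma frac_class_subset:
  assumes ab: "a \<in> carrier R" "b \<in> carrier R" "s \<in> S" "t \<in> S"
    and u: "u \<in> S" "u \<otimes> a \<otimes> t = u \<otimes> b \<otimes> s"
  shows "frac_class R S a s \<subseteq> frac_class R S b t"
proof
  fix x assume x: "x \<in> frac_class R S a s"
  obtain c r where [simp]: "x = (c, r)" by (cases x)
  from x ab obtain w where w: "c \<in> carrier R" "r \<in> S" "w \<in> S" "w \<otimes> a \<otimes> r = w \<otimes> c \<otimes> s"
    by (auto simp: mem_frac_class)
  have cs: "a \<in> carrier R" "b \<in> carrier R" "s \<in> carrier R" "t \<in> carrier R" "u \<in> carrier R"
    "c \<in> carrier R" "r \<in> carrier R" "w \<in> carrier R"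
    using ab u w by auto
  let ?z = "s \<otimes> u \<otimes> w"
  have "?z \<otimes> b \<otimes> r = (u \<otimes> b \<otimes> s) \<otimes> (w \<otimes> r)" using cs by algebra
  also have "\<dots> = (u \<otimes> a \<otimes> t) \<otimes> (w \<otimes> r)" using u by simp
  also have "\<dots> = (w \<otimes> a \<otimes> r) \<otimes> (u \<otimes> t)" using cs by algebra
  also have "\<dots> = (w \<otimes> c \<otimes> s) \<otimes> (u \<otimes> t)" using w by simp
  also have "\<dots> = ?z \<otimes> c \<otimes> t" using cs by algebra
  finally have "?z \<otimes> b \<otimes> r = ?z \<otimes> c \<otimes> t" .
  moreover have "?z \<in> S" using ab u w mult_S by auto
  ultimately show "x \<in> frac_class R S b t" using ab w by (auto simp: mem_frac_class)
qed

lemma frac_class_eq_iff: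
  assumes "a \<in> carrier R" "b \<in> carrier R" "s \<in> S" "t \<in> S"
  shows "frac_class R S a s = frac_class R S b t \<longleftrightarrow> (\<exists>u\<in>S. u \<otimes> a \<otimes> t = u \<otimes> b \<otimes> s)"
proof
  assume eq: "frac_class R S a s = frac_class R S b t"
  have "(b, t) \<in> frac_class R S b t"
    using assms one_S by (auto simp: mem_frac_class)
  then show "\<exists>u\<in>S. u \<otimes> a \<otimes> t = u \<otimes> b \<otimes> s"
    using assms by (simp add: mem_frac_class flip: eq)
next
  assume "\<exists>u\<in>S. u \<otimes> a \<otimes> t = u \<otimes> b \<otimes> s"
  then obtain u where u: "u \<in> S" "u \<otimes> a \<otimes> t = u \<otimes> b \<otimes> s" by blast
  show "frac_class R S a s = frac_class R S b t"
    using frac_class_subset[of a b s t u] frac_class_subset[of b a t s u] assms u by auto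
qed

lemma self_in_frac_class:
  assumes "a \<in> carrier R" "s \<in> S"
  shows "(a, s) \<in> frac_class R S a s"
  using assms one_S by (auto simp: mem_frac_class)

lemma mult_localization:
  assumes ab: "a \<in> carrier R" "b \<in> carrier R" "s \<in> S" "t \<in> S"
  shows "frac_class R S a s \<otimes>\<^bsub>ring_of_fractions R S\<^esub> frac_class R S b t =
    frac_class R S (a \<otimes> b) (s \<otimes> t)"
proof -
  have "frac_class R S (a' \<otimes> b') (s' \<otimes> t') = frac_class R S (a \<otimes> b) (s \<otimes> t)"
    if x: "(a', s') \<in> frac_class R S a s" and y: "(b', t') \<in> frac_class R S b t" for a' s' b' t'
  proof -
    from x y ab obtain u w where
      uw: "a' \<in> carrier R" "b' \<in> carrier R" "s' \<in> S" "t' \<in> S" "u \<in> S" "w \<in> S"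
      "u \<otimes> a \<otimes> s' = u \<otimes> a' \<otimes> s" "w \<otimes> b \<otimes> t' = w \<otimes> b' \<otimes> t"
      by (auto simp: mem_frac_class)
    have cs: "a \<in> carrier R" "b \<in> carrier R" "s \<in> carrier R" "t \<in> carrier R" "u \<in> carrier R"
      "a' \<in> carrier R" "b' \<in> carrier R" "s' \<in> carrier R" "t' \<in> carrier R" "w \<in> carrier R"
      using ab uw by auto
    have "(u \<otimes> w) \<otimes> (a' \<otimes> b') \<otimes> (s \<otimes> t) = (u \<otimes> a' \<otimes> s) \<otimes> (w \<otimes> b' \<otimes> t)"
      using cs by algebra
    also have "\<dots> = (u \<otimes> a \<otimes> s') \<otimes> (w \<otimes> b \<otimes> t')" using uw by simp
    also have "\<dots> = (u \<otimes> w) \<otimes> (a \<otimes> b) \<otimes> (s' \<otimes> t')" using cs by algebra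
    finally have "(u \<otimes> w) \<otimes> (a' \<otimes> b') \<otimes> (s \<otimes> t) = (u \<otimes> w) \<otimes> (a \<otimes> b) \<otimes> (s' \<otimes> t')" .
    moreover have "u \<otimes> w \<in> S" using uw mult_S by auto
    ultimately show ?thesis
      using cs ab uw mult_S by (subst frac_class_eq_iff) auto
  qed
  moreover have "frac_class R S a s \<noteq> {}" "frac_class R S b t \<noteq> {}"
    using self_in_frac_class[OF ab(1,3)] self_in_frac_class[OF ab(2,4)] by auto
  ultimately show ?thesis
    unfolding ring_of_fractions_def ring.simps monoid.simps
    by (intro UN_UN_const) auto
qed

lemma add_localization:
  assumes ab: "a \<in> carrier R" "b \<in> carrier R" "s \<in> S" "t \<in> S"
  shows "frac_class R S a s \<oplus>\<^bsub>ring_of_fractions R S\<^esub> frac_class R S b t =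
    frac_class R S (a \<otimes> t \<oplus> b \<otimes> s) (s \<otimes> t)"
proof -
  have "frac_class R S (a' \<otimes> t' \<oplus> b' \<otimes> s') (s' \<otimes> t') = frac_class R S (a \<otimes> t \<oplus> b \<otimes> s) (s \<otimes> t)"
    if x: "(a', s') \<in> frac_class R S a s" and y: "(b', t') \<in> frac_class R S b t" for a' s' b' t'
  proof -
    from x y ab obtain u w where
      uw: "a' \<in> carrier R" "b' \<in> carrier R" "s' \<in> S" "t' \<in> S" "u \<in> S" "w \<in> S"
      "u \<otimes> a \<otimes> s' = u \<otimes> a' \<otimes> s" "w \<otimes> b \<otimes> t' = w \<otimes> b' \<otimes> t"
      by (auto simp: mem_frac_class)
    have cs: "a \<in> carrier R" "b \<in> carrier R" "s \<in> carrier R" "t \<in> carrier R" "u \<in> carrier R"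
      "a' \<in> carrier R" "b' \<in> carrier R" "s' \<in> carrier R" "t' \<in> carrier R" "w \<in> carrier R"
      using ab uw by auto
    have "(u \<otimes> w) \<otimes> (a' \<otimes> t' \<oplus> b' \<otimes> s') \<otimes> (s \<otimes> t)
      = (u \<otimes> a' \<otimes> s) \<otimes> (w \<otimes> t' \<otimes> t) \<oplus> (w \<otimes> b' \<otimes> t) \<otimes> (u \<otimes> s' \<otimes> s)"
      using cs by algebra
    also have "\<dots> = (u \<otimes> a \<otimes> s') \<otimes> (w \<otimes> t' \<otimes> t) \<oplus> (w \<otimes> b \<otimes> t') \<otimes> (u \<otimes> s' \<otimes> s)" using uw by simp
    also have "\<dots> = (u \<otimes> w) \<otimes> (a \<otimes> t \<oplus> b \<otimes> s) \<otimes> (s' \<otimes> t')" using cs by algebra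
    finally have "(u \<otimes> w) \<otimes> (a' \<otimes> t' \<oplus> b' \<otimes> s') \<otimes> (s \<otimes> t) =
      (u \<otimes> w) \<otimes> (a \<otimes> t \<oplus> b \<otimes> s) \<otimes> (s' \<otimes> t')" .
    moreover have "u \<otimes> w \<in> S" using uw mult_S by auto
    ultimately show ?thesis
      using cs ab uw mult_S by (subst frac_class_eq_iff) auto
  qed
  moreover have "frac_class R S a s \<noteq> {}" "frac_class R S b t \<noteq> {}"
    using self_in_frac_class[OF ab(1,3)] self_in_frac_class[OF ab(2,4)] by auto
  ultimately show ?thesis
    unfolding ring_of_fractions_def ring.simps monoid.simps
    by (intro UN_UN_const) auto
qed

lemma ring_of_fractions_cring: "cring (ring_of_fractions R S)"
proof -
  let ?L = "ring_of_fractions R S" and ?f = "frac_class R S"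
  have zero: "\<zero>\<^bsub>?L\<^esub> = ?f \<zero> \<one>" and one: "\<one>\<^bsub>?L\<^esub> = ?f \<one> \<one>"
    by (simp_all add: ring_of_fractions_def)
  have E: "\<exists>a s. x = ?f a s \<and> a \<in> carrier R \<and> s \<in> S" if "x \<in> carrier ?L" for x
    using that by (auto simp: ring_of_fractions_def)
  have I: "?f a s \<in> carrier ?L" if "a \<in> carrier R" "s \<in> S" for a s
    using that by (auto simp: ring_of_fractions_def)
  have eqI: "?f a s = ?f b t" if "a \<in> carrier R" "b \<in> carrier R" "s \<in> S" "t \<in> S" "a \<otimes> t = b \<otimes> s"
    for a b s t
    using that one_S by (subst frac_class_eq_iff) (auto intro!: bexI[of _ \<one>])
  note ops = mult_localization add_localization
  show ?thesis
  proof (rule cringI)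
    show "abelian_group ?L"
    proof (rule abelian_groupI)
      fix x y assume "x \<in> carrier ?L" "y \<in> carrier ?L"
      then obtain a s b t where xy: "x = ?f a s" "y = ?f b t"
        "a \<in> carrier R" "s \<in> S" "b \<in> carrier R" "t \<in> S" using E by metis
      then show "x \<oplus>\<^bsub>?L\<^esub> y \<in> carrier ?L" by (auto simp: ops mult_S intro!: I)
      have cs: "s \<in> carrier R" "t \<in> carrier R" using xy by auto
      have "a \<otimes> t \<oplus> b \<otimes> s = b \<otimes> s \<oplus> a \<otimes> t" "s \<otimes> t = t \<otimes> s"
        using xy(3,5) cs by algebra+
      then show "x \<oplus>\<^bsub>?L\<^esub> y = y \<oplus>\<^bsub>?L\<^esub> x" using xy by (simp add: ops)
    next
      show "\<zero>\<^bsub>?L\<^esub> \<in> carrier ?L" using one_S by (auto simp: zero intro!: I)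
    next
      fix x y z assume "x \<in> carrier ?L" "y \<in> carrier ?L" "z \<in> carrier ?L"
      then obtain a s b t c r where xy: "x = ?f a s" "y = ?f b t" "z = ?f c r"
        "a \<in> carrier R" "s \<in> S" "b \<in> carrier R" "t \<in> S" "c \<in> carrier R" "r \<in> S" using E by metis
      have cs: "s \<in> carrier R" "t \<in> carrier R" "r \<in> carrier R" using xy by auto
      have "(a \<otimes> t \<oplus> b \<otimes> s) \<otimes> r \<oplus> c \<otimes> (s \<otimes> t) = a \<otimes> (t \<otimes> r) \<oplus> (b \<otimes> r \<oplus> c \<otimes> t) \<otimes> s"
        "s \<otimes> t \<otimes> r = s \<otimes> (t \<otimes> r)"
        using xy(4,6,8) cs by algebra+
      then show "x \<oplus>\<^bsub>?L\<^esub> y \<oplus>\<^bsub>?L\<^esub> z = x \<oplus>\<^bsub>?L\<^esub> (y \<oplus>\<^bsub>?L\<^esub> z)"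
        using xy by (simp add: ops mult_S)
    next
      fix x assume "x \<in> carrier ?L"
      then obtain a s where x: "x = ?f a s" "a \<in> carrier R" "s \<in> S" using E by metis
      then show "\<zero>\<^bsub>?L\<^esub> \<oplus>\<^bsub>?L\<^esub> x = x" using one_S by (simp add: zero ops)
      have cs: "s \<in> carrier R" using x by auto
      have "?f (\<ominus> a) s \<oplus>\<^bsub>?L\<^esub> x = ?f (\<ominus> a \<otimes> s \<oplus> a \<otimes> s) (s \<otimes> s)" using x by (simp add: ops)
      also have "\<ominus> a \<otimes> s \<oplus> a \<otimes> s = \<zero>" using x(2) cs by algebra
      also have "?f \<zero> (s \<otimes> s) = \<zero>\<^bsub>?L\<^esub>" unfolding zero using x one_S mult_S cs by (intro eqI) simp_all
      finally show "\<exists>y\<in>carrier ?L. y \<oplus>\<^bsub>?L\<^esub> x = \<zero>\<^bsub>?L\<^esub>" using x by (auto intro!: bexI I)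
    qed
    show "comm_monoid ?L"
    proof (rule comm_monoidI)
      fix x y assume "x \<in> carrier ?L" "y \<in> carrier ?L"
      then obtain a s b t where xy: "x = ?f a s" "y = ?f b t"
        "a \<in> carrier R" "s \<in> S" "b \<in> carrier R" "t \<in> S" using E by metis
      then show "x \<otimes>\<^bsub>?L\<^esub> y \<in> carrier ?L" by (auto simp: ops mult_S intro!: I)
      show "x \<otimes>\<^bsub>?L\<^esub> y = y \<otimes>\<^bsub>?L\<^esub> x" using xy by (simp add: ops m_comm)
    next
      show "\<one>\<^bsub>?L\<^esub> \<in> carrier ?L" using one_S by (auto simp: one intro!: I)
    next
      fix x y z assume "x \<in> carrier ?L" "y \<in> carrier ?L" "z \<in> carrier ?L"
      then obtain a s b t c r where "x = ?f a s" "y = ?f b t" "z = ?f c r"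
        "a \<in> carrier R" "s \<in> S" "b \<in> carrier R" "t \<in> S" "c \<in> carrier R" "r \<in> S" using E by metis
      then show "x \<otimes>\<^bsub>?L\<^esub> y \<otimes>\<^bsub>?L\<^esub> z = x \<otimes>\<^bsub>?L\<^esub> (y \<otimes>\<^bsub>?L\<^esub> z)"
        by (simp add: ops mult_S m_assoc)
    next
      fix x assume "x \<in> carrier ?L"
      then obtain a s where "x = ?f a s" "a \<in> carrier R" "s \<in> S" using E by metis
      then show "\<one>\<^bsub>?L\<^esub> \<otimes>\<^bsub>?L\<^esub> x = x" using one_S by (simp add: one ops)
    qed
  next
    fix x y z assume "x \<in> carrier ?L" "y \<in> carrier ?L" "z \<in> carrier ?L"
    then obtain a s b t c r where xy: "x = ?f a s" "y = ?f b t" "z = ?f c r"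
      "a \<in> carrier R" "s \<in> S" "b \<in> carrier R" "t \<in> S" "c \<in> carrier R" "r \<in> S" using E by metis
    have cs: "s \<in> carrier R" "t \<in> carrier R" "r \<in> carrier R" using xy by auto
    have eq: "((a \<otimes> t \<oplus> b \<otimes> s) \<otimes> c) \<otimes> ((s \<otimes> r) \<otimes> (t \<otimes> r)) =
      ((a \<otimes> c) \<otimes> (t \<otimes> r) \<oplus> (b \<otimes> c) \<otimes> (s \<otimes> r)) \<otimes> ((s \<otimes> t) \<otimes> r)"
      using xy(4,6,8) cs by algebra
    have "?f ((a \<otimes> t \<oplus> b \<otimes> s) \<otimes> c) ((s \<otimes> t) \<otimes> r) =
      ?f ((a \<otimes> c) \<otimes> (t \<otimes> r) \<oplus> (b \<otimes> c) \<otimes> (s \<otimes> r)) ((s \<otimes> r) \<otimes> (t \<otimes> r))"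
      by (rule eqI) (use xy cs mult_S eq in auto)
    then show "(x \<oplus>\<^bsub>?L\<^esub> y) \<otimes>\<^bsub>?L\<^esub> z = x \<otimes>\<^bsub>?L\<^esub> z \<oplus>\<^bsub>?L\<^esub> y \<otimes>\<^bsub>?L\<^esub> z"
      using xy by (simp add: ops mult_S)
  qed
qed

end

lemma mult_subset_prime_complement:
  assumes "primeideal P R"
  shows "mult_subset R (carrier R - P)"
proof -
  interpret primeideal P R by (rule assms)
  have "\<one>\<^bsub>R\<^esub> \<notin> P" using I_notcarr one_imp_carrier by blast
  then show ?thesis
    by unfold_locales (use I_prime in auto)
qed

lemma localization_cring:
  assumes "primeideal P R"
  shows "cring (localization R P)"
  unfolding localization_def
  using mult_subset.ring_of_fractions_cring[OF mult_subset_prime_complement[OF assms]] .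

lemma keys_add_nat: "Poly_Mapping.keys (\<alpha> + \<beta>) = Poly_Mapping.keys \<alpha> \<union> Poly_Mapping.keys \<beta>"
  for \<alpha> \<beta> :: "nat \<Rightarrow>\<^sub>0 nat"
  by (auto simp: in_keys_iff lookup_add)

lemma mpoly_ring_cring: "cring (mpoly_ring V :: 'k::field mpoly ring)"
proof (rule cringI)
  show "abelian_group (mpoly_ring V :: 'k mpoly ring)"
  proof (rule abelian_groupI)
    fix p q :: "'k mpoly"
    assume "p \<in> carrier (mpoly_ring V)" "q \<in> carrier (mpoly_ring V)"
    then show "p \<oplus>\<^bsub>mpoly_ring V\<^esub> q \<in> carrier (mpoly_ring V)"
      using Poly_Mapping.keys_add[of p q] by (fastforce simp: mpoly_ring_def)
  next
    fix p :: "'k mpoly"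
    assume "p \<in> carrier (mpoly_ring V)"
    then show "\<exists>q\<in>carrier (mpoly_ring V). q \<oplus>\<^bsub>mpoly_ring V\<^esub> p = \<zero>\<^bsub>mpoly_ring V\<^esub>"
      by (intro bexI[of _ "- p"]) (auto simp: mpoly_ring_def)
  qed (auto simp: mpoly_ring_def algebra_simps)
  show "comm_monoid (mpoly_ring V :: 'k mpoly ring)"
  proof (rule comm_monoidI)
    fix p q :: "'k mpoly"
    assume "p \<in> carrier (mpoly_ring V)" "q \<in> carrier (mpoly_ring V)"
    then show "p \<otimes>\<^bsub>mpoly_ring V\<^esub> q \<in> carrier (mpoly_ring V)"
      using keys_mult[of p q] by (fastforce simp: mpoly_ring_def keys_add_nat)
  qed (auto simp: mpoly_ring_def algebra_simps)
qed (auto simp: mpoly_ring_def algebra_simps)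

lemma mp_subst_superset:
  assumes "finite A" "Poly_Mapping.keys p \<subseteq> A"
  shows "mp_subst \<theta> p = (\<Sum>\<alpha>\<in>A. mp_const (Poly_Mapping.lookup p \<alpha>) *
    (\<Prod>i\<in>Poly_Mapping.keys \<alpha>. \<theta> i ^ Poly_Mapping.lookup \<alpha> i))"
  unfolding mp_subst_def using assms
  by (intro sum.mono_neutral_left) (auto simp: in_keys_iff mp_const_def)

lemma mp_subst_add: "mp_subst \<theta> (p + q) = mp_subst \<theta> p + mp_subst \<theta> q"
proof -
  let ?A = "Poly_Mapping.keys p \<union> Poly_Mapping.keys q"
  have "Poly_Mapping.keys (p + q) \<subseteq> ?A" by (rule Poly_Mapping.keys_add)
  then show ?thesis
    by (simp add: mp_subst_superset[of ?A] lookup_add mp_const_def single_add algebra_simps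
        flip: sum.distrib)
qed

lemma mp_subst_single:
  "mp_subst \<theta> (Poly_Mapping.single \<alpha> c) =
    mp_const c * (\<Prod>i\<in>Poly_Mapping.keys \<alpha>. \<theta> i ^ Poly_Mapping.lookup \<alpha> i)"
  by (simp add: mp_subst_def mp_const_def)

lemma mp_subst_mult_single:
  "mp_subst \<theta> (Poly_Mapping.single \<alpha> c * Poly_Mapping.single \<beta> d) =
    mp_subst \<theta> (Poly_Mapping.single \<alpha> c) * mp_subst \<theta> (Poly_Mapping.single \<beta> d)"
proof -
  let ?A = "Poly_Mapping.keys \<alpha> \<union> Poly_Mapping.keys \<beta>"
  have sup: "(\<Prod>i\<in>Poly_Mapping.keys \<gamma>. \<theta> i ^ Poly_Mapping.lookup \<gamma> i) =
    (\<Prod>i\<in>?A. \<theta> i ^ Poly_Mapping.lookup \<gamma> i)" if "Poly_Mapping.keys \<gamma> \<subseteq> ?A" for \<gamma>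
    using that by (intro prod.mono_neutral_left) (auto simp: in_keys_iff)
  show ?thesis
    by (simp add: mult_single mp_subst_single sup keys_add_nat lookup_add power_add
        prod.distrib mp_const_def algebra_simps flip: mult_single[of 0 c 0 d, simplified])
qed

lemma mpoly_induct [case_names single add]:
  fixes p :: "'k::field mpoly"
  assumes "\<And>\<alpha> c. P (Poly_Mapping.single \<alpha> c)" "\<And>p q. P p \<Longrightarrow> P q \<Longrightarrow> P (p + q)"
  shows "P p"
proof -
  have "P (\<Sum>\<alpha>\<in>A. Poly_Mapping.single \<alpha> (Poly_Mapping.lookup p \<alpha>))" if "finite A" for A
    using that
  proof induction
    case empty
    show ?case using assms(1)[of 0 0] by simp
  qed (use assms in auto)
  moreover have "(\<Sum>\<alpha>\<in>Poly_Mapping.keys p. Poly_Mapping.single \<alpha> (Poly_Mapping.lookup p \<alpha>)) = p"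
    by (rule poly_mapping_eqI) (auto simp: lookup_sum lookup_single when_def in_keys_iff)
  ultimately show ?thesis by (metis finite_keys)
qed

lemma mp_subst_mult: "mp_subst \<theta> (p * q) = mp_subst \<theta> p * mp_subst \<theta> q"
proof (induction p rule: mpoly_induct)
  case (single \<alpha> c)
  show ?case
    by (induction q rule: mpoly_induct)
      (simp_all add: mp_subst_mult_single mp_subst_add algebra_simps)
qed (simp add: mp_subst_add algebra_simps)

lemma mp_subst_const: "mp_subst \<theta> (mp_const c) = mp_const c"
  by (simp add: mp_subst_def mp_const_def)

lemma mp_subst_var: "mp_subst \<theta> (mp_var i) = \<theta> i"
  by (simp add: mp_subst_def mp_const_def mp_var_def flip: one_poly_mapping_def)

lemma mp_subst_hom:
  fixes \<theta> :: "nat \<Rightarrow> 'k::field mpoly"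
  assumes "\<And>i. i \<in> V \<Longrightarrow> \<theta> i \<in> carrier (mpoly_ring W)"
  shows "mp_subst \<theta> \<in> ring_hom (mpoly_ring V) (mpoly_ring W)"
proof (rule ring_hom_memI)
  interpret W: cring "mpoly_ring W :: 'k mpoly ring" by (rule mpoly_ring_cring)
  have one: "(1 :: 'k mpoly) \<in> carrier (mpoly_ring W)"
    and zero: "(0 :: 'k mpoly) \<in> carrier (mpoly_ring W)"
    using W.one_closed W.zero_closed by (simp_all add: mpoly_ring_def)
  have mu: "p * q \<in> carrier (mpoly_ring W)"
    if "p \<in> carrier (mpoly_ring W)" "q \<in> carrier (mpoly_ring W)" for p q :: "'k mpoly"
    using W.m_closed[OF that] by (simp add: mpoly_ring_def)
  have ad: "p + q \<in> carrier (mpoly_ring W)"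
    if "p \<in> carrier (mpoly_ring W)" "q \<in> carrier (mpoly_ring W)" for p q :: "'k mpoly"
    using W.a_closed[OF that] by (simp add: mpoly_ring_def)
  have pow: "x ^ k \<in> carrier (mpoly_ring W)" if "x \<in> carrier (mpoly_ring W)" for x :: "'k mpoly" and k
    using that by (induction k) (simp_all add: one mu)
  have pr: "(\<Prod>i\<in>A. f i) \<in> carrier (mpoly_ring W)"
    if "\<And>i. i \<in> A \<Longrightarrow> f i \<in> carrier (mpoly_ring W)" for A :: "nat set" and f :: "nat \<Rightarrow> 'k mpoly"
    using that by (induction A rule: infinite_finite_induct) (simp_all add: one mu)
  have su: "(\<Sum>i\<in>A. f i) \<in> carrier (mpoly_ring W)"
    if "\<And>i. i \<in> A \<Longrightarrow> f i \<in> carrier (mpoly_ring W)"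
    for A :: "(nat \<Rightarrow>\<^sub>0 nat) set" and f :: "(nat \<Rightarrow>\<^sub>0 nat) \<Rightarrow> 'k mpoly"
    using that by (induction A rule: infinite_finite_induct) (simp_all add: zero ad)
  have co: "mp_const c \<in> carrier (mpoly_ring W)" for c :: 'k
    by (auto simp: mpoly_ring_def mp_const_def)
  fix p :: "'k mpoly" assume "p \<in> carrier (mpoly_ring V)"
  then have "i \<in> V" if "\<alpha> \<in> Poly_Mapping.keys p" "i \<in> Poly_Mapping.keys \<alpha>" for \<alpha> i
    using that by (auto simp: mpoly_ring_def)
  then show "mp_subst \<theta> p \<in> carrier (mpoly_ring W)"
    unfolding mp_subst_def by (intro su mu co pr pow assms)
next
  show "mp_subst \<theta> \<one>\<^bsub>mpoly_ring V\<^esub> = \<one>\<^bsub>mpoly_ring W\<^esub>"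
    using mp_subst_const[of \<theta> 1] by (simp add: mpoly_ring_def mp_const_def)
qed (simp_all add: mpoly_ring_def mp_subst_add mp_subst_mult)

lemma curve_param_hom:
  "mp_subst (curve_param n m :: nat \<Rightarrow> 'k::field mpoly)
     \<in> ring_hom (mpoly_ring {1..n + 1}) (mpoly_ring {1, 2})"
proof (rule mp_subst_hom)
  fix i
  interpret W: cring "mpoly_ring {1, 2} :: 'k mpoly ring" by (rule mpoly_ring_cring)
  have mu: "p * q \<in> carrier (mpoly_ring {1, 2})"
    if "p \<in> carrier (mpoly_ring {1, 2})" "q \<in> carrier (mpoly_ring {1, 2})" for p q :: "'k mpoly"
    using W.m_closed[OF that] by (simp add: mpoly_ring_def)
  have one: "(1 :: 'k mpoly) \<in> carrier (mpoly_ring {1, 2})"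
    using W.one_closed by (simp add: mpoly_ring_def)
  have pow: "x ^ k \<in> carrier (mpoly_ring {1, 2})" if "x \<in> carrier (mpoly_ring {1, 2})"
    for x :: "'k mpoly" and k
    using that by (induction k) (simp_all add: one mu del: One_nat_def)
  have "var_u \<in> carrier (mpoly_ring {1, 2} :: 'k mpoly ring)"
    "var_v \<in> carrier (mpoly_ring {1, 2} :: 'k mpoly ring)"
    by (auto simp: mpoly_ring_def mp_var_def)
  then show "curve_param n m i \<in> carrier (mpoly_ring {1, 2} :: 'k mpoly ring)"
    by (simp add: curve_param_def mu pow del: One_nat_def)
qed

lemma curve_coordinate_ring_cring:
  "cring (curve_coordinate_ring n m :: 'k::field mpoly set ring)"
proof -
  have "ring_hom_ring (mpoly_ring {1..n + 1}) (mpoly_ring {1, 2} :: 'k mpoly ring)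
      (mp_subst (curve_param n m))"
    using curve_param_hom mpoly_ring_cring by (intro ring_hom_ringI2 cring.axioms(1))
  then show ?thesis
    unfolding curve_coordinate_ring_def curve_ideal_def
    by (intro ideal.quotient_is_cring ring_hom_ring.kernel_is_ideal mpoly_ring_cring)
qed

end

theory Submission
  imports Defs "HOL-Computational_Algebra.Polynomial"
begin

text \<open>
  \<open>K[C]\<close> is the semigroup ring \<open>A \<subseteq> K[u, v]\<close> of the set \<open>S\<close> of all \<open>(a, b)\<close> with
  \<open>a + b = k m\<^sub>n\<close> and \<open>a = r m\<^sub>1 + j d\<close>, where \<open>r \<le> k\<close> and \<open>j \<le> r (n - 1)\<close>. Put \<open>D = m\<^sub>n\<close>.
  As \<open>gcd(m\<^sub>1, d) = 1\<close>, two representations of \<open>a\<close> differ by a multiple of \<open>(d, -m\<^sub>1)\<close>, and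
  from this \<open>(a + p D, b) \<in> S\<close> and \<open>(a, b + q D) \<in> S\<close> imply \<open>(a, b) \<in> S\<close>. Consequently
  \<open>f(u\<^sup>D), g(v\<^sup>D)\<close> is a regular sequence on \<open>A\<close> for all non-zero \<open>f\<close> and \<open>g\<close>, provided that
  both lie in a proper ideal. Every maximal ideal contains such a pair, because it contracts to a
  maximal ideal of \<open>K[u\<^sup>D, v\<^sup>D]\<close>. Hence every localization at a maximal ideal has depth at
  least \<open>2\<close>. Its dimension is at most \<open>2\<close>, because any three elements of \<open>A\<close> are
  algebraically dependent over \<open>K\<close>, and it is at least the depth.
\<close>

section \<open>Maximal and prime ideals\<close>

text \<open>All maximal ideals have to be treated, not only the homogeneous one, and
  \<open>K\<close> need not be algebraically closed. Hence the parameters are polynomials f(u^D),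
  g(v^D) depending on the ideal, not just u^D and v^D. As f and g are inhomogeneous, the quotient C
  = a / f(u^D) = r / g(v^D), which exists in K[u, v], is put back into A by a leading-term argument
  on its support: exponents move only by multiples of D, and the top part of a product cannot
  cancel. So a statement on S alone suffices. That statement compares two representations of one
  number a. The one coming from (a + p D, b) respects the upper bounds, but may turn negative when
  the shift is undone; the one coming from (a, b + q D) is non-negative, but its r may be too large.
  If the second fails, the first is non-negative.

  K[u, v] is modelled as \<open>'k poly poly\<close>, and A is embedded twice, with u and v
  exchanged, so that the construction of f also yields g.\<close>

lemma (in cring) maximal_inverse:
  assumes P: "maximalideal P R" and x: "x \<in> carrier R" "x \<notin> P"
  shows "\<exists>w\<in>carrier R. \<one> \<oplus> x \<otimes> w \<in> P"
proof -
  interpret P: maximalideal P R by (rule P)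
  let ?J = "P <+>\<^bsub>R\<^esub> PIdl x"
  have J: "ideal ?J R" by (rule add_ideals[OF P.is_ideal cgenideal_ideal[OF x(1)]])
  have mem: "p \<oplus> r \<otimes> x \<in> ?J" if "p \<in> P" "r \<in> carrier R" for p r
    using that unfolding set_add_def' cgenideal_def by blast
  have "P \<subseteq> ?J"
  proof
    fix p assume p: "p \<in> P"
    show "p \<in> ?J" using mem[OF p zero_closed] x P.Icarr[OF p] by simp
  qed
  moreover have "x \<in> ?J" using mem[OF P.zero_closed one_closed] x by simp
  moreover have "?J \<subseteq> carrier R" using ideal.Icarr[OF J] by blast
  ultimately have "?J = carrier R" using P.I_maximal[OF J] x by blast
  then obtain p r where pr: "p \<in> P" "r \<in> carrier R" "\<one> = p \<oplus> r \<otimes> x"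
    using one_closed unfolding set_add_def' cgenideal_def by blast
  have pc: "p \<in> carrier R" using pr P.Icarr by simp
  have "\<one> \<oplus> x \<otimes> (\<ominus> r) = (p \<oplus> r \<otimes> x) \<oplus> x \<otimes> (\<ominus> r)" using pr(3) by simp
  also have "\<dots> = p" using pc pr(2) x(1) by algebra
  finally show ?thesis using pr by (intro bexI[of _ "\<ominus> r"]) auto
qed

text \<open>An ideal that is maximal among those containing \<open>I\<close> and disjoint from the
  multiplicative set \<open>T\<close> is prime; Zorn's lemma provides one.\<close>

lemma (in cring) exists_prime_avoiding:
  assumes I: "ideal I R" and T: "T \<subseteq> carrier R" "\<one> \<in> T" "I \<inter> T = {}"
    and mult: "\<And>s t. s \<in> T \<Longrightarrow> t \<in> T \<Longrightarrow> s \<otimes> t \<in> T"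
  shows "\<exists>Q. primeideal Q R \<and> I \<subseteq> Q \<and> Q \<inter> T = {}"
proof -
  define A where "A = {J. ideal J R \<and> I \<subseteq> J \<and> J \<inter> T = {}}"
  have "\<exists>Q\<in>A. \<forall>J\<in>A. Q \<subseteq> J \<longrightarrow> J = Q"
  proof (rule subset_Zorn_nonempty)
    show "A \<noteq> {}" using I T by (auto simp: A_def)
  next
    fix C assume C: "C \<noteq> {}" "subset.chain A C"
    have sub: "C \<subseteq> A" using C by (auto simp: pred_on.chain_def)
    have "subset.chain {J. ideal J R} C"
      using C by (auto simp: pred_on.chain_def A_def)
    then have "ideal (\<Union>C) R" using chain_Union_is_ideal[of C] C by simp
    moreover have "I \<subseteq> \<Union>C" using C(1) sub by (auto simp: A_def)
    ultimately show "\<Union>C \<in> A" using sub by (auto simp: A_def)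
  qed
  then obtain Q where Q: "ideal Q R" "I \<subseteq> Q" "Q \<inter> T = {}"
    and mx: "\<And>J. ideal J R \<Longrightarrow> Q \<subseteq> J \<Longrightarrow> J \<inter> T = {} \<Longrightarrow> J = Q"
    unfolding A_def by (auto 0 4)
  interpret Q: ideal Q R by (rule Q)
  \<comment> \<open>The ideal Q + (a) is strictly larger than \<open>Q\<close>, so by maximality it
    meets \<open>T\<close>. For a b in \<open>Q\<close>, the product of two such elements of
    \<open>T\<close> would lie in \<open>Q\<close>.\<close>
  have key: "\<exists>q r. q \<in> Q \<and> r \<in> carrier R \<and> q \<oplus> r \<otimes> a \<in> T" if "a \<in> carrier R" "a \<notin> Q" for a
  proof -
    let ?J = "Q <+>\<^bsub>R\<^esub> PIdl a"
    have J: "ideal ?J R" by (rule add_ideals[OF Q(1) cgenideal_ideal[OF that(1)]])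
    have mem: "q \<oplus> r \<otimes> a \<in> ?J" if "q \<in> Q" "r \<in> carrier R" for q r
      using that unfolding set_add_def' cgenideal_def by blast
    have "Q \<subseteq> ?J"
    proof
      fix q assume q: "q \<in> Q"
      show "q \<in> ?J" using mem[OF q zero_closed] that(1) Q.Icarr[OF q] by simp
    qed
    moreover have "a \<in> ?J" using mem[OF Q.zero_closed one_closed] that(1) by simp
    ultimately have "?J \<inter> T \<noteq> {}" using mx[OF J] that by auto
    then show ?thesis unfolding set_add_def' cgenideal_def by auto
  qed
  have "primeideal Q R"
  proof (rule primeidealI[OF Q(1)])
    show "cring R" ..
    show "carrier R \<noteq> Q" using Q(3) T by auto
  next
    fix a b assume ab: "a \<in> carrier R" "b \<in> carrier R" "a \<otimes> b \<in> Q"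
    show "a \<in> Q \<or> b \<in> Q"
    proof (rule ccontr)
      assume "\<not> ?thesis"
      then obtain q r q' r' where
        h: "q \<in> Q" "r \<in> carrier R" "q \<oplus> r \<otimes> a \<in> T" "q' \<in> Q" "r' \<in> carrier R" "q' \<oplus> r' \<otimes> b \<in> T"
        using key ab by metis
      have c: "q \<in> carrier R" "q' \<in> carrier R" using h Q.Icarr by auto
      have "(q \<oplus> r \<otimes> a) \<otimes> (q' \<oplus> r' \<otimes> b) =
        (q' \<oplus> r' \<otimes> b) \<otimes> q \<oplus> ((r \<otimes> a) \<otimes> q' \<oplus> (r \<otimes> r') \<otimes> (a \<otimes> b))"
        using h c ab by algebra
      also have "\<dots> \<in> Q"
        using h(1,2,4,5) Q.I_l_closed[OF h(1), of "q' \<oplus> r' \<otimes> b"] Q.I_l_closed[OF h(4), of "r \<otimes> a"]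
          Q.I_l_closed[OF ab(3), of "r \<otimes> r'"] c ab(1,2) by (intro Q.a_closed) auto
      finally show False using mult[OF h(3,6)] Q(3) by auto
    qed
  qed
  then show ?thesis using Q by auto
qed

text \<open>A regular element lies outside of some smaller prime: this turns regular sequences
  into chains of primes.\<close>

lemma (in cring) exists_smaller_prime:
  assumes P: "primeideal P R" and I: "ideal I R" "I \<subseteq> P" and x: "x \<in> P"
    and reg: "\<And>a. a \<in> carrier R \<Longrightarrow> x \<otimes> a \<in> I \<Longrightarrow> a \<in> I"
  shows "\<exists>Q. primeideal Q R \<and> I \<subseteq> Q \<and> Q \<subset> P"
proof -
  interpret P: primeideal P R by (rule P)
  have xc [simp]: "x \<in> carrier R" using x P.Icarr by auto
  \<comment> \<open>The multiplicative set generated by \<open>x\<close> and the complement of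
    \<open>P\<close>. A prime avoiding it lies inside \<open>P\<close> and misses \<open>x\<close>,
    hence is strictly smaller; regularity of \<open>x\<close> keeps \<open>T\<close> disjoint from
    \<open>I\<close>.\<close>
  define T where "T = {x [^] k \<otimes> s | (k::nat) s. s \<in> carrier R - P}"
  have one: "\<one> \<in> carrier R - P" using P.I_notcarr P.one_imp_carrier by auto
  have "a \<in> I" if "x [^] k \<otimes> a \<in> I" "a \<in> carrier R" for a and k :: nat
    using that
  proof (induction k arbitrary: a)
    case (Suc k)
    have "x [^] Suc k \<otimes> a = x [^] k \<otimes> (x \<otimes> a)" using Suc.prems by (simp add: m_assoc)
    then show ?case using Suc reg[of a] by auto
  qed auto
  then have disj: "I \<inter> T = {}" using I by (auto simp: T_def)
  have "\<exists>Q. primeideal Q R \<and> I \<subseteq> Q \<and> Q \<inter> T = {}"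
  proof (rule exists_prime_avoiding[OF I(1) _ _ disj])
    show "T \<subseteq> carrier R" by (auto simp: T_def)
    have "\<one> = x [^] (0::nat) \<otimes> \<one>" by simp
    then show "\<one> \<in> T" using one unfolding T_def by blast
  next
    fix s t assume "s \<in> T" "t \<in> T"
    then obtain k a l b where h: "s = x [^] (k::nat) \<otimes> a" "t = x [^] (l::nat) \<otimes> b"
      "a \<in> carrier R - P" "b \<in> carrier R - P" unfolding T_def by blast
    have "s \<otimes> t = x [^] (k + l) \<otimes> (a \<otimes> b)"
      using h by (simp add: nat_pow_mult[symmetric] m_ac)
    moreover have "a \<otimes> b \<in> carrier R - P" using h P.I_prime by auto
    ultimately show "s \<otimes> t \<in> T" unfolding T_def by blast
  qed
  then obtain Q where Q: "primeideal Q R" "I \<subseteq> Q" "Q \<inter> T = {}" by blast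
  have sub: "Q \<subseteq> P"
  proof
    fix a assume a: "a \<in> Q"
    have "a \<in> carrier R" using a Q(1) by (meson ideal.Icarr primeideal.axioms(1))
    moreover have "a = x [^] (0::nat) \<otimes> a" using calculation by simp
    ultimately show "a \<in> P" using Q(3) a unfolding T_def by blast
  qed
  have "x = x [^] (1::nat) \<otimes> \<one>" by simp
  then have "x \<in> T" using one unfolding T_def by blast
  then have "x \<notin> Q" using Q by auto
  then show ?thesis using Q sub x by blast
qed

text \<open>The chain is built downwards from \<open>P\<close>. The last element is regular modulo
  the ideal of the others, so some prime strictly below \<open>P\<close> still contains that ideal,
  and the shorter sequence continues inside this prime.\<close>

lemma (in cring) exists_prime_chain:
  assumes P: "primeideal P R" and fs: "set fs \<subseteq> P"
    and reg: "\<And>i a. i < length fs \<Longrightarrow> a \<in> carrier R \<Longrightarrow>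
      fs ! i \<otimes> a \<in> Idl (set (take i fs)) \<Longrightarrow> a \<in> Idl (set (take i fs))"
  shows "\<exists>p. (\<forall>i\<le>length fs. primeideal (p i) R) \<and> (\<forall>i<length fs. p i \<subset> p (Suc i)) \<and> p (length fs) = P"
  using assms
proof (induction fs arbitrary: P rule: rev_induct)
  case Nil
  then show ?case by (intro exI[of _ "\<lambda>_. P"]) auto
next
  case (snoc x fs)
  interpret P: primeideal P R by (rule snoc.prems(1))
  let ?I = "Idl (set fs)"
  have c: "set fs \<subseteq> carrier R" using snoc.prems(2) P.Icarr by auto
  have I: "ideal ?I R" by (rule genideal_ideal[OF c])
  have "?I \<subseteq> P" using snoc.prems(2) by (intro genideal_minimal P.is_ideal) auto
  then have "\<exists>Q. primeideal Q R \<and> ?I \<subseteq> Q \<and> Q \<subset> P"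
    using snoc.prems(2) snoc.prems(3)[of "length fs"]
    by (intro exists_smaller_prime[OF snoc.prems(1) I, of x]) (auto simp: nth_append)
  then obtain Q where Q: "primeideal Q R" "?I \<subseteq> Q" "Q \<subset> P" by blast
  have "a \<in> Idl (set (take i fs))"
    if "i < length fs" "a \<in> carrier R" "fs ! i \<otimes> a \<in> Idl (set (take i fs))" for i a
    using snoc.prems(3)[of i a] that by (simp add: nth_append)
  then obtain p where p: "\<forall>i\<le>length fs. primeideal (p i) R" "\<forall>i<length fs. p i \<subset> p (Suc i)"
    "p (length fs) = Q"
    using snoc.IH[OF Q(1)] genideal_self[OF c] Q(2) by blast
  show ?case
    using p Q snoc.prems(1)
    by (intro exI[of _ "p(Suc (length fs) := P)"]) (auto simp: le_Suc_eq less_Suc_eq)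
qed

lemma (in cring) depth_le_krull_dim:
  assumes P: "primeideal P R"
  shows "depth R P \<le> krull_dim R"
  unfolding depth_def
proof (rule Sup_least, clarify)
  fix fs assume fs: "regular_sequence R fs" "set fs \<subseteq> P"
  have "\<exists>p. (\<forall>i\<le>length fs. primeideal (p i) R) \<and> (\<forall>i<length fs. p i \<subset> p (Suc i)) \<and>
    p (length fs) = P"
    using fs by (intro exists_prime_chain[OF P]) (auto simp: regular_sequence_def)
  then show "enat (length fs) \<le> krull_dim R"
    unfolding krull_dim_def by (intro Sup_upper) blast
qed


section \<open>Localization\<close>

context mult_subset
begin

abbreviation (input) L where "L \<equiv> ring_of_fractions R S"

lemma frac_closed: "a \<in> carrier R \<Longrightarrow> s \<in> S \<Longrightarrow> frac_class R S a s \<in> carrier L"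
  by (auto simp: ring_of_fractions_def)

lemma fracE:
  assumes "x \<in> carrier L"
  obtains a s where "a \<in> carrier R" "s \<in> S" "x = frac_class R S a s"
  using assms by (auto simp: ring_of_fractions_def)

lemma frac_one: "\<one>\<^bsub>L\<^esub> = frac_class R S \<one> \<one>"
  by (simp_all add: ring_of_fractions_def)

lemma frac_eqI:
  assumes "a \<in> carrier R" "b \<in> carrier R" "s \<in> S" "t \<in> S" "a \<otimes> t = b \<otimes> s"
  shows "frac_class R S a s = frac_class R S b t"
  using assms one_S by (subst frac_class_eq_iff) (auto intro!: bexI[of _ \<one>])

lemma frac_hom: "ring_hom_ring R L (\<lambda>a. frac_class R S a \<one>)"
  using one_S
  by (intro ring_hom_ringI2 ring_hom_memI)
    (auto simp: frac_closed mult_localization add_localization frac_one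
      ring_axioms cring.axioms(1)[OF ring_of_fractions_cring])

text \<open>The two fractions differ by the unit s / 1.\<close>

lemma frac_in_ideal_iff:
  assumes J: "ideal J L" and as: "a \<in> carrier R" "s \<in> S"
  shows "frac_class R S a s \<in> J \<longleftrightarrow> frac_class R S a \<one> \<in> J"
proof
  assume "frac_class R S a s \<in> J"
  then have "frac_class R S s \<one> \<otimes>\<^bsub>L\<^esub> frac_class R S a s \<in> J"
    using as one_S by (intro ideal.I_l_closed[OF J] frac_closed) auto
  also have "frac_class R S s \<one> \<otimes>\<^bsub>L\<^esub> frac_class R S a s = frac_class R S a \<one>"
    using as one_S by (simp add: mult_localization m_comm) (rule frac_eqI, auto)
  finally show "frac_class R S a \<one> \<in> J" .
next
  assume "frac_class R S a \<one> \<in> J"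
  then have "frac_class R S \<one> s \<otimes>\<^bsub>L\<^esub> frac_class R S a \<one> \<in> J"
    using as one_S by (intro ideal.I_l_closed[OF J] frac_closed) auto
  then show "frac_class R S a s \<in> J"
    using as one_S by (simp add: mult_localization)
qed

definition extension :: "'a set \<Rightarrow> ('a \<times> 'a) set set" where
  "extension I = {frac_class R S a s | a s. a \<in> I \<and> s \<in> S}"

text \<open>A fraction of the extended ideal also has representatives whose numerator lies outside
  \<open>I\<close>; the multiplier \<open>u\<close> makes membership independent of the
  representative.\<close>

lemma frac_in_extension_iff:
  assumes I: "ideal I R" and as: "a \<in> carrier R" "s \<in> S"
  shows "frac_class R S a s \<in> extension I \<longleftrightarrow> (\<exists>u\<in>S. u \<otimes> a \<in> I)"
proof
  interpret I: ideal I R by (rule I)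
  assume "frac_class R S a s \<in> extension I"
  then obtain b t where b: "b \<in> I" "t \<in> S" "frac_class R S a s = frac_class R S b t"
    by (auto simp: extension_def)
  then obtain u where u: "u \<in> S" "u \<otimes> a \<otimes> t = u \<otimes> b \<otimes> s"
    using as I.Icarr[of b] frac_class_eq_iff by auto
  have c: "u \<in> carrier R" "t \<in> carrier R" "s \<in> carrier R" "b \<in> carrier R"
    using u b as I.Icarr[of b] by auto
  have "(u \<otimes> t) \<otimes> a = (u \<otimes> s) \<otimes> b" using u(2) c as(1) by (simp add: m_ac)
  then have "(u \<otimes> t) \<otimes> a \<in> I" using c b by (simp add: I.I_l_closed)
  then show "\<exists>u\<in>S. u \<otimes> a \<in> I" using u b mult_S by blast
next
  assume "\<exists>u\<in>S. u \<otimes> a \<in> I"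
  then obtain u where u: "u \<in> S" "u \<otimes> a \<in> I" by blast
  have c: "u \<in> carrier R" "s \<in> carrier R" using u as by auto
  have "frac_class R S a s = frac_class R S (u \<otimes> a) (u \<otimes> s)"
    using u as c mult_S by (intro frac_eqI) (auto simp: m_ac)
  then show "frac_class R S a s \<in> extension I"
    using u as mult_S unfolding extension_def by blast
qed

lemma extension_ideal:
  assumes I: "ideal I R"
  shows "ideal (extension I) L"
proof (rule idealI)
  interpret I: ideal I R by (rule I)
  interpret L: cring L by (rule ring_of_fractions_cring)
  show "ring L" ..
  show lc: "x \<otimes>\<^bsub>L\<^esub> a \<in> extension I" if "a \<in> extension I" "x \<in> carrier L" for a x
  proof -
    from that obtain b t c s where "a = frac_class R S b t" "b \<in> I" "t \<in> S"
      "x = frac_class R S c s" "c \<in> carrier R" "s \<in> S" by (auto simp: extension_def elim!: fracE)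
    then have "x \<otimes>\<^bsub>L\<^esub> a = frac_class R S (c \<otimes> b) (s \<otimes> t)" "c \<otimes> b \<in> I" "s \<otimes> t \<in> S"
      by (auto simp: mult_localization I.Icarr I.I_l_closed mult_S)
    then show ?thesis unfolding extension_def by blast
  qed
  show "a \<otimes>\<^bsub>L\<^esub> x \<in> extension I" if "a \<in> extension I" "x \<in> carrier L" for a x
  proof -
    have "a \<in> carrier L" using that(1) by (auto simp: extension_def I.Icarr intro!: frac_closed)
    then show ?thesis using lc[OF that] that(2) by (simp add: L.m_comm)
  qed
  show "subgroup (extension I) (add_monoid L)"
  proof (rule L.add.subgroupI)
    show "extension I \<subseteq> carrier L" by (auto simp: extension_def I.Icarr intro!: frac_closed)
    show "extension I \<noteq> {}" using I.zero_closed one_S unfolding extension_def by blast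
    show "\<ominus>\<^bsub>L\<^esub> a \<in> extension I" if "a \<in> extension I" for a
    proof -
      have "a \<in> carrier L" using that by (auto simp: extension_def I.Icarr intro!: frac_closed)
      then have "\<ominus>\<^bsub>L\<^esub> a = (\<ominus>\<^bsub>L\<^esub> \<one>\<^bsub>L\<^esub>) \<otimes>\<^bsub>L\<^esub> a" by (simp add: L.l_minus)
      then show ?thesis using lc[OF that] by simp
    qed
    show "a \<oplus>\<^bsub>L\<^esub> b \<in> extension I" if "a \<in> extension I" "b \<in> extension I" for a b
    proof -
      from that obtain c s e t where "a = frac_class R S c s" "c \<in> I" "s \<in> S"
        "b = frac_class R S e t" "e \<in> I" "t \<in> S" by (auto simp: extension_def)
      then have "a \<oplus>\<^bsub>L\<^esub> b = frac_class R S (c \<otimes> t \<oplus> e \<otimes> s) (s \<otimes> t)"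
        "c \<otimes> t \<oplus> e \<otimes> s \<in> I" "s \<otimes> t \<in> S"
        by (auto simp: add_localization I.Icarr I.I_r_closed mult_S)
      then show ?thesis unfolding extension_def by blast
    qed
  qed
qed

text \<open>Denominators are units, so an ideal of the localization is determined by the numerators
  it contains. Finite generation and strictness of chains pass between the two rings through this
  identity.\<close>

lemma extension_contraction:
  assumes J: "ideal J L"
  shows "extension {a \<in> carrier R. frac_class R S a \<one> \<in> J} = J"
proof
  show "extension {a \<in> carrier R. frac_class R S a \<one> \<in> J} \<subseteq> J"
    using frac_in_ideal_iff[OF J] by (auto simp: extension_def)
  show "J \<subseteq> extension {a \<in> carrier R. frac_class R S a \<one> \<in> J}"
  proof
    fix x assume x: "x \<in> J"
    then have "x \<in> carrier L" using ideal.Icarr[OF J] by auto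
    then obtain a s where "a \<in> carrier R" "s \<in> S" "x = frac_class R S a s" by (rule fracE)
    then show "x \<in> extension {a \<in> carrier R. frac_class R S a \<one> \<in> J}"
      using x frac_in_ideal_iff[OF J] by (auto simp: extension_def)
  qed
qed

lemma extension_genideal:
  assumes F: "F \<subseteq> carrier R"
  shows "extension (Idl F) = Idl\<^bsub>L\<^esub> ((\<lambda>a. frac_class R S a \<one>) ` F)" (is "_ = Idl\<^bsub>L\<^esub> ?F")
proof
  interpret L: cring L by (rule ring_of_fractions_cring)
  interpret h: ring_hom_ring R L "\<lambda>a. frac_class R S a \<one>" by (rule frac_hom)
  have Fc: "?F \<subseteq> carrier L" using F one_S by (auto intro!: frac_closed)
  have J: "ideal (Idl\<^bsub>L\<^esub> ?F) L" by (rule L.genideal_ideal[OF Fc])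
  have "ideal {a \<in> carrier R. frac_class R S a \<one> \<in> Idl\<^bsub>L\<^esub> ?F} R" by (rule h.ideal_vimage[OF J])
  then have "Idl F \<subseteq> {a \<in> carrier R. frac_class R S a \<one> \<in> Idl\<^bsub>L\<^esub> ?F}"
    using F L.genideal_self[OF Fc] by (intro genideal_minimal) auto
  then have "extension (Idl F) \<subseteq> extension {a \<in> carrier R. frac_class R S a \<one> \<in> Idl\<^bsub>L\<^esub> ?F}"
    unfolding extension_def by blast
  then show "extension (Idl F) \<subseteq> Idl\<^bsub>L\<^esub> ?F" using extension_contraction[OF J] by simp
  show "Idl\<^bsub>L\<^esub> ?F \<subseteq> extension (Idl F)"
    using genideal_self[OF F] one_S
    by (intro L.genideal_minimal extension_ideal genideal_ideal F) (auto simp: extension_def)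
qed

lemma noetherian_ring_of_fractions:
  assumes "noetherian_ring R"
  shows "noetherian_ring L"
proof -
  interpret L: cring L by (rule ring_of_fractions_cring)
  interpret h: ring_hom_ring R L "\<lambda>a. frac_class R S a \<one>" by (rule frac_hom)
  show ?thesis
  proof (rule L.noetherian_ringI)
    fix J assume J: "ideal J L"
    obtain F where F: "F \<subseteq> carrier R" "finite F"
      "{a \<in> carrier R. frac_class R S a \<one> \<in> J} = Idl F"
      using noetherian_ring.finetely_gen[OF assms h.ideal_vimage[OF J]] by blast
    then have "J = Idl\<^bsub>L\<^esub> ((\<lambda>a. frac_class R S a \<one>) ` F)"
      using extension_contraction[OF J] extension_genideal[OF F(1)] by simp
    then show "\<exists>A\<subseteq>carrier L. finite A \<and> J = Idl\<^bsub>L\<^esub> A"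
      using F one_S by (intro exI[of _ "(\<lambda>a. frac_class R S a \<one>) ` F"]) (auto intro!: frac_closed)
  qed
qed

text \<open>Contraction preserves primes and is injective on ideals, since extension undoes it; a
  strict chain therefore contracts to a strict chain.\<close>

lemma krull_dim_ring_of_fractions: "krull_dim L \<le> krull_dim R"
  unfolding krull_dim_def
proof (rule Sup_least, clarify)
  interpret L: cring L by (rule ring_of_fractions_cring)
  interpret h: ring_hom_ring R L "\<lambda>a. frac_class R S a \<one>" by (rule frac_hom)
  fix k p assume p: "\<forall>i\<le>k. primeideal (p i) L" "\<forall>i<k. p i \<subset> p (Suc i)"
  define q where "q i = {a \<in> carrier R. frac_class R S a \<one> \<in> p i}" for i
  have ext: "extension (q i) = p i" if "i \<le> k" for i
    unfolding q_def using p(1) that by (intro extension_contraction) (auto intro: primeideal.axioms(1))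
  have "primeideal (q i) R" if "i \<le> k" for i
    unfolding q_def using p(1) that by (intro h.primeideal_vimage is_cring) auto
  moreover have "q i \<subset> q (Suc i)" if "i < k" for i
  proof
    have lt: "p i \<subset> p (Suc i)" using p(2) that by blast
    then show "q i \<subseteq> q (Suc i)" unfolding q_def by blast
    show "q i \<noteq> q (Suc i)"
    proof
      assume "q i = q (Suc i)"
      then have "extension (q i) = extension (q (Suc i))" by (rule arg_cong)
      then have "p i = p (Suc i)" using ext[of i] ext[of "Suc i"] that by simp
      then show False using lt by blast
    qed
  qed
  ultimately show "enat k \<le> Sup {enat k | k. \<exists>p. (\<forall>i\<le>k. primeideal (p i) R) \<and> (\<forall>i<k. p i \<subset> p (Suc i))}"
    by (intro Sup_upper) blast
qed

end

locale prime_localization = primeideal P R for P and R (structure)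
begin

sublocale mult_subset R "carrier R - P"
  by (rule mult_subset_prime_complement) (rule primeideal)

lemma extension_prime_iff:
  assumes "a \<in> carrier R" "s \<in> carrier R - P"
  shows "frac_class R (carrier R - P) a s \<in> extension P \<longleftrightarrow> a \<in> P"
  using assms one_S I_prime[of _ a] I_l_closed
  by (auto simp: frac_in_extension_iff[OF is_ideal] intro!: bexI[of _ \<one>])

text \<open>A fraction outside of \<open>extension P\<close> has its numerator outside of
  \<open>P\<close>, so swapping numerator and denominator inverts it.\<close>

lemma localization_nonunit:
  assumes J: "ideal J (localization R P)" "J \<noteq> carrier (localization R P)"
  shows "J \<subseteq> extension P"
proof
  fix x assume x: "x \<in> J"
  interpret J: ideal J "localization R P" by (rule J)
  have "x \<in> carrier (localization R P)" using x J.Icarr by auto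
  then obtain a s where as: "a \<in> carrier R" "s \<in> carrier R - P" "x = frac_class R (carrier R - P) a s"
    unfolding localization_def by (rule fracE)
  show "x \<in> extension P"
  proof (rule ccontr)
    assume "x \<notin> extension P"
    then have a: "a \<in> carrier R - P" using as extension_prime_iff by simp
    have "x \<otimes>\<^bsub>localization R P\<^esub> frac_class R (carrier R - P) s a \<in> J"
      using x as a by (intro J.I_r_closed) (auto simp: localization_def intro!: frac_closed)
    also have "x \<otimes>\<^bsub>localization R P\<^esub> frac_class R (carrier R - P) s a = \<one>\<^bsub>localization R P\<^esub>"
      using as a one_S mult_S[of s a] unfolding localization_def frac_one as(3)
      by (simp add: mult_localization m_comm) (rule frac_eqI, auto simp: m_comm)
    finally show False using J.one_imp_carrier J(2) by simp
  qed
qed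

lemma extension_maximal: "maximalideal (extension P) (localization R P)"
  and maximal_unique: "maximalideal N (localization R P) \<Longrightarrow> N = extension P"
proof -
  have id: "ideal (extension P) (localization R P)"
    unfolding localization_def by (rule extension_ideal[OF is_ideal])
  have "frac_class R (carrier R - P) \<one> \<one> \<notin> extension P"
    using extension_prime_iff[of \<one> \<one>] one_S by auto
  moreover have "frac_class R (carrier R - P) \<one> \<one> \<in> carrier (localization R P)"
    unfolding localization_def using one_S by (intro frac_closed) auto
  ultimately have proper: "carrier (localization R P) \<noteq> extension P" by auto
  show "maximalideal (extension P) (localization R P)"
    using localization_nonunit by (intro maximalidealI id proper) blast
  assume N: "maximalideal N (localization R P)"
  then interpret N: maximalideal N "localization R P" .
  show "N = extension P"
    using N.I_maximal[OF id] N.I_notcarr localization_nonunit[OF N.is_ideal] proper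
      ideal.Icarr[OF id] by blast
qed

text \<open>Regularity survives because the multiplier \<open>u\<close> that clears denominators can
  be absorbed into \<open>a\<close>: from f (u a) in the earlier ideal follows u a in it, which says
  that a / s is in its extension. The localized sequence generates a proper ideal because it stays
  inside the maximal one.\<close>

lemma regular_sequence_localization:
  assumes fs: "regular_sequence R fs" "set fs \<subseteq> P"
  defines "fs' \<equiv> map (\<lambda>a. frac_class R (carrier R - P) a \<one>) fs"
  shows "regular_sequence (localization R P) fs'" "set fs' \<subseteq> extension P"
proof -
  have fc: "set fs \<subseteq> carrier R" using fs by (auto simp: regular_sequence_def)
  have idl: "Idl\<^bsub>localization R P\<^esub> (set (take i fs')) = extension (Idl (set (take i fs)))" for i
    using fc set_take_subset[of i fs] unfolding fs'_def localization_def take_map set_map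
    by (intro extension_genideal[symmetric]) auto
  show sub: "set fs' \<subseteq> extension P"
    using fs one_S fc by (auto simp: fs'_def extension_prime_iff)
  have id: "ideal (extension P) (localization R P)"
    using extension_maximal by (rule maximalideal.axioms(1))
  show "regular_sequence (localization R P) fs'"
    unfolding regular_sequence_def
  proof (intro conjI allI impI ballI)
    show "set fs' \<subseteq> carrier (localization R P)"
      using sub ideal.Icarr[OF id] by auto
    interpret L: cring "localization R P" by (rule localization_cring) (rule primeideal)
    have "Idl\<^bsub>localization R P\<^esub> (set fs') \<subseteq> extension P"
      by (rule L.genideal_minimal[OF id sub])
    then show "Idl\<^bsub>localization R P\<^esub> (set fs') \<noteq> carrier (localization R P)"
      using maximalideal.I_notcarr[OF extension_maximal] ideal.Icarr[OF id] by blast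
  next
    fix i x
    assume i: "i < length fs'" and x: "x \<in> carrier (localization R P)"
      and mem: "fs' ! i \<otimes>\<^bsub>localization R P\<^esub> x \<in> Idl\<^bsub>localization R P\<^esub> (set (take i fs'))"
    have I: "ideal (Idl (set (take i fs))) R"
      using fc set_take_subset[of i fs] by (intro genideal_ideal) auto
    have f: "fs ! i \<in> carrier R" using fc i by (auto simp: fs'_def)
    obtain a s where as: "a \<in> carrier R" "s \<in> carrier R - P" "x = frac_class R (carrier R - P) a s"
      using x unfolding localization_def by (rule fracE)
    have "fs' ! i \<otimes>\<^bsub>localization R P\<^esub> x = frac_class R (carrier R - P) (fs ! i \<otimes> a) s"
      using i as f one_S by (simp add: fs'_def localization_def mult_localization)
    then obtain u where u: "u \<in> carrier R - P" "u \<otimes> (fs ! i \<otimes> a) \<in> Idl (set (take i fs))"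
      using mem as f unfolding idl by (auto simp: frac_in_extension_iff[OF I])
    have "fs ! i \<otimes> (u \<otimes> a) \<in> Idl (set (take i fs))"
      using u f as by (simp add: m_lcomm)
    moreover have "\<forall>b\<in>carrier R. fs ! i \<otimes> b \<in> Idl (set (take i fs)) \<longrightarrow> b \<in> Idl (set (take i fs))"
      using fs(1) i unfolding regular_sequence_def fs'_def length_map by blast
    moreover have "u \<otimes> a \<in> carrier R" using u as by simp
    ultimately have "u \<otimes> a \<in> Idl (set (take i fs))" by blast
    then show "x \<in> Idl\<^bsub>localization R P\<^esub> (set (take i fs'))"
      unfolding idl using as u by (auto simp: frac_in_extension_iff[OF I])
  qed
qed

end

text \<open>The inequalities close up: r <= depth of the localization <= its dimension <= dimension
  of R <= r. Thus one global bound and one sequence per maximal ideal suffice, and no local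
  dimension has to be computed directly.\<close>

lemma cohen_macaulay_ringI:
  assumes R: "cring R" "noetherian_ring R" and dim: "krull_dim R \<le> enat r"
    and reg: "\<And>P. maximalideal P R \<Longrightarrow> \<exists>fs. regular_sequence R fs \<and> set fs \<subseteq> P \<and> length fs = r"
  shows "cohen_macaulay_ring R"
  unfolding cohen_macaulay_ring_def
proof (intro conjI allI impI R)
  fix P assume P: "maximalideal P R"
  interpret R: cring R by (rule R)
  have pr: "primeideal P R" by (rule R.maximalideal_prime[OF P])
  interpret prime_localization P R by (rule prime_localization.intro[OF pr])
  interpret L: cring "localization R P" by (rule localization_cring[OF pr])
  obtain fs where fs: "regular_sequence R fs" "set fs \<subseteq> P" "length fs = r" using reg[OF P] by blast
  have "depth (localization R P) (extension P) \<le> krull_dim (localization R P)"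
    by (intro L.depth_le_krull_dim L.maximalideal_prime extension_maximal)
  moreover have "krull_dim (localization R P) \<le> enat r"
    using krull_dim_ring_of_fractions dim unfolding localization_def by (rule order_trans)
  moreover have "enat r \<le> depth (localization R P) (extension P)"
    unfolding depth_def using regular_sequence_localization[OF fs(1,2)] fs(3)
    by (intro Sup_upper) (auto intro!: exI[of _ "map (\<lambda>a. frac_class R (carrier R - P) a \<one>\<^bsub>R\<^esub>) fs"])
  ultimately have "depth (localization R P) (extension P) = krull_dim (localization R P)"
    by (meson order_antisym order_trans)
  then show "cohen_macaulay_local_ring (localization R P)"
    unfolding cohen_macaulay_local_ring_def
    using extension_maximal maximal_unique noetherian_ring_of_fractions[OF R(2)] L.is_cring
    unfolding localization_def by blast
qed

section \<open>Bivariate polynomials\<close>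

lemma dickson:
  fixes E :: "(nat \<times> nat) set"
  shows "\<exists>G\<subseteq>E. finite G \<and> (\<forall>(x, y)\<in>E. \<exists>(x', y')\<in>G. x' \<le> x \<and> y' \<le> y)"
proof (cases "E = {}")
  case False
  then obtain x0 y0 where e0: "(x0, y0) \<in> E" by auto
  \<comment> \<open>The minimal elements of \<open>E\<close>. Each of them is determined by either
    coordinate alone, and none exceeds the fixed point (x0, y0) of \<open>E\<close> in both
    coordinates, so two finite strips cover them.\<close>
  define G where "G = {(x, y) \<in> E. \<forall>(x', y')\<in>E. x' \<le> x \<longrightarrow> y' \<le> y \<longrightarrow> x' = x \<and> y' = y}"
  have uniq: "x = x' \<longleftrightarrow> y = y'" if "(x, y) \<in> G" "(x', y') \<in> G" for x y x' y'
    using that unfolding G_def by (cases "x \<le> x'"; cases "y \<le> y'") fastforce+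
  have "finite {e \<in> G. fst e \<le> x0}"
    by (rule finite_imageD[of fst], rule finite_subset[of _ "{..x0}"]) (use uniq in \<open>auto simp: inj_on_def\<close>)
  moreover have "finite {e \<in> G. snd e \<le> y0}"
    by (rule finite_imageD[of snd], rule finite_subset[of _ "{..y0}"]) (use uniq in \<open>auto simp: inj_on_def\<close>)
  moreover have "G \<subseteq> {e \<in> G. fst e \<le> x0} \<union> {e \<in> G. snd e \<le> y0}"
    using e0 by (auto simp: G_def)
  ultimately have "finite G" by (meson finite_UnI finite_subset)
  moreover have "\<exists>(x', y')\<in>G. x' \<le> x \<and> y' \<le> y" if "(x, y) \<in> E" for x y
    using that
  proof (induction "x + y" arbitrary: x y rule: less_induct)
    case less
    show ?case
    proof (cases "(x, y) \<in> G")
      case False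
      then obtain x' y' where h: "(x', y') \<in> E" "x' \<le> x" "y' \<le> y" "\<not> (x' = x \<and> y' = y)"
        using less.prems unfolding G_def by auto
      then have "x' + y' < x + y" by linarith
      then obtain x'' y'' where "(x'', y'') \<in> G" "x'' \<le> x'" "y'' \<le> y'"
        using less.hyps[OF _ h(1)] by blast
      then show ?thesis using h by (intro bexI[of _ "(x'', y'')"]) auto
    qed auto
  qed
  ultimately show ?thesis by (intro exI[of _ G]) (auto simp: G_def)
qed auto

text \<open>Here the order is the one in which only multiples of \<open>D\<close> may be added to a
  coordinate. It splits into the D^2 residue classes, and Dickson's lemma applies to each of
  them.\<close>

lemma dickson_mod:
  fixes E :: "(nat \<times> nat) set"
  assumes "D > 0"
  shows "\<exists>G\<subseteq>E. finite G \<and> (\<forall>(x, y)\<in>E. \<exists>(x', y')\<in>G. \<exists>a b. x = x' + a * D \<and> y = y' + b * D)"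
proof -
  define C where "C = (\<lambda>(r, t). {(x, y). (r + x * D, t + y * D) \<in> E})"
  have "\<forall>c. \<exists>G. G \<subseteq> C c \<and> finite G \<and> (\<forall>(x, y)\<in>C c. \<exists>(x', y')\<in>G. x' \<le> x \<and> y' \<le> y)"
    by (intro allI dickson)
  from choice[OF this] obtain G where
    "\<forall>c. G c \<subseteq> C c \<and> finite (G c) \<and> (\<forall>(x, y)\<in>C c. \<exists>(x', y')\<in>G c. x' \<le> x \<and> y' \<le> y)" ..
  then have GC: "G c \<subseteq> C c \<and> finite (G c) \<and> (\<forall>(x, y)\<in>C c. \<exists>(x', y')\<in>G c. x' \<le> x \<and> y' \<le> y)" for c
    by (rule spec)
  note G = GC[THEN conjunct1] GC[THEN conjunct2, THEN conjunct1] GC[THEN conjunct2, THEN conjunct2]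
  let ?H = "\<Union>c\<in>{..<D} \<times> {..<D}. (\<lambda>(x, y). (fst c + x * D, snd c + y * D)) ` G c"
  show ?thesis
  proof (intro exI[of _ ?H] conjI)
    show "?H \<subseteq> E"
    proof
      fix e assume "e \<in> ?H"
      then obtain r t x y where e: "(x, y) \<in> G (r, t)" "e = (r + x * D, t + y * D)" by auto
      then have "(x, y) \<in> C (r, t)" using G(1) by blast
      then show "e \<in> E" using e by (simp add: C_def)
    qed
    show "finite ?H" using G(2) by auto
    have "\<exists>(x', y')\<in>?H. \<exists>a b. x = x' + a * D \<and> y = y' + b * D" if "(x, y) \<in> E" for x y
    proof -
      let ?c = "(x mod D, y mod D)"
      have "(x div D, y div D) \<in> C ?c" using that by (simp add: C_def)
      then obtain x' y' where h: "(x', y') \<in> G ?c" "x' \<le> x div D" "y' \<le> y div D" using G(3) by blast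
      have decomp: "x = (x mod D + x' * D) + (x div D - x') * D" if le: "x' \<le> x div D" for x x'
      proof -
        obtain k where k: "x div D = x' + k" using le_Suc_ex[OF le] by blast
        have "x = x mod D + x div D * D" by simp
        then show ?thesis unfolding k by (simp add: add_mult_distrib)
      qed
      note decomp[OF h(2)] decomp[OF h(3)]
      moreover have "(x mod D + x' * D, y mod D + y' * D) \<in> ?H"
        using assms by (intro UN_I[of ?c] image_eqI[OF _ h(1)]) auto
      ultimately show ?thesis by blast
    qed
    then show "\<forall>(x, y)\<in>E. \<exists>(x', y')\<in>?H. \<exists>a b. x = x' + a * D \<and> y = y' + b * D" by blast
  qed
qed

section \<open>Ideals of K[s][t] and Nakayama's lemma\<close>

lemma map_poly_add_hom:
  assumes "f 0 = 0" "\<And>a b. f (a + b) = f a + f b"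
  shows "map_poly f (p + q) = map_poly f p + map_poly f q"
  by (rule poly_eqI) (simp add: coeff_map_poly assms)

lemma map_poly_mult_hom:
  fixes f :: "'a::comm_semiring_0 \<Rightarrow> 'b::comm_semiring_0"
  assumes "f 0 = 0" "\<And>a b. f (a + b) = f a + f b" "\<And>a b. f (a * b) = f a * f b"
  shows "map_poly f (p * q) = map_poly f p * map_poly f q"
proof (rule poly_eqI)
  fix n
  have "f (sum g A) = (\<Sum>i\<in>A. f (g i))" for g and A :: "nat set"
    by (induction A rule: infinite_finite_induct) (simp_all add: assms)
  then show "coeff (map_poly f (p * q)) n = coeff (map_poly f p * map_poly f q) n"
    by (simp add: coeff_map_poly coeff_mult assms)
qed

text \<open>Division by a polynomial whose leading coefficient is regular modulo \<open>e\<close>: the coefficients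
  of the quotient are compared with those of the product from the top downwards.\<close>

lemma dvd_coeff_of_mult:
  fixes h :: "'a::comm_ring_1 poly"
  assumes lc: "\<And>x. e dvd lead_coeff h * x \<Longrightarrow> e dvd x"
    and dv: "\<And>j. e dvd coeff (h * p) (degree h + j)"
  shows "e dvd coeff p j"
proof (induction "Suc (degree p) - j" arbitrary: j rule: less_induct)
  case less
  show ?case
  proof (cases "j > degree p")
    case True
    then show ?thesis by (simp add: coeff_eq_0)
  next
    case False
    have "e dvd coeff h i * coeff p (degree h + j - i)" if "i \<noteq> degree h" "i \<le> degree h + j" for i
    proof (cases "i < degree h")
      case True
      then show ?thesis using False less.hyps[of "degree h + j - i"] by (intro dvd_mult) auto
    next
      case False
      then show ?thesis using that by (simp add: coeff_eq_0)
    qed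
    then have sum: "e dvd (\<Sum>i\<in>{..degree h + j} - {degree h}. coeff h i * coeff p (degree h + j - i))"
      by (intro dvd_sum) auto
    have "coeff (h * p) (degree h + j) = lead_coeff h * coeff p j +
        (\<Sum>i\<in>{..degree h + j} - {degree h}. coeff h i * coeff p (degree h + j - i))"
      unfolding coeff_mult by (subst sum.remove[of _ "degree h"]) auto
    with dv[of j] have "e dvd lead_coeff h * coeff p j"
      by (simp only: dvd_add_left_iff[OF sum])
    then show ?thesis by (rule lc)
  qed
qed

text \<open>A maximal ideal of \<open>K[s][t]\<close> meets \<open>K[s]\<close>: take \<open>h\<close> in the ideal of least degree in
  \<open>t\<close>, with leading coefficient \<open>c\<close>; if the degree is positive, then the polynomial \<open>1 + s c\<close>
  is neither in the ideal nor invertible modulo it.\<close>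

lemma maximal_meets_constants:
  fixes q :: "'k::field poly poly set"
  assumes add: "\<And>a b. a \<in> q \<Longrightarrow> b \<in> q \<Longrightarrow> a + b \<in> q"
    and mult: "\<And>a b. b \<in> q \<Longrightarrow> a * b \<in> q"
    and max: "\<And>b. b \<notin> q \<Longrightarrow> \<exists>y. 1 + b * y \<in> q"
  shows "\<exists>f. f \<noteq> 0 \<and> [:f:] \<in> q"
proof (rule ccontr)
  assume "\<not> ?thesis"
  then have const: "[:f:] \<notin> q" if "f \<noteq> 0" for f using that by blast
  have "\<exists>h. h \<in> q \<and> h \<noteq> 0"
  proof (cases "[:0, 1:] \<in> q")
    case False
    then obtain y where y: "1 + [:0, 1:] * y \<in> q" using max by blast
    have "coeff (1 + [:0, 1:] * y) 0 \<noteq> 0" by simp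
    then have "1 + [:0, 1:] * y \<noteq> 0" by (metis coeff_0)
    then show ?thesis using y by blast
  qed (auto intro!: exI[of _ "[:0, 1:]"])
  then obtain h where h: "h \<in> q" "h \<noteq> 0" and min: "\<And>p. p \<in> q \<Longrightarrow> p \<noteq> 0 \<Longrightarrow> degree h \<le> degree p"
    using ex_has_least_nat[of "\<lambda>h. h \<in> q \<and> h \<noteq> 0" _ degree] by blast
  define c where "c = lead_coeff h"
  \<comment> \<open>The factor s makes \<open>e\<close> non-constant even if \<open>c\<close> is a
    scalar, hence a non-unit; at the same time e is 1 modulo c, so \<open>c\<close> is regular
    modulo \<open>e\<close>.\<close>
  define e where "e = 1 + [:0, 1:] * c"
  have c0: "c \<noteq> 0" using h by (simp add: c_def)
  have deg: "degree h > 0"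
  proof (rule ccontr)
    assume "\<not> degree h > 0"
    then have "h = [:c:]" unfolding c_def by (metis degree_eq_zeroE lead_coeff_pCons(2) not_gr_zero pCons_0_0)
    then show False using const[OF c0] h by simp
  qed
  have e: "e = pCons 1 c" by (simp add: e_def one_pCons)
  have e0: "e \<noteq> 0" and ne: "\<not> e dvd 1" using c0 by (auto simp: e is_unit_iff_degree)
  have reg: "e dvd x" if "e dvd c * x" for x
  proof -
    have "x = e * x - [:0, 1:] * (c * x)" by (simp add: e_def algebra_simps)
    then show ?thesis using that by (metis dvd_diff dvd_mult dvd_triv_left)
  qed
  obtain y where y: "1 + [:e:] * y \<in> q" using max const[OF e0] by blast
  obtain Q R where QR: "pseudo_divmod (1 + [:e:] * y) h = (Q, R)" by fastforce
  define k where "k = Suc (degree (1 + [:e:] * y)) - degree h"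
  have eq: "smult (c ^ k) (1 + [:e:] * y) = h * Q + R" and R: "R = 0 \<or> degree R < degree h"
    using pseudo_divmod[OF h(2) QR] by (simp_all add: c_def k_def)
  have Req: "R = [:c ^ k:] * (1 + [:e:] * y) + (- Q) * h" using eq by (simp add: algebra_simps)
  \<comment> \<open>The remainder is a combination of elements of \<open>q\<close> and has degree
    below that of \<open>h\<close>, so minimality of \<open>h\<close> makes it vanish.\<close>
  have "R \<in> q" by (subst Req) (intro add mult y h(1))
  then have "R = 0" using R min by fastforce
  then have eq: "h * Q = smult (c ^ k) (1 + [:e:] * y)" using eq by simp
  \<comment> \<open>The summand 1 in 1 + e y only affects degree 0, which is below
    \<open>degree h\<close>. From \<open>degree h\<close> on, all coefficients of c^k (1 + e y) are
    multiples of \<open>e\<close>, and division by \<open>h\<close> passes this to \<open>Q\<close>.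
    The constant coefficient then gives that e divides c^k, hence 1.\<close>
  have "e dvd coeff Q j" for j
  proof (rule dvd_coeff_of_mult[of _ h])
    show "e dvd coeff (h * Q) (degree h + j)" for j
      unfolding eq using deg by (cases "degree h + j") (auto simp: mult.left_commute[of _ e])
  qed (rule reg, simp add: c_def)
  then have "e dvd coeff (h * Q) 0" by (simp add: coeff_mult)
  then have "e dvd c ^ k + e * (c ^ k * coeff y 0)" unfolding eq by (simp add: algebra_simps)
  then have "e dvd c ^ k * 1" by (simp add: dvd_add_left_iff)
  then have "e dvd 1"
  proof (induction k)
    case (Suc k)
    then show ?case using reg[of "c ^ k"] by (simp add: mult.assoc)
  qed auto
  then show False using ne by simp
qed

text \<open>With M the \<open>B\<close>-module spanned by \<open>G\<close>, the hypothesis says that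
  M is contained in N + b M, and the conclusion that some 1 + b y maps M into \<open>N\<close>.
  Instead of a determinant, the generators are eliminated one at a time, with \<open>N\<close>
  enlarged by the multiples of the generator \<open>m\<close> set aside.\<close>

lemma nakayama:
  fixes B :: "'r::comm_ring_1 set"
  assumes B: "0 \<in> B" "1 \<in> B" "\<And>x y. x \<in> B \<Longrightarrow> y \<in> B \<Longrightarrow> x + y \<in> B"
    "\<And>x y. x \<in> B \<Longrightarrow> y \<in> B \<Longrightarrow> x * y \<in> B" "\<And>x. x \<in> B \<Longrightarrow> - x \<in> B"
    and b: "b \<in> B" and "finite G"
    and N: "0 \<in> N" "\<And>x y. x \<in> N \<Longrightarrow> y \<in> N \<Longrightarrow> x + y \<in> N" "\<And>x y. x \<in> B \<Longrightarrow> y \<in> N \<Longrightarrow> x * y \<in> N"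
    and gen: "\<And>g. g \<in> G \<Longrightarrow> \<exists>c. (\<forall>h\<in>G. c h \<in> B) \<and> g - b * (\<Sum>h\<in>G. c h * h) \<in> N"
  shows "\<exists>y\<in>B. \<forall>g\<in>G. (1 + b * y) * g \<in> N"
  using \<open>finite G\<close> N gen
proof (induction G arbitrary: N rule: finite_induct)
  case empty
  then show ?case using B by auto
next
  case (insert m G)
  have sumB: "(\<Sum>h\<in>A. f h) \<in> B" if "\<And>h. h \<in> A \<Longrightarrow> f h \<in> B" for A :: "'r set" and f
    using that by (induction A rule: infinite_finite_induct) (auto simp: B)
  have sumN: "(\<Sum>h\<in>A. f h) \<in> N" if "\<And>h. h \<in> A \<Longrightarrow> f h \<in> N" for A :: "'r set" and f
    using that by (induction A rule: infinite_finite_induct) (auto simp: insert.prems)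
  define N' where "N' = {n + z * m | n z. n \<in> N \<and> z \<in> B}"
  have N'I: "n + z * m \<in> N'" if "n \<in> N" "z \<in> B" for n z using that unfolding N'_def by blast
  have "\<exists>y\<in>B. \<forall>g\<in>G. (1 + b * y) * g \<in> N'"
  proof (rule insert.IH)
    show "0 \<in> N'" using N'I[of 0 0] B insert.prems by simp
    show "x + y \<in> N'" if xy: "x \<in> N'" "y \<in> N'" for x y
    proof -
      obtain n z where "x = n + z * m" "n \<in> N" "z \<in> B" using xy(1) unfolding N'_def by blast
      moreover obtain n' z' where "y = n' + z' * m" "n' \<in> N" "z' \<in> B" using xy(2) unfolding N'_def by blast
      ultimately show ?thesis using N'I[of "n + n'" "z + z'"] B(3) insert.prems(2) by (simp add: algebra_simps)
    qed
    show "x * y \<in> N'" if xy: "x \<in> B" "y \<in> N'" for x y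
    proof -
      obtain n z where "y = n + z * m" "n \<in> N" "z \<in> B" using xy(2) unfolding N'_def by blast
      then show ?thesis
        using N'I[OF insert.prems(3)[OF xy(1)] B(4)[OF xy(1)], of n z] by (simp add: algebra_simps)
    qed
    fix g assume g: "g \<in> G"
    then obtain c where c: "\<forall>h\<in>insert m G. c h \<in> B" "g - b * (\<Sum>h\<in>insert m G. c h * h) \<in> N"
      using insert.prems(4)[of g] by blast
    have "g - b * (\<Sum>h\<in>G. c h * h) = (g - b * (\<Sum>h\<in>insert m G. c h * h)) + (b * c m) * m"
      using insert.hyps by (simp add: algebra_simps)
    also have "\<dots> \<in> N'" using c b B by (intro N'I) auto
    finally show "\<exists>c. (\<forall>h\<in>G. c h \<in> B) \<and> g - b * (\<Sum>h\<in>G. c h * h) \<in> N'" using c by blast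
  qed
  then obtain y where y: "y \<in> B" "\<forall>g\<in>G. (1 + b * y) * g \<in> N'" by blast
  define x where "x = 1 + b * y"
  have xB: "x \<in> B" using y b B by (simp add: x_def)
  have "\<forall>g\<in>G. \<exists>n z. x * g = n + z * m \<and> n \<in> N \<and> z \<in> B"
    using y unfolding x_def N'_def by blast
  then obtain n z where nz: "\<And>g. g \<in> G \<Longrightarrow> x * g = n g + z g * m"
    "\<And>g. g \<in> G \<Longrightarrow> n g \<in> N" "\<And>g. g \<in> G \<Longrightarrow> z g \<in> B" by metis
  obtain c where c: "\<forall>h\<in>insert m G. c h \<in> B" "m - b * (\<Sum>h\<in>insert m G. c h * h) \<in> N"
    using insert.prems(4)[of m] by blast
  \<comment> \<open>Multiply the relation for \<open>m\<close> by \<open>x\<close> and replace each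
    x h by n h + z h m. The coefficients of \<open>m\<close> then collect to x - b w, and what
    remains lies in \<open>N\<close>.\<close>
  define w where "w = (\<Sum>h\<in>G. c h * z h) + c m * x"
  have wB: "w \<in> B" unfolding w_def using c nz xB B by (auto intro!: B(3) sumB)
  define x' where "x' = x - b * w"
  have x'B: "x' \<in> B" unfolding x'_def using B(3)[OF xB B(5)[OF B(4)[OF b wB]]] by simp
  have "(\<Sum>h\<in>G. c h * (x * h)) = (\<Sum>h\<in>G. c h * (n h + z h * m))"
    by (intro sum.cong) (simp_all add: nz(1))
  also have "\<dots> = (\<Sum>h\<in>G. c h * n h) + (\<Sum>h\<in>G. c h * z h) * m"
    by (simp add: algebra_simps sum.distrib sum_distrib_left)
  finally have s: "(\<Sum>h\<in>G. c h * (x * h)) = \<dots>" .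
  have "x * (\<Sum>h\<in>G. c h * h) = (\<Sum>h\<in>G. c h * (x * h))"
    by (simp add: sum_distrib_left mult.left_commute)
  note s = this[unfolded s]
  have "x' * m = x * m - b * ((\<Sum>h\<in>G. c h * z h) * m + c m * x * m)"
    by (simp add: x'_def w_def algebra_simps)
  also have "(\<Sum>h\<in>G. c h * z h) * m = x * (\<Sum>h\<in>G. c h * h) - (\<Sum>h\<in>G. c h * n h)"
    using s by simp
  also have "x * m - b * (x * (\<Sum>h\<in>G. c h * h) - (\<Sum>h\<in>G. c h * n h) + c m * x * m) =
      x * (m - b * (\<Sum>h\<in>insert m G. c h * h)) + b * (\<Sum>h\<in>G. c h * n h)"
    using insert.hyps by (simp add: algebra_simps)
  also have "\<dots> \<in> N"
  proof (rule insert.prems(2)[OF insert.prems(3)[OF xB c(2)]])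
    show "b * (\<Sum>h\<in>G. c h * n h) \<in> N"
      by (intro insert.prems(3) b sumN) (use c nz(2) in auto)
  qed
  finally have x'm: "x' * m \<in> N" .
  \<comment> \<open>The factor x' brings \<open>m\<close> into \<open>N\<close>; the factor x first
    moves every other generator into N + B m. Their product serves all generators and is again 1
    plus a multiple of \<open>b\<close>.\<close>
  have "1 + b * (y - w + y + y * (b * (y - w))) = x' * x"
    by (simp add: x'_def x_def algebra_simps)
  moreover have "y - w + y + y * (b * (y - w)) \<in> B"
  proof -
    have "y - w \<in> B" using B(3)[OF y(1) B(5)[OF wB]] by simp
    then show ?thesis by (intro B(3,4) y(1) b)
  qed
  moreover have "x' * x * g \<in> N" if "g \<in> insert m G" for g
  proof (cases "g = m")
    case True
    then show ?thesis using insert.prems(3)[OF xB x'm] by (simp add: mult_ac)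
  next
    case False
    then have g: "g \<in> G" using that by simp
    have "x' * x * g = x' * (x * g)" by (simp add: mult.assoc)
    also have "\<dots> = x' * n g + z g * (x' * m)" unfolding nz(1)[OF g] by (simp add: algebra_simps)
    finally have "x' * x * g = x' * n g + z g * (x' * m)" .
    then show ?thesis using g nz(2,3) x'B x'm insert.prems(2,3) by simp
  qed
  ultimately show ?case by metis
qed

section \<open>Algebraic dependence by counting monomials\<close>

text \<open>Bounding the two variables separately makes the bounds additive under products and
  leaves exactly (N + 1)^2 monomials.\<close>

definition degree_bounded :: "nat \<Rightarrow> 'k::field poly poly \<Rightarrow> bool" where
  "degree_bounded N p \<longleftrightarrow> (\<forall>i j. coeff (coeff p j) i \<noteq> 0 \<longrightarrow> i \<le> N \<and> j \<le> N)"

lemma degree_bounded_exists: "\<exists>N. degree_bounded N p"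
proof -
  have "degree_bounded (degree p + (\<Sum>j\<le>degree p. degree (coeff p j))) p"
    unfolding degree_bounded_def
  proof (intro allI impI conjI)
    fix i j assume nz: "coeff (coeff p j) i \<noteq> 0"
    then have "coeff p j \<noteq> 0" by auto
    then have j: "j \<le> degree p" by (rule le_degree)
    then show "j \<le> degree p + (\<Sum>j\<le>degree p. degree (coeff p j))" by simp
    have "i \<le> degree (coeff p j)" using nz by (rule le_degree)
    also have "\<dots> \<le> (\<Sum>j\<le>degree p. degree (coeff p j))"
      using j by (intro member_le_sum) auto
    finally show "i \<le> degree p + (\<Sum>j\<le>degree p. degree (coeff p j))" by simp
  qed
  then show ?thesis by blast
qed

lemma degree_bounded_mono: "degree_bounded N p \<Longrightarrow> N \<le> M \<Longrightarrow> degree_bounded M p"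
  unfolding degree_bounded_def using order_trans by blast

lemma degree_bounded_mult:
  assumes "degree_bounded N p" "degree_bounded M q"
  shows "degree_bounded (N + M) (p * q)"
  unfolding degree_bounded_def
proof (intro allI impI)
  fix i j assume "coeff (coeff (p * q) j) i \<noteq> 0"
  then have "(\<Sum>l\<le>j. \<Sum>k\<le>i. coeff (coeff p l) k * coeff (coeff q (j - l)) (i - k)) \<noteq> 0"
    by (simp add: coeff_mult coeff_sum)
  then obtain l where "l \<le> j" "(\<Sum>k\<le>i. coeff (coeff p l) k * coeff (coeff q (j - l)) (i - k)) \<noteq> 0"
    by (meson atMost_iff sum.neutral)
  then obtain k where "k \<le> i" "coeff (coeff p l) k * coeff (coeff q (j - l)) (i - k) \<noteq> 0"
    by (meson atMost_iff sum.neutral)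
  then have "k \<le> N" "l \<le> N" "i - k \<le> M" "j - l \<le> M" using assms unfolding degree_bounded_def by auto
  then show "i \<le> N + M \<and> j \<le> N + M" using \<open>l \<le> j\<close> \<open>k \<le> i\<close> by linarith
qed

lemma degree_bounded_power:
  assumes "degree_bounded N p"
  shows "degree_bounded (a * N) (p ^ a)"
proof (induction a)
  case 0
  then show ?case by (auto simp: degree_bounded_def one_pCons coeff_pCons split: nat.splits)
next
  case (Suc a)
  then show ?case using degree_bounded_mult[OF assms Suc] by simp
qed

text \<open>There are more vectors than monomials that can occur in them. Linear dependence is a
  notion for sets, so a family with a repeated member is handled on its own, by the difference of
  the two equal members.\<close>

lemma linear_relation:
  fixes v :: "'i \<Rightarrow> 'k::field poly poly"
  assumes I: "finite I" "card I > Suc N * Suc N" and v: "\<And>i. i \<in> I \<Longrightarrow> degree_bounded N (v i)"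
  shows "\<exists>q. (\<exists>i\<in>I. q i \<noteq> 0) \<and> (\<Sum>i\<in>I. smult [:q i:] (v i)) = 0"
proof (cases "inj_on v I")
  case False
  then obtain i j where ij: "i \<in> I" "j \<in> I" "i \<noteq> j" "v i = v j" by (auto simp: inj_on_def)
  let ?q = "\<lambda>k. if k = i then 1 else if k = j then - 1 else (0 :: 'k)"
  have "(\<Sum>k\<in>I. smult [:?q k:] (v k)) = (\<Sum>k\<in>{i, j}. smult [:?q k:] (v k))"
    using I ij by (intro sum.mono_neutral_right) auto
  also have "\<dots> = smult [:1:] (v i) + smult [:- 1:] (v i)" using ij by simp
  also have "\<dots> = 0" by (simp flip: smult_add_left)
  finally show ?thesis using ij by (intro exI[of _ ?q]) auto
next
  case True
  interpret vector_space "\<lambda>(c :: 'k) (p :: 'k poly poly). smult [:c:] p"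
  proof
    show "smult [:a + b:] p = smult [:a:] p + smult [:b:] p" for a b :: 'k and p :: "'k poly poly"
      by (simp flip: smult_add_left)
  qed (simp_all add: smult_add_right mult.commute flip: one_pCons)
  let ?M = "(\<lambda>(i, j). monom (monom (1 :: 'k) i) j) ` ({..N} \<times> {..N})"
  have mem: "p \<in> span ?M" if "degree_bounded N p" for p
  proof -
    have "p = (\<Sum>j\<le>N. \<Sum>i\<le>N. smult [:coeff (coeff p j) i:] (monom (monom 1 i) j))"
    proof (intro poly_eqI)
      fix j i
      have "coeff (coeff (\<Sum>j\<le>N. \<Sum>i\<le>N. smult [:coeff (coeff p j) i:] (monom (monom 1 i) j)) j) i
        = (\<Sum>j'\<le>N. \<Sum>i'\<le>N. if j' = j then if i' = i then coeff (coeff p j) i else 0 else 0)"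
        unfolding coeff_sum by (intro sum.cong) auto
      also have "\<dots> = (\<Sum>j'\<le>N. if j' = j then \<Sum>i'\<le>N. if i' = i then coeff (coeff p j) i else 0 else 0)"
        by (intro sum.cong) auto
      also have "\<dots> = coeff (coeff p j) i"
        using that by (auto simp: degree_bounded_def)
      finally show "coeff (coeff p j) i =
        coeff (coeff (\<Sum>j\<le>N. \<Sum>i\<le>N. smult [:coeff (coeff p j) i:] (monom (monom 1 i) j)) j) i" ..
    qed
    also have "\<dots> \<in> span ?M" by (intro span_sum span_scale span_base) auto
    finally show ?thesis .
  qed
  have "card ?M \<le> Suc N * Suc N"
    using card_image_le[of "{..N} \<times> {..N}" "\<lambda>(i, j). monom (monom (1 :: 'k) i) j"] by simp
  then have "card (v ` I) > card ?M" using I card_image[OF True] by simp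
  then have "dependent (v ` I)"
    using independent_span_bound[of ?M "v ` I"] mem v by fastforce
  then obtain u where u: "\<exists>p\<in>v ` I. u p \<noteq> 0" "(\<Sum>p\<in>v ` I. smult [:u p:] p) = 0"
    using dependent_finite[of "v ` I"] I by auto
  show ?thesis
  proof (intro exI[of _ "\<lambda>i. u (v i)"] conjI)
    show "\<exists>i\<in>I. u (v i) \<noteq> 0" using u(1) by auto
    show "(\<Sum>i\<in>I. smult [:u (v i):] (v i)) = 0" using u(2) by (simp add: sum.reindex[OF True])
  qed
qed

text \<open>The (M + 1)^3 products of powers grow faster in M than the (3 N M + 1)^2 monomials
  available to them. The sum is nested, with powers of \<open>x\<close> outermost, so that it can be
  read along a chain of primes.\<close>

lemma algebraic_relation:
  fixes x y z :: "'k::field poly poly"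
  shows "\<exists>M q. (\<exists>a\<le>M. \<exists>b\<le>M. \<exists>c\<le>M. q a b c \<noteq> 0) \<and>
    (\<Sum>a\<le>M. (\<Sum>b\<le>M. (\<Sum>c\<le>M. [:[:q a b c:]:] * z ^ c) * y ^ b) * x ^ a) = 0"
proof -
  obtain N1 N2 N3 where "degree_bounded N1 x" "degree_bounded N2 y" "degree_bounded N3 z"
    using degree_bounded_exists by metis
  then obtain N where N: "degree_bounded N x" "degree_bounded N y" "degree_bounded N z"
    using degree_bounded_mono[of _ _ "N1 + N2 + N3"] by (metis le_add1 le_add2 trans_le_add1)
  \<comment> \<open>With this M, (3 N M + 1)^2 <= (3 N + 1)^2 (M + 1)^2 = M (M + 1)^2 < (M +
    1)^3.\<close>
  define M where "M = Suc (3 * N) * Suc (3 * N)"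
  let ?I = "{..M} \<times> {..M} \<times> {..M}"
  let ?v = "\<lambda>(a, b, c). z ^ c * y ^ b * x ^ a"
  have "degree_bounded (3 * N * M) (?v i)" if i: "i \<in> ?I" for i
  proof -
    obtain a b c where abc: "i = (a, b, c)" "a \<le> M" "b \<le> M" "c \<le> M" using i by auto
    have "c * N + b * N + a * N = (a + b + c) * N" by (simp add: algebra_simps)
    also have "\<dots> \<le> (3 * M) * N" using abc by (intro mult_right_mono) auto
    finally have "c * N + b * N + a * N \<le> 3 * N * M" by (simp add: ac_simps)
    then show ?thesis
      using degree_bounded_mult[OF degree_bounded_mult[OF degree_bounded_power[OF N(3), of c]
          degree_bounded_power[OF N(2), of b]] degree_bounded_power[OF N(1), of a]]
      unfolding abc(1) prod.case by (rule degree_bounded_mono[rotated])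
  qed
  moreover have "card ?I > Suc (3 * N * M) * Suc (3 * N * M)"
  proof -
    have "Suc (3 * N * M) \<le> Suc (3 * N) * Suc M" by simp
    then have "Suc (3 * N * M) * Suc (3 * N * M) \<le> (Suc (3 * N) * Suc M) * (Suc (3 * N) * Suc M)"
      by (intro mult_mono) auto
    also have "\<dots> = M * (Suc M * Suc M)" by (simp only: M_def ac_simps)
    also have "\<dots> < Suc M * (Suc M * Suc M)" by simp
    finally show ?thesis by (simp add: card_cartesian_product)
  qed
  ultimately obtain q where q: "\<exists>i\<in>?I. q i \<noteq> 0" "(\<Sum>i\<in>?I. smult [:q i:] (?v i)) = 0"
    using linear_relation[of ?I "3 * N * M" ?v] by auto
  have "(\<Sum>a\<le>M. (\<Sum>b\<le>M. (\<Sum>c\<le>M. [:[:q (a, b, c):]:] * z ^ c) * y ^ b) * x ^ a) =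
      (\<Sum>i\<in>?I. smult [:q i:] (?v i))"
    by (simp add: sum.cartesian_product sum_distrib_right mult.assoc split_def)
  then show ?thesis using q by (intro exI[of _ M] exI[of _ "\<lambda>a b c. q (a, b, c)"]) auto
qed

section \<open>Supports and leading terms\<close>

text \<open>Let m be the largest exponent of \<open>p\<close> that violates \<open>G\<close>. In
  degree m + degree f, any other contribution would involve a coefficient of \<open>p\<close> at m
  plus a positive multiple of \<open>D\<close>; there \<open>G\<close> holds by maximality and would
  descend to m. So nothing cancels the leading product, \<open>G\<close> holds at m + degree f, and
  it descends to m after all.\<close>

lemma support_of_mult:
  fixes f p :: "'k::field poly"
  assumes f: "f \<noteq> 0" "\<And>i. coeff f i \<noteq> 0 \<Longrightarrow> D dvd i"
    and G: "\<And>i k. G (i + k * D) \<Longrightarrow> G i"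
    and fp: "\<And>i. coeff (f * p) i \<noteq> 0 \<Longrightarrow> G i" and i: "coeff p i \<noteq> 0"
  shows "G i"
proof (rule ccontr)
  assume "\<not> G i"
  let ?B = "{i. coeff p i \<noteq> 0 \<and> \<not> G i}"
  have fin: "finite ?B" by (rule finite_subset[of _ "{..degree p}"]) (auto intro: le_degree)
  define m where "m = Max ?B"
  have m: "coeff p m \<noteq> 0" "\<not> G m" using Max_in[OF fin] i \<open>\<not> G i\<close> unfolding m_def by auto
  have big: "G l" if "coeff p l \<noteq> 0" "l > m" for l
    using Max_ge[OF fin, of l] that unfolding m_def by auto
  obtain k where k: "degree f = k * D" using f by (metis dvdE leading_coeff_0_iff mult.commute)
  have "coeff f l * coeff p (m + k * D - l) = 0" if l: "l \<noteq> k * D" for l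
  proof (rule ccontr)
    assume nz: "coeff f l * coeff p (m + k * D - l) \<noteq> 0"
    then have "l \<le> degree f" "D dvd l" using f(2) by (auto intro: le_degree)
    then obtain r where r: "l = r * D" "r * D < k * D" using l k by (metis dvd_def le_neq_implies_less mult.commute)
    then have eq: "m + k * D - l = m + (k - r) * D" by (simp add: diff_mult_distrib)
    have "r < k" using r(2) by simp
    then have "(k - r) * D > 0" using r(2) by (simp add: diff_mult_distrib)
    then have "G (m + (k - r) * D)" using big[of "m + (k - r) * D"] nz eq by auto
    then show False using G m by blast
  qed
  then have "coeff (f * p) (m + k * D) = (\<Sum>l\<in>{k * D}. coeff f l * coeff p (m + k * D - l))"
    unfolding coeff_mult by (intro sum.mono_neutral_right) auto
  then have "coeff (f * p) (m + k * D) \<noteq> 0" using m f(1) by (simp flip: k)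
  then show False using fp G m by blast
qed

lemma pcompose_monom_monom: "pcompose (monom c a) (monom 1 D) = monom c (a * D)"
  for c :: "'a::comm_ring_1"
  by (induction a) (simp_all add: monom_Suc pcompose_pCons mult_monom monom_0)

lemma dvd_of_coeff_pcompose_monom:
  fixes p :: "'a::comm_ring_1 poly"
  shows "coeff (pcompose p (monom 1 D)) i \<noteq> 0 \<Longrightarrow> D dvd i"
proof (induction p arbitrary: i)
  case (pCons a p)
  show ?case
  proof (cases "i = 0")
    case False
    then have "i \<ge> D" "coeff (pcompose p (monom 1 D)) (i - D) \<noteq> 0"
      using pCons.prems
      by (auto simp: pcompose_pCons coeff_monom_mult coeff_pCons split: nat.splits if_splits)
    then show ?thesis using pCons.IH[of "i - D"] by (simp add: dvd_minus_self)
  qed simp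
qed simp

text \<open>The inner variable is u and the outer one v, so \<open>coeff (coeff p j) i\<close> is
  the coefficient of u^i v^j. For a semigroup \<open>S\<close> this is the semigroup ring
  K[S].\<close>

definition supported :: "(nat \<times> nat) set \<Rightarrow> 'k::field poly poly set" where
  "supported S = {p. \<forall>i j. coeff (coeff p j) i \<noteq> 0 \<longrightarrow> (i, j) \<in> S}"

lemma supported_induct [consumes 1, case_names zero add monom]:
  assumes p: "p \<in> supported S" and zero: "P 0"
    and add: "\<And>a b. P a \<Longrightarrow> P b \<Longrightarrow> P (a + b)"
    and monom: "\<And>i j c. (i, j) \<in> S \<Longrightarrow> P (monom (monom c i) j)"
  shows "P p"
proof -
  have sum: "P (\<Sum>i\<in>I. f i)" if "\<And>i. i \<in> I \<Longrightarrow> P (f i)" for I :: "nat set" and f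
    using that by (induction I rule: infinite_finite_induct) (auto intro: zero add)
  have "P (monom (monom (coeff (coeff p j) i) i) j)" for i j
  proof (cases "coeff (coeff p j) i = 0")
    case True
    then show ?thesis using zero by simp
  next
    case False
    then show ?thesis using p monom by (auto simp: supported_def)
  qed
  then have "P (\<Sum>j\<le>degree p. \<Sum>i\<le>degree (coeff p j). monom (monom (coeff (coeff p j) i) i) j)"
    by (intro sum)
  also have "(\<Sum>j\<le>degree p. \<Sum>i\<le>degree (coeff p j). monom (monom (coeff (coeff p j) i) i) j) = p"
  proof -
    have "(\<Sum>i\<le>degree (coeff p j). monom (monom (coeff (coeff p j) i) i) j) = monom (coeff p j) j" for j
    proof -
      have "(\<Sum>i\<in>I. monom (f i) j) = monom (\<Sum>i\<in>I. f i) j" for I :: "nat set" and f :: "nat \<Rightarrow> 'a poly"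
        by (induction I rule: infinite_finite_induct) (simp_all add: add_monom)
      then show ?thesis by (simp add: poly_as_sum_of_monoms)
    qed
    then show ?thesis by (simp add: poly_as_sum_of_monoms)
  qed
  finally show ?thesis .
qed

text \<open>The termination measure of division with v above u. Since \<open>degree 0 = 0\<close>,
  the \<open>Suc\<close> is what places 0 strictly below the non-zero polynomials of v-degree
  0.\<close>

definition lex_rank :: "'k::field poly poly \<Rightarrow> nat \<times> nat" where
  "lex_rank p = (if p = 0 then 0 else Suc (degree p), degree (lead_coeff p))"

lemma cancel_leading_term:
  fixes p g :: "'k::field poly poly"
  assumes p: "p \<noteq> 0" and g: "g \<noteq> 0" and deg: "degree p = degree g + b"
    "degree (lead_coeff p) = degree (lead_coeff g) + a"
  shows "\<exists>c. (lex_rank (p - monom (monom c a) b * g), lex_rank p) \<in> less_than <*lex*> less_than"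
proof -
  define c where "c = lead_coeff (lead_coeff p) / lead_coeff (lead_coeff g)"
  have c: "c \<noteq> 0" using p g by (simp add: c_def)
  let ?m = "monom (monom c a) b"
  let ?r = "p - ?m * g"
  have m: "degree ?m = b" "lead_coeff ?m = monom c a" using c by (simp_all add: degree_monom_eq)
  have dm: "degree (?m * g) = degree p"
    using c g deg by (subst degree_mult_eq) (simp_all add: m)
  have "lead_coeff (?m * g) = lead_coeff ?m * lead_coeff g" by (rule lead_coeff_mult)
  also have "lead_coeff ?m = monom c a" by (rule m(2))
  finally have "lead_coeff (?m * g) = monom c a * lead_coeff g" .
  then have lm: "coeff (?m * g) (degree p) = monom c a * lead_coeff g" by (simp only: dm)
  have le: "degree ?r \<le> degree p" using dm by (intro degree_diff_le) simp_all
  \<comment> \<open>The top v-coefficients of both polynomials have the same u-degree and, by the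
    choice of \<open>c\<close>, the same leading scalar. So either the v-degree drops, or the
    u-degree of the top coefficient does.\<close>
  have "lex_rank ?r = (0, 0) \<or> degree ?r < degree p \<or>
    (degree ?r = degree p \<and> ?r \<noteq> 0 \<and> degree (lead_coeff ?r) < degree (lead_coeff p))"
  proof (cases "?r = 0 \<or> degree ?r < degree p")
    case True
    then show ?thesis by (auto simp: lex_rank_def)
  next
    case False
    then have eq: "degree ?r = degree p" and nz: "?r \<noteq> 0" using le by auto
    have lr: "lead_coeff ?r = lead_coeff p - monom c a * lead_coeff g" unfolding eq by (simp add: lm)
    have dg: "degree (monom c a * lead_coeff g) = degree (lead_coeff p)"
      using c g deg by (subst degree_mult_eq) (simp_all add: degree_monom_eq)
    have "lead_coeff (monom c a * lead_coeff g) = c * lead_coeff (lead_coeff g)"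
      using c by (simp only: lead_coeff_mult) (simp add: degree_monom_eq)
    then have "coeff (monom c a * lead_coeff g) (degree (lead_coeff p)) = lead_coeff (lead_coeff p)"
      using g by (simp only: dg) (simp add: c_def)
    then have "coeff (lead_coeff ?r) (degree (lead_coeff p)) = 0" unfolding lr by simp
    moreover have "degree (lead_coeff ?r) \<le> degree (lead_coeff p)"
      unfolding lr using dg by (intro degree_diff_le) simp_all
    moreover have "lead_coeff ?r \<noteq> 0" unfolding leading_coeff_0_iff by (rule nz)
    ultimately have "degree (lead_coeff ?r) < degree (lead_coeff p)"
      by (metis le_neq_implies_less leading_coeff_0_iff)
    then show ?thesis using eq nz by blast
  qed
  then have "(lex_rank ?r, lex_rank p) \<in> less_than <*lex*> less_than"
    using p by (auto simp: lex_rank_def)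
  then show ?thesis by blast
qed

section \<open>Affine semigroup rings in the plane\<close>

text \<open>\<open>\<psi>\<close> identifies the abstract ring with K[S] inside K[u, v], so that
  arithmetic takes place in a type-class ring while ideals remain those of \<open>A\<close>. The two
  pure powers in \<open>S\<close> make K[u^D, v^D] a subring over which K[S] is a finite
  module.\<close>

locale plane_semigroup_ring = cring A for A (structure) +
  fixes \<psi> :: "'a \<Rightarrow> 'k::field poly poly" and S :: "(nat \<times> nat) set" and D :: nat
  assumes psi_add: "\<lbrakk>x \<in> carrier A; y \<in> carrier A\<rbrakk> \<Longrightarrow> \<psi> (x \<oplus> y) = \<psi> x + \<psi> y"
    and psi_mult: "\<lbrakk>x \<in> carrier A; y \<in> carrier A\<rbrakk> \<Longrightarrow> \<psi> (x \<otimes> y) = \<psi> x * \<psi> y"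
    and psi_one: "\<psi> \<one> = 1"
    and psi_inj: "inj_on \<psi> (carrier A)"
    and psi_image: "\<psi> ` carrier A = supported S"
    and D_pos: "D > 0"
    and S_u: "(D, 0) \<in> S" and S_v: "(0, D) \<in> S"
    and S_zero: "(0, 0) \<in> S"
    and S_add: "\<lbrakk>(i, j) \<in> S; (k, l) \<in> S\<rbrakk> \<Longrightarrow> (i + k, j + l) \<in> S"
begin

section \<open>The ring and its ideals seen inside K[u, v]\<close>

lemma psi_closed: "x \<in> carrier A \<Longrightarrow> \<psi> x \<in> supported S"
  using psi_image by blast

lemma psi_surj:
  assumes "p \<in> supported S"
  obtains x where "x \<in> carrier A" "\<psi> x = p"
  using assms psi_image by (metis imageE)

lemma psi_zero: "\<psi> \<zero> = 0"
proof -
  have "\<psi> \<zero> + \<psi> \<zero> = \<psi> \<zero> + 0" using psi_add[of \<zero> \<zero>] by simp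
  then show ?thesis by (simp only: add_left_cancel)
qed

lemma psi_eq_iff: "\<lbrakk>x \<in> carrier A; y \<in> carrier A\<rbrakk> \<Longrightarrow> \<psi> x = \<psi> y \<longleftrightarrow> x = y"
  using psi_inj by (auto simp: inj_on_def)

lemma supported_zero: "0 \<in> supported S"
  by (simp add: supported_def)

lemma supported_add:
  fixes p q :: "'k poly poly"
  assumes "p \<in> supported S" "q \<in> supported S"
  shows "p + q \<in> supported S"
proof -
  obtain x where x: "x \<in> carrier A" "\<psi> x = p" using assms(1) by (rule psi_surj)
  obtain y where y: "y \<in> carrier A" "\<psi> y = q" using assms(2) by (rule psi_surj)
  have "\<psi> (x \<oplus> y) \<in> supported S" using x y by (intro psi_closed) simp
  then show ?thesis using x y by (simp add: psi_add)
qed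

lemma supported_mult:
  fixes p q :: "'k poly poly"
  assumes "p \<in> supported S" "q \<in> supported S"
  shows "p * q \<in> supported S"
proof -
  obtain x where x: "x \<in> carrier A" "\<psi> x = p" using assms(1) by (rule psi_surj)
  obtain y where y: "y \<in> carrier A" "\<psi> y = q" using assms(2) by (rule psi_surj)
  have "\<psi> (x \<otimes> y) \<in> supported S" using x y by (intro psi_closed) simp
  then show ?thesis using x y by (simp add: psi_mult)
qed

lemma supported_monom: "(i, j) \<in> S \<Longrightarrow> Polynomial.monom (Polynomial.monom c i) j \<in> supported S"
  by (auto simp: supported_def)

lemma supported_const: "[:[:c:]:] \<in> supported S"
  using supported_monom[OF S_zero, of c] by (simp add: monom_0)

lemma supported_one: "(1 :: 'k poly poly) \<in> supported S"
  using psi_closed[OF one_closed] by (simp add: psi_one)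

lemma supported_sum:
  fixes f :: "'i \<Rightarrow> 'k poly poly"
  assumes "\<And>i. i \<in> I \<Longrightarrow> f i \<in> supported S"
  shows "(\<Sum>i\<in>I. f i) \<in> supported S"
  using assms
  by (induction I rule: infinite_finite_induct) (auto intro: supported_zero supported_add)

lemma supported_power: "(p :: 'k poly poly) \<in> supported S \<Longrightarrow> p ^ n \<in> supported S"
  by (induction n) (auto intro: supported_one supported_mult)

lemma S_periods:
  assumes "(i, j) \<in> S"
  shows "(i + a * D, j + b * D) \<in> S"
proof -
  have "(a * D, 0) \<in> S"
  proof (induction a)
    case (Suc a)
    then show ?case using S_add[OF S_u Suc] by simp
  qed (simp add: S_zero)
  moreover have "(0, b * D) \<in> S"
  proof (induction b)
    case (Suc b)
    then show ?case using S_add[OF S_v Suc] by simp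
  qed (simp add: S_zero)
  ultimately have "(a * D + 0, 0 + b * D) \<in> S" by (rule S_add)
  then show ?thesis using S_add[OF assms] by simp
qed

lemma mem_image_ideal:
  assumes I: "ideal I A" and x: "x \<in> carrier A"
  shows "\<psi> x \<in> \<psi> ` I \<longleftrightarrow> x \<in> I"
  using assms ideal.Icarr[OF I] by (auto simp: psi_eq_iff)

lemma image_ideal_add:
  assumes I: "ideal I A" and pq: "p \<in> \<psi> ` I" "q \<in> \<psi> ` I"
  shows "p + q \<in> \<psi> ` I"
proof -
  interpret I: ideal I A by (rule I)
  obtain x y where "x \<in> I" "y \<in> I" "p = \<psi> x" "q = \<psi> y" using pq by blast
  then show ?thesis using I.Icarr by (intro image_eqI[of _ _ "x \<oplus> y"]) (auto simp: psi_add)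
qed

lemma image_ideal_mult:
  assumes I: "ideal I A" and pq: "p \<in> supported S" "q \<in> \<psi> ` I"
  shows "p * q \<in> \<psi> ` I"
proof -
  interpret I: ideal I A by (rule I)
  obtain x where x: "x \<in> carrier A" "\<psi> x = p" using pq(1) by (rule psi_surj)
  obtain y where y: "y \<in> I" "q = \<psi> y" using pq(2) by blast
  show ?thesis using x y I.Icarr[OF y(1)]
    by (intro image_eqI[of _ _ "x \<otimes> y"]) (auto simp: psi_mult I.I_l_closed)
qed

lemma image_ideal_diff:
  assumes I: "ideal I A" and pq: "p \<in> \<psi> ` I" "q \<in> \<psi> ` I"
  shows "p - q \<in> \<psi> ` I"
proof -
  have "[:[:- 1:]:] * q \<in> \<psi> ` I" by (rule image_ideal_mult[OF I supported_const pq(2)])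
  then have "p + [:[:- 1:]:] * q \<in> \<psi> ` I" by (rule image_ideal_add[OF I pq(1)])
  moreover have "[:- 1:] = (- 1 :: 'k poly)" by (simp add: one_pCons)
  ultimately show ?thesis by simp
qed

lemma image_ideal_zero: "ideal I A \<Longrightarrow> 0 \<in> \<psi> ` I"
  using psi_zero additive_subgroup.zero_closed[OF ideal.axioms(1)] by (metis imageI)

text \<open>Division with remainder as for Groebner bases; the semigroup of exponents is a finite union
  of translates of \<open>D\<nat> \<times> D\<nat>\<close>, to which Dickson's lemma applies.\<close>

lemma noetherian: "noetherian_ring A"
proof (rule noetherian_ringI)
  fix I assume I: "ideal I A"
  interpret I: ideal I A by (rule I)
  define lexp :: "'k poly poly \<Rightarrow> nat \<times> nat" where "lexp p = (degree (lead_coeff p), degree p)" for p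
  \<comment> \<open>The leading exponents of \<open>I\<close>. Ordinary divisibility of monomials
    would not do, as the quotient of two monomials of A may lie outside A. Monomials with exponents
    in multiples of \<open>D\<close> do lie in A, so subtracting such multiples of a generator stays
    inside \<open>I\<close>.\<close>
  define E where "E = {lexp (\<psi> x) | x. x \<in> I \<and> \<psi> x \<noteq> 0}"
  obtain G where G: "G \<subseteq> E" "finite G"
    and dom: "\<forall>(x, y)\<in>E. \<exists>(x', y')\<in>G. \<exists>a b. x = x' + a * D \<and> y = y' + b * D"
    using dickson_mod[OF D_pos, of E] by blast
  have "\<forall>e\<in>G. \<exists>x. x \<in> I \<and> \<psi> x \<noteq> 0 \<and> lexp (\<psi> x) = e"
  proof
    fix e assume "e \<in> G"
    then have "e \<in> E" using G(1) by blast
    then show "\<exists>x. x \<in> I \<and> \<psi> x \<noteq> 0 \<and> lexp (\<psi> x) = e" unfolding E_def by blast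
  qed
  from bchoice[OF this] obtain w where w: "\<forall>e\<in>G. w e \<in> I \<and> \<psi> (w e) \<noteq> 0 \<and> lexp (\<psi> (w e)) = e" ..
  have sub: "w ` G \<subseteq> I" using w by blast
  then have subc: "w ` G \<subseteq> carrier A" using I.Icarr by blast
  have id: "ideal (Idl (w ` G)) A" by (rule genideal_ideal[OF subc])
  have "\<psi> x \<in> \<psi> ` (Idl (w ` G))" if "x \<in> I" for x
    using that
  proof (induction "lex_rank (\<psi> x)" arbitrary: x rule: wf_induct_rule[OF wf_lex_prod[OF wf_less_than wf_less_than]])
    case 1
    show ?case
    proof (cases "\<psi> x = 0")
      case True
      then show ?thesis using image_ideal_zero[OF id] by simp
    next
      case False
      then have "(degree (lead_coeff (\<psi> x)), degree (\<psi> x)) \<in> E"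
        using 1(2) unfolding E_def lexp_def by blast
      then obtain k l a b where kl: "(k, l) \<in> G" "degree (lead_coeff (\<psi> x)) = k + a * D" "degree (\<psi> x) = l + b * D"
        using dom by blast
      let ?g = "w (k, l)"
      have wg: "?g \<in> I" "\<psi> ?g \<noteq> 0" "degree (lead_coeff (\<psi> ?g)) = k" "degree (\<psi> ?g) = l"
        using w kl(1) by (auto simp: lexp_def)
      obtain c where c: "(lex_rank (\<psi> x - Polynomial.monom (Polynomial.monom c (a * D)) (b * D) * \<psi> ?g), lex_rank (\<psi> x)) \<in> less_than <*lex*> less_than"
        using cancel_leading_term[OF False wg(2), of "b * D" "a * D"] kl wg by auto
      have ms: "Polynomial.monom (Polynomial.monom c (a * D)) (b * D) \<in> supported S"
        using S_periods[OF S_zero, of a b] by (intro supported_monom) simp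
      have "?g \<in> Idl (w ` G)" using genideal_self[OF subc] kl(1) by blast
      then have t1: "Polynomial.monom (Polynomial.monom c (a * D)) (b * D) * \<psi> ?g \<in> \<psi> ` (Idl (w ` G))"
        by (intro image_ideal_mult[OF id ms]) simp
      have "\<psi> x - Polynomial.monom (Polynomial.monom c (a * D)) (b * D) * \<psi> ?g \<in> \<psi> ` I"
        using 1(2) wg(1) by (intro image_ideal_diff[OF I] image_ideal_mult[OF I ms]) simp_all
      then obtain y where y: "y \<in> I" "\<psi> y = \<psi> x - Polynomial.monom (Polynomial.monom c (a * D)) (b * D) * \<psi> ?g" by auto
      have "\<psi> y \<in> \<psi> ` (Idl (w ` G))" using 1(1)[of y] c y by simp
      then have "\<psi> y + Polynomial.monom (Polynomial.monom c (a * D)) (b * D) * \<psi> ?g \<in> \<psi> ` (Idl (w ` G))"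
        using t1 by (rule image_ideal_add[OF id])
      then show ?thesis using y(2) by simp
    qed
  qed
  then have "I \<subseteq> Idl (w ` G)" using mem_image_ideal[OF id] I.Icarr by blast
  moreover have "Idl (w ` G) \<subseteq> I" by (rule genideal_minimal[OF I sub])
  ultimately show "\<exists>F\<subseteq>carrier A. finite F \<and> I = Idl F"
    using G(2) subc by (intro exI[of _ "w ` G"]) auto
qed

section \<open>Contraction to K[u^D, v^D]\<close>

text \<open>The substitution of u^D for u and v^D for v. It makes the full polynomial ring act on A
  through its image K[u^D, v^D].\<close>

definition frob :: "'k poly poly \<Rightarrow> 'k poly poly" where
  "frob p = pcompose (map_poly (\<lambda>c. pcompose c (Polynomial.monom 1 D)) p) (Polynomial.monom 1 D)"

lemma frob_add: "frob (p + q) = frob p + frob q"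
  unfolding frob_def by (subst map_poly_add_hom) (simp_all add: pcompose_add)

lemma frob_mult: "frob (p * q) = frob p * frob q"
  unfolding frob_def by (subst map_poly_mult_hom) (simp_all add: pcompose_add pcompose_mult)

lemma frob_monom: "frob (Polynomial.monom (Polynomial.monom c i) j) = Polynomial.monom (Polynomial.monom c (i * D)) (j * D)"
  by (simp add: frob_def map_poly_monom pcompose_monom_monom)

lemma frob_const: "frob [:f:] = [:pcompose f (Polynomial.monom 1 D):]"
  by (simp add: frob_def map_poly_pCons)

lemma frob_supported: "frob p \<in> supported S"
proof -
  have "p \<in> supported UNIV" by (simp add: supported_def)
  then show ?thesis
  proof (induction rule: supported_induct)
    case zero
    show ?case by (simp add: frob_def supported_zero)
  next
    case (monom i j c)
    show ?case unfolding frob_monom using S_periods[OF S_zero, of i j] by (intro supported_monom) simp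
  qed (simp add: frob_add supported_add)
qed

text \<open>By Nakayama's lemma the contraction of a maximal ideal to \<open>K[u\<^sup>D, v\<^sup>D]\<close> is maximal.\<close>

lemma maximal_meets_u:
  assumes P: "maximalideal P A"
  shows "\<exists>x f. x \<in> P \<and> f \<noteq> 0 \<and> \<psi> x = [:pcompose f (Polynomial.monom 1 D):]"
proof -
  interpret P: maximalideal P A by (rule P)
  define N where "N = \<psi> ` P"
  note N_add = image_ideal_add[OF P.is_ideal, folded N_def]
  note N_mult = image_ideal_mult[OF P.is_ideal, folded N_def]
  note N_zero = image_ideal_zero[OF P.is_ideal, folded N_def]
  obtain G0 where G0: "G0 \<subseteq> S" "finite G0"
    and dom: "\<forall>(x, y)\<in>S. \<exists>(x', y')\<in>G0. \<exists>a b. x = x' + a * D \<and> y = y' + b * D"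
    using dickson_mod[OF D_pos, of S] by blast
  define G where "G = (\<lambda>(i, j). Polynomial.monom (Polynomial.monom (1 :: 'k) i) j) ` G0"
  have G: "finite G" "G \<subseteq> supported S" using G0 by (auto simp: G_def intro: supported_monom)
  \<comment> \<open>A is generated over K[u^D, v^D] by finitely many monomials, at the exponents
    supplied by the refined Dickson lemma.\<close>
  have span: "\<exists>c. (\<forall>h\<in>G. c h \<in> range frob) \<and> t = (\<Sum>h\<in>G. c h * h)" if "t \<in> supported S" for t
    using that
  proof (induction rule: supported_induct)
    case zero
    have "frob 0 = 0" by (simp add: frob_def)
    then have "0 \<in> range frob" by (metis rangeI)
    then show ?case by (intro exI[of _ "\<lambda>_. 0"]) auto
  next
    case (add a b)
    then obtain c d where cd: "\<forall>h\<in>G. c h \<in> range frob" "a = (\<Sum>h\<in>G. c h * h)"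
      "\<forall>h\<in>G. d h \<in> range frob" "b = (\<Sum>h\<in>G. d h * h)" by blast
    have "\<forall>h\<in>G. c h + d h \<in> range frob"
    proof
      fix h assume h: "h \<in> G"
      then obtain r s where "c h = frob r" "d h = frob s" using cd by blast
      then show "c h + d h \<in> range frob" by (metis frob_add rangeI)
    qed
    then show ?case
      using cd by (intro exI[of _ "\<lambda>h. c h + d h"]) (simp add: distrib_right sum.distrib)
  next
    case (monom i j c)
    then obtain k l a b where kl: "(k, l) \<in> G0" "i = k + a * D" "j = l + b * D" using dom by blast
    let ?g = "Polynomial.monom (Polynomial.monom (1 :: 'k) k) l"
    have g: "?g \<in> G" using kl(1) by (auto simp: G_def)
    have "Polynomial.monom (Polynomial.monom c i) j = frob (Polynomial.monom (Polynomial.monom c a) b) * ?g"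
      by (simp add: frob_monom mult_monom kl add.commute)
    also have "\<dots> = (\<Sum>h\<in>G. if h = ?g then frob (Polynomial.monom (Polynomial.monom c a) b) * h else 0)"
      using G(1) g by simp
    also have "\<dots> = (\<Sum>h\<in>G. (if h = ?g then frob (Polynomial.monom (Polynomial.monom c a) b) else frob 0) * h)"
      by (intro sum.cong) (simp_all add: frob_def)
    finally show ?case
      by (intro exI[of _ "\<lambda>h. if h = ?g then frob (Polynomial.monom (Polynomial.monom c a) b) else frob 0"]) simp
  qed
  \<comment> \<open>The contraction of \<open>P\<close>. What has to be checked is that an element
    outside of \<open>q\<close> is invertible modulo \<open>q\<close>; its inverse modulo
    \<open>P\<close> exists in A, but need not come from the subring.\<close>
  define q where "q = {p. frob p \<in> N}"
  have "\<exists>f. f \<noteq> 0 \<and> [:f:] \<in> q"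
  proof (rule maximal_meets_constants)
    show "a + b \<in> q" if "a \<in> q" "b \<in> q" for a b using that N_add by (simp add: q_def frob_add)
    show "a * b \<in> q" if "b \<in> q" for a b
      using that N_mult frob_supported by (simp add: q_def frob_mult)
  next
    fix b assume b: "b \<notin> q"
    obtain x where x: "x \<in> carrier A" "\<psi> x = frob b" using frob_supported by (rule psi_surj)
    have "x \<notin> P"
    proof
      assume "x \<in> P"
      then have "\<psi> x \<in> N" unfolding N_def by (rule imageI)
      then show False using b x(2) by (simp add: q_def)
    qed
    then obtain w where w: "w \<in> carrier A" "\<one> \<oplus> x \<otimes> w \<in> P" using maximal_inverse[OF P x(1)] by blast
    have "1 + frob b * \<psi> w = \<psi> (\<one> \<oplus> x \<otimes> w)" using x w by (simp add: psi_add psi_mult psi_one)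
    then have inv: "1 + frob b * \<psi> w \<in> N" using w(2) by (simp add: N_def)
    have "\<exists>y\<in>range frob. \<forall>g\<in>G. (1 + frob b * y) * g \<in> N"
    proof (rule nakayama)
      show "0 \<in> range frob" by (rule range_eqI[of _ _ 0]) (simp add: frob_def)
      show "1 \<in> range frob" by (rule range_eqI[of _ _ 1]) (simp add: frob_def map_poly_1 pcompose_1)
      show "x + y \<in> range frob" if "x \<in> range frob" "y \<in> range frob" for x y
        using that by (auto simp flip: frob_add)
      show "x * y \<in> range frob" if "x \<in> range frob" "y \<in> range frob" for x y
        using that by (auto simp flip: frob_mult)
      show "- x \<in> range frob" if x: "x \<in> range frob" for x
      proof -
        obtain p where "x = frob p" using x by blast
        then have "x + frob (- p) = frob 0" by (simp flip: frob_add)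
        then have "- x = frob (- p)" by (simp add: frob_def add_eq_0_iff)
        then show ?thesis by simp
      qed
      show "x * y \<in> N" if "x \<in> range frob" "y \<in> N" for x y
        using that N_mult frob_supported by blast
      show "0 \<in> N" by (rule N_zero)
      show "x + y \<in> N" if "x \<in> N" "y \<in> N" for x y by (rule N_add[OF that])
      fix g assume g: "g \<in> G"
      then have gs: "g \<in> supported S" using G by blast
      \<comment> \<open>Since 1 + b w is in \<open>N\<close>, g is congruent to b times -w g modulo
        \<open>N\<close>. Expanding -w g in the generators gives the relation needed for Nakayama's
        lemma.\<close>
      have "[:[:- 1:]:] * (\<psi> w * g) \<in> supported S"
        by (intro supported_mult supported_const psi_closed w gs)
      then obtain c where c: "\<forall>h\<in>G. c h \<in> range frob" "[:[:- 1:]:] * (\<psi> w * g) = (\<Sum>h\<in>G. c h * h)"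
        using span by blast
      have "[:- 1:] = (- 1 :: 'k poly)" by (simp add: one_pCons)
      then have "(\<Sum>h\<in>G. c h * h) = - (\<psi> w * g)" using c(2) by simp
      then have "g - frob b * (\<Sum>h\<in>G. c h * h) = g * (1 + frob b * \<psi> w)"
        by (simp only:) (simp add: algebra_simps)
      also have "\<dots> \<in> N" by (rule N_mult[OF gs inv])
      finally show "\<exists>c. (\<forall>h\<in>G. c h \<in> range frob) \<and> g - frob b * (\<Sum>h\<in>G. c h * h) \<in> N"
        using c by blast
    qed (use G in auto)
    then obtain y where y: "\<forall>g\<in>G. (1 + frob b * frob y) * g \<in> N" by blast
    \<comment> \<open>The unit 1 is itself a combination of the generators, so 1 + b y lies in
      \<open>N\<close> and not merely its products with them.\<close>
    obtain c where c: "\<forall>h\<in>G. c h \<in> range frob" "1 = (\<Sum>h\<in>G. c h * h)"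
      using span[OF supported_one] by blast
    have "1 + frob b * frob y = (1 + frob b * frob y) * (\<Sum>h\<in>G. c h * h)" by (simp flip: c(2))
    also have "\<dots> = (\<Sum>h\<in>G. c h * ((1 + frob b * frob y) * h))"
      by (simp add: sum_distrib_left mult.left_commute)
    also have "\<dots> \<in> N"
    proof -
      have sumN: "(\<Sum>h\<in>H. f h) \<in> N" if "\<And>h. h \<in> H \<Longrightarrow> f h \<in> N" for H and f :: "'k poly poly \<Rightarrow> 'k poly poly"
        using that by (induction H rule: infinite_finite_induct) (auto intro: N_zero N_add)
      have "c h * ((1 + frob b * frob y) * h) \<in> N" if h: "h \<in> G" for h
      proof -
        have "c h \<in> range frob" using c(1) h by blast
        then have "c h \<in> supported S" by (auto simp: frob_supported)
        then show ?thesis by (rule N_mult) (use y h in blast)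
      qed
      then show ?thesis by (rule sumN)
    qed
    finally have "1 + frob b * frob y \<in> N" .
    moreover have "frob 1 = 1" by (simp add: frob_def map_poly_1 pcompose_1)
    ultimately have "1 + b * y \<in> q" by (simp add: q_def frob_add frob_mult)
    then show "\<exists>y. 1 + b * y \<in> q" by blast
  qed
  then obtain f where "f \<noteq> 0" "frob [:f:] \<in> \<psi> ` P" by (auto simp: q_def N_def)
  then show ?thesis unfolding frob_const by (metis imageE)
qed

section \<open>Dimension at most two\<close>

text \<open>As \<open>x\<close> lies outside the prime \<open>p0\<close>, the factor x^a0 can be
  cancelled modulo \<open>p0\<close>. What is left is F a0 plus a multiple of \<open>x\<close>, and
  both the whole and that multiple lie in \<open>p1\<close>.\<close>

lemma lowest_term_in_prime:
  assumes p0: "primeideal p0 A" and p1: "ideal p1 A" "p0 \<subseteq> p1"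
    and x: "x \<in> p1" "x \<notin> p0"
    and F: "\<And>a. F a \<in> supported S" "\<And>a. a < a0 \<Longrightarrow> F a = 0" and a0: "a0 \<le> M"
    and rel: "(\<Sum>a\<le>M. F a * \<psi> x ^ a) \<in> \<psi> ` p0"
  shows "F a0 \<in> \<psi> ` p1"
proof -
  interpret p0: primeideal p0 A by (rule p0)
  have xc: "x \<in> carrier A" using ideal.Icarr[OF p1(1) x(1)] .
  define Y where "Y k = (\<Sum>a<k. F (a0 + a) * \<psi> x ^ a)" for k
  have "(\<Sum>a\<le>M. F a * \<psi> x ^ a) = (\<Sum>a\<in>{a0..M}. F a * \<psi> x ^ a)"
    using F(2) by (intro sum.mono_neutral_right) auto
  also have "\<dots> = (\<Sum>a\<in>{..<Suc M - a0}. F (a0 + a) * \<psi> x ^ (a0 + a))"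
    using a0 by (intro sum.reindex_bij_witness[of _ "\<lambda>a. a0 + a" "\<lambda>a. a - a0"]) auto
  also have "\<dots> = \<psi> x ^ a0 * Y (Suc M - a0)"
    by (simp add: Y_def sum_distrib_left power_add mult_ac)
  finally have "\<psi> x ^ a0 * Y (Suc M - a0) \<in> \<psi> ` p0" using rel by simp
  moreover have Ys: "Y (Suc M - a0) \<in> supported S"
    unfolding Y_def by (intro supported_sum supported_mult supported_power F psi_closed xc)
  moreover have "W \<in> \<psi> ` p0" if "\<psi> x ^ n * W \<in> \<psi> ` p0" "W \<in> supported S" for n W
    using that
  proof (induction n)
    case (Suc n)
    obtain y where y: "y \<in> carrier A" "\<psi> y = \<psi> x ^ n * W"
      using supported_mult[OF supported_power[OF psi_closed[OF xc]] Suc.prems(2)] by (rule psi_surj)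
    have "\<psi> (x \<otimes> y) \<in> \<psi> ` p0" using Suc.prems(1) xc y by (simp add: psi_mult mult.assoc)
    then have "x \<otimes> y \<in> p0" using xc y by (simp add: mem_image_ideal[OF p0.is_ideal])
    then have "y \<in> p0" using p0.I_prime[OF xc y(1)] x(2) by blast
    then have "\<psi> x ^ n * W \<in> \<psi> ` p0" unfolding y(2)[symmetric] by (rule imageI)
    then show ?case using Suc.IH Suc.prems(2) by blast
  qed simp
  ultimately have "Y (Suc M - a0) \<in> \<psi> ` p0" by blast
  then have Y1: "Y (Suc M - a0) \<in> \<psi> ` p1" using p1(2) by blast
  define Z where "Z = (\<Sum>a<M - a0. F (a0 + Suc a) * \<psi> x ^ a)"
  have "Y (Suc M - a0) = F a0 + Z * \<psi> x"
    using a0 by (simp add: Y_def Z_def Suc_diff_le sum.lessThan_Suc_shift sum_distrib_left sum_distrib_right mult_ac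
        del: sum.lessThan_Suc)
  then have "F a0 = Y (Suc M - a0) - Z * \<psi> x" by simp
  moreover have "Z \<in> supported S"
    unfolding Z_def by (intro supported_sum supported_mult supported_power F psi_closed xc)
  ultimately show ?thesis
    using Y1 x(1) by (simp add: image_ideal_diff[OF p1(1)] image_ideal_mult[OF p1(1)])
qed

text \<open>In a chain of four primes, choose an element new in each of the last three. Taking
  lowest terms of an algebraic relation between them, one variable for each step of the chain, ends
  with a non-zero scalar in the top prime.\<close>

lemma krull_dim_le_2: "krull_dim A \<le> enat 2"
  unfolding krull_dim_def
proof (rule Sup_least, clarify)
  fix k p assume p: "\<forall>i\<le>k. primeideal (p i) A" "\<forall>i<k. p i \<subset> p (Suc i)"
  show "enat k \<le> enat 2"
  proof (rule ccontr)
    assume "\<not> enat k \<le> enat 2"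
    then have k: "k \<ge> 3" by simp
    then have pr: "primeideal (p 0) A" "primeideal (p 1) A" "primeideal (p 2) A" "primeideal (p 3) A"
      using p(1) by auto
    have sub: "p 0 \<subset> p 1" "p 1 \<subset> p 2" "p 2 \<subset> p 3"
      using p(2)[rule_format, of 0] p(2)[rule_format, of 1] p(2)[rule_format, of 2] k
      by (simp_all add: numeral_2_eq_2 numeral_3_eq_3)
    obtain x y z where xyz: "x \<in> p 1" "x \<notin> p 0" "y \<in> p 2" "y \<notin> p 1" "z \<in> p 3" "z \<notin> p 2"
      using psubset_imp_ex_mem[OF sub(1)] psubset_imp_ex_mem[OF sub(2)] psubset_imp_ex_mem[OF sub(3)]
      by blast
    have id: "ideal (p 0) A" "ideal (p 1) A" "ideal (p 2) A" "ideal (p 3) A"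
      using pr[THEN primeideal.axioms(1)] by simp_all
    have c: "x \<in> carrier A" "y \<in> carrier A" "z \<in> carrier A"
      using xyz ideal.Icarr[OF id(2)] ideal.Icarr[OF id(3)] ideal.Icarr[OF id(4)] by auto
    obtain M q where q: "\<exists>a\<le>M. \<exists>b\<le>M. \<exists>c\<le>M. q a b c \<noteq> 0"
      and rel: "(\<Sum>a\<le>M. (\<Sum>b\<le>M. (\<Sum>c\<le>M. [:[:q a b c:]:] * \<psi> z ^ c) * \<psi> y ^ b) * \<psi> x ^ a) = 0"
      using algebraic_relation[of "\<psi> z" "\<psi> y" "\<psi> x"] by blast
    define F3 where "F3 a b c = ([:[:q a b c:]:] :: 'k poly poly)" for a b c
    define F2 where "F2 a b = (\<Sum>c\<le>M. F3 a b c * \<psi> z ^ c)" for a b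
    define F1 where "F1 a = (\<Sum>b\<le>M. F2 a b * \<psi> y ^ b)" for a
    have s3: "F3 a b c \<in> supported S" for a b c by (simp add: F3_def supported_const)
    have s2: "F2 a b \<in> supported S" for a b
      unfolding F2_def by (intro supported_sum supported_mult s3 supported_power psi_closed c)
    have s1: "F1 a \<in> supported S" for a
      unfolding F1_def by (intro supported_sum supported_mult s2 supported_power psi_closed c)
    define a0 where "a0 = (LEAST a. a \<le> M \<and> (\<exists>b\<le>M. \<exists>c\<le>M. q a b c \<noteq> 0))"
    have a0: "a0 \<le> M \<and> (\<exists>b\<le>M. \<exists>c\<le>M. q a0 b c \<noteq> 0)"
      unfolding a0_def by (rule LeastI_ex) (use q in blast)
    have za: "F1 a = 0" if "a < a0" for a
    proof -
      have "\<not> (a \<le> M \<and> (\<exists>b\<le>M. \<exists>c\<le>M. q a b c \<noteq> 0))" using that unfolding a0_def by (rule not_less_Least)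
      then show ?thesis using that a0 by (simp add: F1_def F2_def F3_def)
    qed
    define b0 where "b0 = (LEAST b. b \<le> M \<and> (\<exists>c\<le>M. q a0 b c \<noteq> 0))"
    have b0: "b0 \<le> M \<and> (\<exists>c\<le>M. q a0 b0 c \<noteq> 0)"
      unfolding b0_def by (rule LeastI_ex) (use a0 in blast)
    have zb: "F2 a0 b = 0" if "b < b0" for b
    proof -
      have "\<not> (b \<le> M \<and> (\<exists>c\<le>M. q a0 b c \<noteq> 0))" using that unfolding b0_def by (rule not_less_Least)
      then show ?thesis using that b0 by (simp add: F2_def F3_def)
    qed
    define c0 where "c0 = (LEAST c. c \<le> M \<and> q a0 b0 c \<noteq> 0)"
    have c0: "c0 \<le> M \<and> q a0 b0 c0 \<noteq> 0"
      unfolding c0_def by (rule LeastI_ex) (use b0 in blast)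
    have zc: "F3 a0 b0 c = 0" if "c < c0" for c
    proof -
      have "\<not> (c \<le> M \<and> q a0 b0 c \<noteq> 0)" using that unfolding c0_def by (rule not_less_Least)
      then show ?thesis using that c0 by (simp add: F3_def)
    qed
    have "(\<Sum>a\<le>M. F1 a * \<psi> x ^ a) \<in> \<psi> ` p 0"
      using rel image_ideal_zero[OF id(1)] by (simp add: F1_def F2_def F3_def)
    then have "F1 a0 \<in> \<psi> ` p 1"
      using sub xyz a0 by (intro lowest_term_in_prime[OF pr(1) id(2), of x F1, OF _ _ _ s1 za]) auto
    then have "F2 a0 b0 \<in> \<psi> ` p 2"
      using sub xyz b0 unfolding F1_def
      by (intro lowest_term_in_prime[OF pr(2) id(3), of y "F2 a0", OF _ _ _ s2 zb]) auto
    then have "F3 a0 b0 c0 \<in> \<psi> ` p 3"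
      using sub xyz c0 unfolding F2_def
      by (intro lowest_term_in_prime[OF pr(3) id(4), of z "F3 a0 b0", OF _ _ _ s3 zc]) auto
    then have "[:[:1 / q a0 b0 c0:]:] * F3 a0 b0 c0 \<in> \<psi> ` p 3"
      by (rule image_ideal_mult[OF id(4) supported_const])
    then have "1 \<in> \<psi> ` p 3" using c0 by (simp add: F3_def one_pCons)
    then have "\<one> \<in> p 3" using mem_image_ideal[OF id(4) one_closed] by (simp add: psi_one)
    then show False using ideal.one_imp_carrier[OF id(4)] primeideal.I_notcarr[OF pr(4)] by simp
  qed
qed

section \<open>Regular sequences from separated polynomials\<close>

lemma regular_pair:
  fixes f g :: "'k poly"
  assumes P: "maximalideal P A" and xy: "x \<in> P" "y \<in> P"
    and psi: "\<psi> x = [:f:]" "\<psi> y = map_poly (\<lambda>c. [:c:]) g"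
    and f: "f \<noteq> 0" "\<And>i. poly.coeff f i \<noteq> 0 \<Longrightarrow> D dvd i"
    and g: "g \<noteq> 0" "\<And>i. poly.coeff g i \<noteq> 0 \<Longrightarrow> D dvd i"
    and S_saturated: "\<And>i j k l. (i + k * D, j) \<in> S \<Longrightarrow> (i, j + l * D) \<in> S \<Longrightarrow> (i, j) \<in> S"
  shows "regular_sequence A [x, y]"
proof -
  interpret P: maximalideal P A by (rule P)
  let ?G = "map_poly (\<lambda>c. [:c:]) g"
  have c: "x \<in> carrier A" "y \<in> carrier A" using xy P.Icarr by auto
  have idl0: "Idl {} = {\<zero>}"
  proof
    show "Idl {} \<subseteq> {\<zero>}" by (rule genideal_minimal[OF zeroideal]) simp
    show "{\<zero>} \<subseteq> Idl {}"
      using additive_subgroup.zero_closed[OF ideal.axioms(1)[OF genideal_ideal[of "{}"]]] by simp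
  qed
  have idl1: "Idl {x} = {r \<otimes> x | r. r \<in> carrier A}"
    using cgenideal_eq_genideal[OF c(1)] by (simp add: cgenideal_def)
  have dg: "degree ?G = degree g" by (rule degree_map_poly) simp
  have reg0: "a \<in> Idl {}" if a: "a \<in> carrier A" "x \<otimes> a \<in> Idl {}" for a
  proof -
    have "\<psi> x * \<psi> a = \<psi> \<zero>" using a c by (simp add: idl0 flip: psi_mult)
    then have "\<psi> a = \<psi> \<zero>" using f by (simp add: psi psi_zero)
    then show ?thesis using a psi_eq_iff[of a \<zero>] by (simp add: idl0)
  qed
  have reg1: "a \<in> Idl {x}" if a: "a \<in> carrier A" "y \<otimes> a \<in> Idl {x}" for a
  proof -
    obtain r where r: "r \<in> carrier A" "y \<otimes> a = r \<otimes> x" using a idl1 by auto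
    then have eq: "?G * \<psi> a = [:f:] * \<psi> r" using a c psi by (metis psi_mult mult.commute)
    \<comment> \<open>In g a = f r the leading v-coefficient of g is a non-zero scalar, so
      \<open>f\<close> divides all v-coefficients of a.\<close>
    have "f dvd poly.coeff (\<psi> a) j" for j
    proof (rule dvd_coeff_of_mult[of _ ?G])
      fix b assume "f dvd lead_coeff ?G * b"
      then have "f dvd smult (lead_coeff g) b" by (simp add: dg coeff_map_poly)
      then show "f dvd b" using g(1) by (simp add: dvd_smult_iff)
    next
      show "f dvd poly.coeff (?G * \<psi> a) (degree ?G + j)" for j unfolding eq by simp
    qed
    then have "[:f:] dvd \<psi> a" by (simp add: const_poly_dvd_iff)
    then obtain C where C: "\<psi> a = [:f:] * C" by (rule dvdE)
    have "[:f:] * (?G * C) = [:f:] * \<psi> r" using eq C by (simp add: mult.left_commute)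
    then have GC: "?G * C = \<psi> r" using f(1) by (metis mult_left_cancel pCons_eq_0_iff)
    \<comment> \<open>Up to here C is only an element of K[u, v]. Both f C and g C lie in K[S],
      which confines each exponent of C in the two directions; saturation of \<open>S\<close>
      combines the two conditions.\<close>
    have "C \<in> supported S"
      unfolding supported_def
    proof (intro CollectI allI impI)
      fix i j assume nz: "poly.coeff (poly.coeff C j) i \<noteq> 0"
      have "\<exists>k. (i + k * D, j) \<in> S"
      proof (rule support_of_mult[OF f, where p = "poly.coeff C j" and G = "\<lambda>i. \<exists>k. (i + k * D, j) \<in> S"])
        show "\<exists>k. (i + k * D, j) \<in> S" if "\<exists>k'. (i + k * D + k' * D, j) \<in> S" for i k
          using that by (metis add.assoc add_mult_distrib)
        show "\<exists>k. (i + k * D, j) \<in> S" if "poly.coeff (f * poly.coeff C j) i \<noteq> 0" for i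
        proof -
          have "poly.coeff (poly.coeff (\<psi> a) j) i \<noteq> 0" using that by (simp add: C)
          then show ?thesis using psi_closed[OF a(1)] by (intro exI[of _ 0]) (auto simp: supported_def)
        qed
      qed (use nz in auto)
      moreover have "\<exists>l. (i, j + l * D) \<in> S"
      \<comment> \<open>The u-direction used the coefficient of v^j in C; here the coefficient of
        u^i is taken as a polynomial in v, on which g acts by ordinary multiplication.\<close>
      proof (rule support_of_mult[OF g, where p = "map_poly (\<lambda>r. poly.coeff r i) C" and G = "\<lambda>j. \<exists>l. (i, j + l * D) \<in> S"])
        show "\<exists>k. (i, j + k * D) \<in> S" if "\<exists>k'. (i, j + k * D + k' * D) \<in> S" for j k
          using that by (metis add.assoc add_mult_distrib)
        show "\<exists>l. (i, j + l * D) \<in> S" if "poly.coeff (g * map_poly (\<lambda>r. poly.coeff r i) C) j \<noteq> 0" for j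
        proof -
          have "poly.coeff (g * map_poly (\<lambda>r. poly.coeff r i) C) j = poly.coeff (poly.coeff (?G * C) j) i"
            by (simp add: coeff_mult coeff_map_poly coeff_sum)
          then have "poly.coeff (poly.coeff (\<psi> r) j) i \<noteq> 0" using that by (simp add: GC)
          then show ?thesis using psi_closed[OF r(1)] by (intro exI[of _ 0]) (auto simp: supported_def)
        qed
        show "poly.coeff (map_poly (\<lambda>r. poly.coeff r i) C) j \<noteq> 0" using nz by (simp add: coeff_map_poly)
      qed
      ultimately show "(i, j) \<in> S" using S_saturated by blast
    qed
    then obtain z where z: "z \<in> carrier A" "\<psi> z = C" by (rule psi_surj)
    then have "\<psi> a = \<psi> (z \<otimes> x)" using C c psi by (simp add: psi_mult mult.commute)
    then show ?thesis using z a c by (auto simp: idl1 psi_eq_iff)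
  qed
  have "Idl {x, y} \<subseteq> P" using xy by (intro genideal_minimal P.is_ideal) simp
  then have "Idl {x, y} \<noteq> carrier A" using P.I_notcarr P.Icarr by blast
  moreover have "\<forall>i<length [x, y]. \<forall>a\<in>carrier A.
      [x, y] ! i \<otimes> a \<in> Idl (set (take i [x, y])) \<longrightarrow> a \<in> Idl (set (take i [x, y]))"
    using reg0 reg1 by (auto simp: less_Suc_eq)
  ultimately show ?thesis using c unfolding regular_sequence_def by simp
qed

end

text \<open>The second embedding exchanges u and v, so the element of a maximal ideal that is a
  polynomial in the D-th power of the inner variable becomes one in v^D for the first
  embedding.\<close>

lemma plane_semigroup_ring_cohen_macaulay:
  fixes \<psi> \<psi>' :: "'a \<Rightarrow> 'k::field poly poly"
  assumes A: "plane_semigroup_ring A \<psi> S D" "plane_semigroup_ring A \<psi>' S' D"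
    and swap: "\<And>x i j. x \<in> carrier A \<Longrightarrow> coeff (coeff (\<psi>' x) i) j = coeff (coeff (\<psi> x) j) i"
    and S_saturated: "\<And>i j k l. (i + k * D, j) \<in> S \<Longrightarrow> (i, j + l * D) \<in> S \<Longrightarrow> (i, j) \<in> S"
  shows "cohen_macaulay_ring A"
proof -
  interpret plane_semigroup_ring A \<psi> S D by (rule A)
  interpret V: plane_semigroup_ring A \<psi>' S' D by (rule A)
  show ?thesis
  proof (rule cohen_macaulay_ringI[OF is_cring noetherian krull_dim_le_2])
    fix P assume P: "maximalideal P A"
    obtain x f where x: "x \<in> P" "f \<noteq> 0" "\<psi> x = [:pcompose f (Polynomial.monom 1 D):]"
      using maximal_meets_u[OF P] by blast
    obtain y g where y: "y \<in> P" "g \<noteq> 0" "\<psi>' y = [:pcompose g (Polynomial.monom 1 D):]"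
      using V.maximal_meets_u[OF P] by blast
    have yc: "y \<in> carrier A" using ideal.Icarr[OF maximalideal.axioms(1)[OF P] y(1)] .
    have psi_y: "\<psi> y = map_poly (\<lambda>c. [:c:]) (pcompose g (Polynomial.monom 1 D))"
      by (intro poly_eqI) (auto simp: coeff_map_poly y(3) coeff_pCons split: nat.splits simp flip: swap[OF yc])
    have nz: "pcompose h (Polynomial.monom 1 D) \<noteq> 0" if "h \<noteq> 0" for h :: "'k poly"
      using that D_pos by (simp add: pcompose_eq_0_iff degree_monom_eq)
    have "regular_sequence A [x, y]"
      by (rule regular_pair[OF P x(1) y(1) x(3) psi_y nz[OF x(2)] dvd_of_coeff_pcompose_monom
            nz[OF y(2)] dvd_of_coeff_pcompose_monom S_saturated])
    then show "\<exists>fs. regular_sequence A fs \<and> set fs \<subseteq> P \<and> length fs = 2"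
      using x y by (intro exI[of _ "[x, y]"]) auto
  qed
qed

section \<open>The coordinate ring of a projective monomial curve\<close>

text \<open>\<open>x\<^sub>a\<close> becomes the inner and \<open>x\<^sub>b\<close> the outer
  variable; any other variable is set to 1. The map is multiplicative on all polynomials, but
  injectivity is only claimed on those in these two variables.\<close>

definition two_var :: "nat \<Rightarrow> nat \<Rightarrow> 'k::field mpoly \<Rightarrow> 'k poly poly" where
  "two_var a b p = (\<Sum>\<alpha>\<in>Poly_Mapping.keys p.
     monom (monom (Poly_Mapping.lookup p \<alpha>) (Poly_Mapping.lookup \<alpha> a)) (Poly_Mapping.lookup \<alpha> b))"

lemma two_var_single:
  "two_var a b (Poly_Mapping.single \<alpha> c) =
    monom (monom c (Poly_Mapping.lookup \<alpha> a)) (Poly_Mapping.lookup \<alpha> b)"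
  by (simp add: two_var_def)

lemma two_var_superset:
  assumes "finite B" "Poly_Mapping.keys p \<subseteq> B"
  shows "two_var a b p = (\<Sum>\<alpha>\<in>B.
    monom (monom (Poly_Mapping.lookup p \<alpha>) (Poly_Mapping.lookup \<alpha> a)) (Poly_Mapping.lookup \<alpha> b))"
  unfolding two_var_def using assms
  by (intro sum.mono_neutral_left) (auto simp: in_keys_iff)

lemma two_var_add: "two_var a b (p + q) = two_var a b p + two_var a b q"
proof -
  let ?B = "Poly_Mapping.keys p \<union> Poly_Mapping.keys q"
  have "Poly_Mapping.keys (p + q) \<subseteq> ?B" by (rule Poly_Mapping.keys_add)
  then show ?thesis
    by (simp add: two_var_superset[of ?B] lookup_add add_monom flip: sum.distrib)
qed

lemma two_var_mult: "two_var a b (p * q) = two_var a b p * two_var a b q"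
proof (induction p rule: mpoly_induct)
  case (single \<alpha> c)
  show ?case
    by (induction q rule: mpoly_induct)
      (simp_all add: mult_single two_var_single two_var_add lookup_add mult_monom algebra_simps)
qed (simp add: two_var_add algebra_simps)

lemma two_var_one: "two_var a b 1 = 1"
  using two_var_single[of a b 0 1] by (simp add: monom_0 one_pCons)

lemma two_var_power: "two_var a b (p ^ k) = two_var a b p ^ k"
  by (induction k) (simp_all add: two_var_one two_var_mult)

lemma two_var_prod: "two_var a b (\<Prod>i\<in>I. f i) = (\<Prod>i\<in>I. two_var a b (f i))"
  by (induction I rule: infinite_finite_induct) (simp_all add: two_var_one two_var_mult)

lemma two_var_swap: "coeff (coeff (two_var b a p) i) j = coeff (coeff (two_var a b p) j) i"
  by (induction p rule: mpoly_induct) (simp_all add: two_var_single two_var_add)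

lemma two_var_eq_zero:
  fixes p :: "'k::field mpoly"
  assumes p: "p \<in> carrier (mpoly_ring {a, b})" and zero: "two_var a b p = 0"
  shows "p = 0"
proof (rule poly_mapping_eqI)
  fix \<alpha>
  show "Poly_Mapping.lookup p \<alpha> = Poly_Mapping.lookup 0 \<alpha>"
  proof (cases "\<alpha> \<in> Poly_Mapping.keys p")
    case True
    have keys: "Poly_Mapping.keys \<beta> \<subseteq> {a, b}" if "\<beta> \<in> Poly_Mapping.keys p" for \<beta>
      using p that by (simp add: mpoly_ring_def)
    have "coeff (coeff (two_var a b p) (Poly_Mapping.lookup \<alpha> b)) (Poly_Mapping.lookup \<alpha> a) =
      (\<Sum>\<beta>\<in>Poly_Mapping.keys p. if \<beta> = \<alpha> then Poly_Mapping.lookup p \<alpha> else 0)"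
      unfolding two_var_def coeff_sum
    proof (intro sum.cong refl)
      fix \<beta> assume \<beta>: "\<beta> \<in> Poly_Mapping.keys p"
      have "\<beta> = \<alpha>" if e: "Poly_Mapping.lookup \<beta> a = Poly_Mapping.lookup \<alpha> a"
        "Poly_Mapping.lookup \<beta> b = Poly_Mapping.lookup \<alpha> b"
      proof (rule poly_mapping_eqI)
        fix i
        show "Poly_Mapping.lookup \<beta> i = Poly_Mapping.lookup \<alpha> i"
        proof (cases "i \<in> {a, b}")
          case False
          then have "i \<notin> Poly_Mapping.keys \<beta>" "i \<notin> Poly_Mapping.keys \<alpha>"
            using keys[OF \<beta>] keys[OF True] by blast+
          then show ?thesis by (simp add: in_keys_iff)
        qed (use e in auto)
      qed
      then show "coeff (coeff (monom (monom (Poly_Mapping.lookup p \<beta>) (Poly_Mapping.lookup \<beta> a))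
          (Poly_Mapping.lookup \<beta> b)) (Poly_Mapping.lookup \<alpha> b)) (Poly_Mapping.lookup \<alpha> a) =
        (if \<beta> = \<alpha> then Poly_Mapping.lookup p \<alpha> else 0)" by auto
    qed
    then show ?thesis using True zero by simp
  qed (simp add: in_keys_iff)
qed

text \<open>Nested polynomials as a record, so that the homomorphism theorem for quotients by
  kernels can be applied to maps into them.\<close>

definition type_ring :: "'a::comm_ring_1 ring" where
  "type_ring = \<lparr>carrier = UNIV, monoid.mult = (*), monoid.one = 1, ring.zero = 0, ring.add = (+)\<rparr>"

lemma type_ring_simps:
  "carrier type_ring = UNIV" "x \<otimes>\<^bsub>type_ring\<^esub> y = x * y" "\<one>\<^bsub>type_ring\<^esub> = 1"
  "\<zero>\<^bsub>type_ring\<^esub> = 0" "x \<oplus>\<^bsub>type_ring\<^esub> y = x + y"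
  by (simp_all add: type_ring_def)

lemma type_ring_cring: "cring (type_ring :: 'a::comm_ring_1 ring)"
proof (rule cringI)
  show "abelian_group (type_ring :: 'a ring)"
  proof (rule abelian_groupI)
    show "\<exists>y\<in>carrier type_ring. y \<oplus>\<^bsub>type_ring\<^esub> x = \<zero>\<^bsub>type_ring\<^esub>" for x :: 'a
      by (intro bexI[of _ "- x"]) (simp_all add: type_ring_simps)
  qed (simp_all add: type_ring_simps algebra_simps)
  show "comm_monoid (type_ring :: 'a ring)"
    by (rule comm_monoidI) (simp_all add: type_ring_simps algebra_simps)
qed (simp_all add: type_ring_simps algebra_simps)

text \<open>The exponent of \<open>u\<close> (if \<open>w = 1\<close>) or \<open>v\<close> in the image of \<open>x\<^sub>i\<close>.\<close>

definition curve_exp :: "nat \<Rightarrow> (nat \<Rightarrow> nat) \<Rightarrow> nat \<Rightarrow> nat \<Rightarrow> nat" where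
  "curve_exp n m w i =
    (if w = 1 then if i = n + 1 then 0 else m i else if i = n + 1 then m n else m n - m i)"

section \<open>The parametrization and its exponent semigroup\<close>

definition curve_semigroup :: "nat \<Rightarrow> (nat \<Rightarrow> nat) \<Rightarrow> nat \<Rightarrow> nat \<Rightarrow> (nat \<times> nat) set" where
  "curve_semigroup n m a b =
    {(\<Sum>i\<in>{1..n + 1}. \<alpha> i * curve_exp n m a i, \<Sum>i\<in>{1..n + 1}. \<alpha> i * curve_exp n m b i) | \<alpha>. True}"

definition curve_map :: "nat \<Rightarrow> (nat \<Rightarrow> nat) \<Rightarrow> nat \<Rightarrow> nat \<Rightarrow> 'k::field mpoly \<Rightarrow> 'k poly poly" where
  "curve_map n m a b p = two_var a b (mp_subst (curve_param n m) p)"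

lemma curve_semigroup_zero: "(0, 0) \<in> curve_semigroup n m a b"
  unfolding curve_semigroup_def by (rule CollectI, rule exI[of _ "\<lambda>_. 0"]) simp

lemma curve_semigroup_add:
  assumes "(i, j) \<in> curve_semigroup n m a b" "(k, l) \<in> curve_semigroup n m a b"
  shows "(i + k, j + l) \<in> curve_semigroup n m a b"
proof -
  obtain \<alpha> \<beta> where "i = (\<Sum>i\<in>{1..n + 1}. \<alpha> i * curve_exp n m a i)"
    "j = (\<Sum>i\<in>{1..n + 1}. \<alpha> i * curve_exp n m b i)"
    "k = (\<Sum>i\<in>{1..n + 1}. \<beta> i * curve_exp n m a i)"
    "l = (\<Sum>i\<in>{1..n + 1}. \<beta> i * curve_exp n m b i)"
    using assms unfolding curve_semigroup_def by blast
  then show ?thesis unfolding curve_semigroup_def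
    by (intro CollectI exI[of _ "\<lambda>i. \<alpha> i + \<beta> i"]) (simp add: add_mult_distrib sum.distrib del: sum.cl_ivl_Suc)
qed

lemma curve_semigroup_gen:
  assumes "i \<in> {1..n + 1}"
  shows "(curve_exp n m a i, curve_exp n m b i) \<in> curve_semigroup n m a b"
proof -
  have "(\<Sum>j\<in>{1..n + 1}. (if j = i then 1 else 0) * curve_exp n m w j) = curve_exp n m w i" for w
  proof -
    have "(\<Sum>j\<in>{1..n + 1}. (if j = i then 1 else 0) * curve_exp n m w j) =
      (\<Sum>j\<in>{1..n + 1}. if j = i then curve_exp n m w j else 0)" by (intro sum.cong) auto
    then show ?thesis using assms by (simp del: sum.cl_ivl_Suc)
  qed
  then show ?thesis unfolding curve_semigroup_def
    by (intro CollectI exI[of _ "\<lambda>j. if j = i then 1 else 0"]) simp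
qed

lemma curve_map_single:
  fixes c :: "'k::field"
  assumes ab: "(a, b) \<in> {(1, 2), (2, 1)}" and \<alpha>: "Poly_Mapping.keys \<alpha> \<subseteq> {1..n + 1}"
  shows "curve_map n m a b (Poly_Mapping.single \<alpha> c) =
    monom (monom c (\<Sum>i\<in>{1..n + 1}. Poly_Mapping.lookup \<alpha> i * curve_exp n m a i))
      (\<Sum>i\<in>{1..n + 1}. Poly_Mapping.lookup \<alpha> i * curve_exp n m b i)"
proof -
  have pu: "(var_u :: 'k mpoly) ^ k = Poly_Mapping.single (Poly_Mapping.single 1 k) 1"
    and pv: "(var_v :: 'k mpoly) ^ k = Poly_Mapping.single (Poly_Mapping.single 2 k) 1" for k
    by (induction k) (simp_all add: mp_var_def mult_single flip: single_add)
  have par: "curve_param n m i =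
    (Poly_Mapping.single (Poly_Mapping.single 1 (curve_exp n m 1 i) + Poly_Mapping.single 2 (curve_exp n m 2 i)) 1 :: 'k mpoly)" for i
    unfolding curve_param_def pu pv by (simp add: curve_exp_def mult_single)
  have "two_var a b (curve_param n m i) = (monom (monom 1 (curve_exp n m a i)) (curve_exp n m b i) :: 'k poly poly)" for i
    unfolding par two_var_single using ab by (auto simp: lookup_add lookup_single)
  then have "curve_map n m a b (Poly_Mapping.single \<alpha> c) = monom (monom c 0) 0 *
    (\<Prod>i\<in>Poly_Mapping.keys \<alpha>. monom (monom 1 (curve_exp n m a i)) (curve_exp n m b i) ^ Poly_Mapping.lookup \<alpha> i)"
    by (simp add: curve_map_def mp_subst_single two_var_mult two_var_prod two_var_power mp_const_def two_var_single)
  also have "(\<Prod>i\<in>Poly_Mapping.keys \<alpha>. monom (monom (1 :: 'k) (curve_exp n m a i)) (curve_exp n m b i) ^ Poly_Mapping.lookup \<alpha> i)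
    = (\<Prod>i\<in>{1..n + 1}. monom (monom 1 (curve_exp n m a i)) (curve_exp n m b i) ^ Poly_Mapping.lookup \<alpha> i)"
    using \<alpha> by (intro prod.mono_neutral_left) (auto simp: in_keys_iff)
  also have "\<dots> = monom (monom 1 (\<Sum>i\<in>{1..n + 1}. Poly_Mapping.lookup \<alpha> i * curve_exp n m a i))
      (\<Sum>i\<in>{1..n + 1}. Poly_Mapping.lookup \<alpha> i * curve_exp n m b i)"
  proof -
    have "(\<Prod>i\<in>I. monom (monom (1 :: 'k) (f i)) (g i) ^ e i) =
      monom (monom 1 (\<Sum>i\<in>I. e i * f i)) (\<Sum>i\<in>I. e i * g i)" for I :: "nat set" and e f g
      by (induction I rule: infinite_finite_induct)
        (simp_all add: monom_power mult_monom monom_0 one_pCons mult.commute)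
    then show ?thesis .
  qed
  also have "monom (monom c 0) 0 * \<dots> =
    monom (monom c (\<Sum>i\<in>{1..n + 1}. Poly_Mapping.lookup \<alpha> i * curve_exp n m a i))
      (\<Sum>i\<in>{1..n + 1}. Poly_Mapping.lookup \<alpha> i * curve_exp n m b i)"
    by (simp add: mult_monom del: sum.cl_ivl_Suc)
  finally show ?thesis .
qed

lemma curve_map_add: "curve_map n m a b (p + q) = curve_map n m a b p + curve_map n m a b q"
  by (simp add: curve_map_def mp_subst_add two_var_add)

text \<open>Monomials go to monomials, and their exponents run through exactly the semigroup
  generated by those of the images of the variables.\<close>

lemma curve_map_image:
  assumes ab: "(a, b) \<in> {(1, 2), (2, 1)}"
  shows "curve_map n m a b ` carrier (mpoly_ring {1..n + 1} :: 'k::field mpoly ring) =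
    supported (curve_semigroup n m a b)"
proof
  let ?S = "curve_semigroup n m a b"
  have add: "p + q \<in> supported ?S" if "p \<in> supported ?S" "q \<in> supported ?S" for p q :: "'k poly poly"
    unfolding supported_def
  proof (intro CollectI allI impI)
    fix i j assume "coeff (coeff (p + q) j) i \<noteq> 0"
    then have "coeff (coeff p j) i \<noteq> 0 \<or> coeff (coeff q j) i \<noteq> 0" by auto
    then show "(i, j) \<in> ?S" using that unfolding supported_def by blast
  qed
  show "curve_map n m a b ` carrier (mpoly_ring {1..n + 1} :: 'k mpoly ring) \<subseteq> supported ?S"
  proof
    fix q assume "q \<in> curve_map n m a b ` carrier (mpoly_ring {1..n + 1} :: 'k mpoly ring)"
    then obtain p :: "'k mpoly" where p: "p \<in> carrier (mpoly_ring {1..n + 1})" "q = curve_map n m a b p" by blast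
    have mem: "curve_map n m a b (\<Sum>\<alpha>\<in>B. Poly_Mapping.single \<alpha> (Poly_Mapping.lookup p \<alpha>)) \<in> supported ?S"
      if "finite B" "B \<subseteq> Poly_Mapping.keys p" for B
      using that
    proof (induction B)
      case empty
      then show ?case by (simp add: curve_map_def mp_subst_def two_var_def supported_def)
    next
      case (insert \<alpha> B)
      have k: "Poly_Mapping.keys \<alpha> \<subseteq> {1..n + 1}" using insert.prems p(1) by (auto simp: mpoly_ring_def)
      have "(\<Sum>i\<in>{1..n + 1}. Poly_Mapping.lookup \<alpha> i * curve_exp n m a i,
          \<Sum>i\<in>{1..n + 1}. Poly_Mapping.lookup \<alpha> i * curve_exp n m b i) \<in> ?S"
        unfolding curve_semigroup_def by blast
      then have "curve_map n m a b (Poly_Mapping.single \<alpha> (Poly_Mapping.lookup p \<alpha>)) \<in> supported ?S"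
        unfolding curve_map_single[OF ab k] supported_def
        by (auto simp del: sum.cl_ivl_Suc)
      then show ?case using insert add by (simp add: curve_map_add)
    qed
    have "(\<Sum>\<alpha>\<in>Poly_Mapping.keys p. Poly_Mapping.single \<alpha> (Poly_Mapping.lookup p \<alpha>)) = p"
      by (rule poly_mapping_eqI) (auto simp: lookup_sum lookup_single when_def in_keys_iff)
    then show "q \<in> supported ?S" using mem[OF finite_keys subset_refl] p(2) by simp
  qed
  show "supported ?S \<subseteq> curve_map n m a b ` carrier (mpoly_ring {1..n + 1} :: 'k mpoly ring)"
  proof
    interpret V: cring "mpoly_ring {1..n + 1} :: 'k mpoly ring" by (rule mpoly_ring_cring)
    fix q :: "'k poly poly" assume "q \<in> supported ?S"
    then show "q \<in> curve_map n m a b ` carrier (mpoly_ring {1..n + 1})"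
    proof (induction rule: supported_induct)
      case zero
      have "curve_map n m a b 0 = (0 :: 'k poly poly)" by (simp add: curve_map_def mp_subst_def two_var_def)
      then show ?case by (intro image_eqI[of _ _ 0]) (simp_all add: mpoly_ring_def)
    next
      case (add q r)
      then obtain s t where "s \<in> carrier (mpoly_ring {1..n + 1})" "t \<in> carrier (mpoly_ring {1..n + 1})"
        "q = curve_map n m a b s" "r = curve_map n m a b t" by blast
      then show ?case using V.a_closed[of s t]
        by (intro image_eqI[of _ _ "s + t"]) (simp_all add: curve_map_add mpoly_ring_def)
    next
      case (monom i j c)
      then obtain \<alpha> where \<alpha>: "i = (\<Sum>i\<in>{1..n + 1}. \<alpha> i * curve_exp n m a i)"
        "j = (\<Sum>i\<in>{1..n + 1}. \<alpha> i * curve_exp n m b i)"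
        unfolding curve_semigroup_def by blast
      define \<beta> where "\<beta> = (\<Sum>i\<in>{1..n + 1}. Poly_Mapping.single i (\<alpha> i))"
      have l: "Poly_Mapping.lookup \<beta> i = (if i \<in> {1..n + 1} then \<alpha> i else 0)" for i
        unfolding \<beta>_def lookup_sum lookup_single when_def by (simp del: sum.cl_ivl_Suc)
      then have k: "Poly_Mapping.keys \<beta> \<subseteq> {1..n + 1}" by (auto simp: in_keys_iff split: if_splits)
      have e: "(\<Sum>i\<in>{1..n + 1}. Poly_Mapping.lookup \<beta> i * f i) = (\<Sum>i\<in>{1..n + 1}. \<alpha> i * f i)" for f
        by (intro sum.cong) (simp_all add: l)
      have "curve_map n m a b (Poly_Mapping.single \<beta> c) = monom (monom c i) j"
        by (simp only: curve_map_single[OF ab k] e \<alpha>)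
      moreover have "Poly_Mapping.single \<beta> c \<in> carrier (mpoly_ring {1..n + 1})"
        using k by (auto simp: mpoly_ring_def)
      ultimately show ?case by (metis image_eqI)
    qed
  qed
qed

lemma curve_map_hom:
  "ring_hom_ring (mpoly_ring {1..n + 1}) type_ring (curve_map n m a b :: 'k::field mpoly \<Rightarrow> _)"
proof (rule ring_hom_ringI2)
  show "ring (mpoly_ring {1..n + 1} :: 'k mpoly ring)" by (rule cring.axioms(1)[OF mpoly_ring_cring])
  show "ring (type_ring :: 'k poly poly ring)" by (rule cring.axioms(1)[OF type_ring_cring])
  show "curve_map n m a b \<in> ring_hom (mpoly_ring {1..n + 1} :: 'k mpoly ring) type_ring"
  proof (rule ring_hom_memI)
    have "mp_subst (curve_param n m) 1 = (1 :: 'k mpoly)"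
      using mp_subst_const[of "curve_param n m" "1 :: 'k"] by (simp add: mp_const_def)
    then show "curve_map n m a b \<one>\<^bsub>mpoly_ring {1..n + 1} :: 'k mpoly ring\<^esub> = \<one>\<^bsub>type_ring\<^esub>"
      by (simp add: curve_map_def mpoly_ring_def type_ring_simps two_var_one)
  qed (simp_all add: curve_map_def mpoly_ring_def type_ring_simps mp_subst_add mp_subst_mult
      two_var_add two_var_mult)
qed

lemma curve_ideal_eq_kernel:
  assumes ab: "(a, b) \<in> {(1, 2), (2, 1)}"
  shows "(curve_ideal n m :: 'k::field mpoly set) =
    a_kernel (mpoly_ring {1..n + 1}) type_ring (curve_map n m a b)"
proof -
  have "mp_subst (curve_param n m) p = 0 \<longleftrightarrow> curve_map n m a b p = 0"
    if p: "p \<in> carrier (mpoly_ring {1..n + 1})" for p :: "'k mpoly"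
  proof
    have ins: "{1, 2} = {a, b}" using ab by auto
    have "mp_subst (curve_param n m) p \<in> carrier (mpoly_ring {a, b})"
      using ring_hom_closed[OF curve_param_hom p] unfolding ins .
    then show "mp_subst (curve_param n m) p = 0" if "curve_map n m a b p = 0"
      using that two_var_eq_zero unfolding curve_map_def by blast
  qed (simp add: curve_map_def two_var_def)
  then show ?thesis
    unfolding curve_ideal_def a_kernel_def' by (auto simp: mpoly_ring_def type_ring_simps)
qed

text \<open>The homomorphism theorem: the map is constant on each coset of the kernel, and
  \<open>the_elem\<close> extracts that value.\<close>

lemma plane_semigroup_ring_curve:
  assumes ab: "(a, b) \<in> {(1, 2), (2, 1)}" and n: "n \<ge> 1" and mn: "m n > 0"
  shows "plane_semigroup_ring (curve_coordinate_ring n m :: 'k::field mpoly set ring)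
    (\<lambda>F. the_elem (curve_map n m a b ` F)) (curve_semigroup n m a b) (m n)"
proof -
  let ?R = "mpoly_ring {1..n + 1} :: 'k mpoly ring"
  let ?h = "curve_map n m a b :: 'k mpoly \<Rightarrow> 'k poly poly"
  interpret H: ring_hom_ring ?R type_ring ?h by (rule curve_map_hom)
  have A: "curve_coordinate_ring n m = ?R Quot a_kernel ?R type_ring ?h"
    unfolding curve_coordinate_ring_def by (subst curve_ideal_eq_kernel[OF ab]) simp
  let ?A = "?R Quot a_kernel ?R type_ring ?h"
  have hom: "(\<lambda>F. the_elem (?h ` F)) \<in> ring_hom ?A type_ring" by (rule H.the_elem_hom)
  show ?thesis
    unfolding A
  proof (intro plane_semigroup_ring.intro plane_semigroup_ring_axioms.intro)
    show "cring ?A" unfolding A[symmetric] by (rule curve_coordinate_ring_cring)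
    show "inj_on (\<lambda>F. the_elem (?h ` F)) (carrier ?A)" by (intro inj_onI H.the_elem_inj)
    show "(\<lambda>F. the_elem (?h ` F)) ` carrier ?A = supported (curve_semigroup n m a b)"
      using H.the_elem_surj curve_map_image[OF ab] by simp
    have "(curve_exp n m a n, curve_exp n m b n) \<in> curve_semigroup n m a b"
      "(curve_exp n m a (n + 1), curve_exp n m b (n + 1)) \<in> curve_semigroup n m a b"
      using n by (auto intro!: curve_semigroup_gen)
    then show "(m n, 0) \<in> curve_semigroup n m a b" "(0, m n) \<in> curve_semigroup n m a b"
      using ab by (auto simp: curve_exp_def)
  qed (use ring_hom_add[OF hom] ring_hom_mult[OF hom] ring_hom_one[OF hom] mn in
      \<open>simp_all add: type_ring_simps curve_semigroup_zero curve_semigroup_add\<close>)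
qed

section \<open>The semigroup of an arithmetic sequence\<close>

text \<open>For a monomial in the variables, k is its degree, r its degree in the first n variables,
  and j the sum of the offsets i - 1 of those. Conversely, every j up to r (n - 1) is a sum of r
  offsets between 0 and n - 1.\<close>

lemma curve_semigroup_arithmetic:
  fixes n d :: nat and m :: "nat \<Rightarrow> nat"
  assumes n: "n \<ge> 2" and m: "\<forall>i\<in>{1..n}. m i = m 1 + (i - 1) * d"
  shows "(a, b) \<in> curve_semigroup n m 1 2 \<longleftrightarrow>
    (\<exists>k r j. a + b = k * m n \<and> r \<le> k \<and> j \<le> r * (n - 1) \<and> a = r * m 1 + j * d)"
proof
  have mi: "m i = m 1 + (i - 1) * d" if "i \<in> {1..n}" for i using m that by blast
  have le: "m i \<le> m n" if "i \<in> {1..n}" for i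
  proof -
    have "(i - 1) * d \<le> (n - 1) * d" using that by (intro mult_le_mono1 diff_le_mono) simp
    then show ?thesis using mi[OF that] mi[of n] n by simp
  qed
  assume "(a, b) \<in> curve_semigroup n m 1 2"
  then obtain \<alpha> where \<alpha>: "a = (\<Sum>i\<in>{1..n + 1}. \<alpha> i * curve_exp n m 1 i)"
    "b = (\<Sum>i\<in>{1..n + 1}. \<alpha> i * curve_exp n m 2 i)"
    unfolding curve_semigroup_def by blast
  have a: "a = (\<Sum>i\<in>{1..n}. \<alpha> i * m i)"
    unfolding \<alpha>(1) by (simp add: curve_exp_def)
  have "a + b = (\<Sum>i\<in>{1..n + 1}. \<alpha> i * (curve_exp n m 1 i + curve_exp n m 2 i))"
    by (simp add: \<alpha> add_mult_distrib2 sum.distrib del: sum.cl_ivl_Suc)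
  also have "\<dots> = (\<Sum>i\<in>{1..n + 1}. \<alpha> i * m n)"
    using le by (intro sum.cong) (auto simp: curve_exp_def)
  also have "\<dots> = (\<Sum>i\<in>{1..n + 1}. \<alpha> i) * m n" by (simp only: sum_distrib_right)
  finally have "a + b = (\<Sum>i\<in>{1..n + 1}. \<alpha> i) * m n" .
  moreover have "(\<Sum>i\<in>{1..n}. \<alpha> i) \<le> (\<Sum>i\<in>{1..n + 1}. \<alpha> i)" by simp
  moreover have "(\<Sum>i\<in>{1..n}. \<alpha> i * (i - 1)) \<le> (\<Sum>i\<in>{1..n}. \<alpha> i) * (n - 1)"
    unfolding sum_distrib_right by (intro sum_mono mult_le_mono2) auto
  moreover have "a = (\<Sum>i\<in>{1..n}. \<alpha> i) * m 1 + (\<Sum>i\<in>{1..n}. \<alpha> i * (i - 1)) * d"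
  proof -
    have "a = (\<Sum>i\<in>{1..n}. \<alpha> i * m 1 + \<alpha> i * (i - 1) * d)"
      unfolding a
    proof (intro sum.cong refl)
      fix i assume "i \<in> {1..n}"
      then have "\<alpha> i * m i = \<alpha> i * (m 1 + (i - 1) * d)" using mi by metis
      then show "\<alpha> i * m i = \<alpha> i * m 1 + \<alpha> i * (i - 1) * d"
        by (simp only: add_mult_distrib2 mult.assoc)
    qed
    then show ?thesis by (simp only: sum.distrib sum_distrib_right)
  qed
  ultimately show "\<exists>k r j. a + b = k * m n \<and> r \<le> k \<and> j \<le> r * (n - 1) \<and> a = r * m 1 + j * d"
    by blast
next
  let ?S = "curve_semigroup n m 1 2"
  assume "\<exists>k r j. a + b = k * m n \<and> r \<le> k \<and> j \<le> r * (n - 1) \<and> a = r * m 1 + j * d"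
  then obtain k r j where h: "a + b = k * m n" "r \<le> k" "j \<le> r * (n - 1)" "a = r * m 1 + j * d" by blast
  have mi: "m i = m 1 + (i - 1) * d" if "i \<in> {1..n}" for i using m that by blast
  have mn: "m n = m 1 + (n - 1) * d" using mi[of n] n by simp
  have "(r * m 1 + j * d, k * m n - (r * m 1 + j * d)) \<in> ?S" if "r \<le> k" "j \<le> r * (n - 1)" for k r j
    using that
  proof (induction k arbitrary: r j)
    case 0
    then show ?case by (simp add: curve_semigroup_zero)
  next
    case (Suc k)
    show ?case
    proof (cases r)
      case 0
      have "(0, m n) \<in> ?S" using curve_semigroup_gen[of "n + 1" n m 1 2] by (simp add: curve_exp_def)
      then show ?thesis
        using Suc.IH[of 0 0] curve_semigroup_add[of 0 "m n" n m 1 2 0 "k * m n"] Suc.prems 0 by simp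
    next
      case (Suc s)
      \<comment> \<open>The greedy choice: the largest available offset is removed, so the remaining
        j - t fits into s factors. The variable used is the one with index t + 1.\<close>
      define t where "t = min j (n - 1)"
      have t: "t \<le> j" "t \<le> n - 1" "j - t \<le> s * (n - 1)"
        using Suc.prems Suc by (auto simp: t_def min_def)
      have IH: "(s * m 1 + (j - t) * d, k * m n - (s * m 1 + (j - t) * d)) \<in> ?S"
        using Suc.IH[of s "j - t"] Suc.prems Suc t by simp
      have "t < n" using t(2) n by linarith
      then have "(m (t + 1), m n - m (t + 1)) \<in> ?S"
        using curve_semigroup_gen[of "t + 1" n m 1 2] by (simp add: curve_exp_def)
      moreover have mt: "m (t + 1) = m 1 + t * d" using mi[of "t + 1"] t n by simp
      ultimately have "(m 1 + t * d, m n - (m 1 + t * d)) \<in> ?S" by simp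
      from curve_semigroup_add[OF this IH]
      have "(m 1 + t * d + (s * m 1 + (j - t) * d), m n - (m 1 + t * d) + (k * m n - (s * m 1 + (j - t) * d))) \<in> ?S" .
      moreover have "m 1 + t * d + (s * m 1 + (j - t) * d) = r * m 1 + j * d"
      proof -
        obtain e where "j = t + e" using le_Suc_ex[OF t(1)] by blast
        then show ?thesis by (simp add: Suc algebra_simps)
      qed
      moreover have "m 1 + t * d \<le> m n" using t by (simp add: mn)
      moreover have "s * m 1 + (j - t) * d \<le> k * m n"
      proof -
        have "s * m 1 + (j - t) * d \<le> s * m 1 + s * (n - 1) * d" using t by simp
        also have "\<dots> = s * m n" by (simp add: mn algebra_simps)
        also have "\<dots> \<le> k * m n" using Suc.prems Suc by simp
        finally show ?thesis .
      qed
      ultimately show ?thesis by simp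
    qed
  qed
  from this[OF h(2,3)] have "(a, k * m n - a) \<in> ?S" by (simp only: flip: h(4))
  moreover have "k * m n - a = b" by (simp flip: h(1))
  ultimately show "(a, b) \<in> ?S" by simp
qed

lemma curve_semigroup_saturated:
  fixes n d :: nat and m :: "nat \<Rightarrow> nat"
  assumes n: "n \<ge> 2" and pos: "m 1 > 0" "d > 0" and m: "\<forall>i\<in>{1..n}. m i = m 1 + (i - 1) * d"
    and cop: "gcd (m 1) d = 1"
    and S: "(a + p * m n, b) \<in> curve_semigroup n m 1 2" "(a, b + q * m n) \<in> curve_semigroup n m 1 2"
  shows "(a, b) \<in> curve_semigroup n m 1 2"
proof -
  note char = curve_semigroup_arithmetic[OF n m]
  have mn: "m n = m 1 + (n - 1) * d" by (rule bspec[OF m]) (use n in simp)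
  have mn0: "m n > 0" using pos mn by simp
  obtain k1 r1 j1 where h1: "a + p * m n + b = k1 * m n" "r1 \<le> k1" "j1 \<le> r1 * (n - 1)"
    "a + p * m n = r1 * m 1 + j1 * d" using S(1) unfolding char by blast
  obtain k2 r2 j2 where h2: "a + (b + q * m n) = k2 * m n" "r2 \<le> k2" "j2 \<le> r2 * (n - 1)"
    "a = r2 * m 1 + j2 * d" using S(2) unfolding char by blast
  have "p * m n \<le> k1 * m n" using h1(1) by linarith
  then have pk: "p \<le> k1" using mn0 by simp
  define k where "k = k1 - p"
  have k: "a + b = k * m n" using h1(1) by (simp add: k_def diff_mult_distrib)
  show ?thesis
  proof (cases "r2 \<le> k")
    case True
    then show ?thesis unfolding char using k h2 by blast
  next
    case False
    define M where "M = int (m 1)"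
    define N where "N = int (n - 1)"
    \<comment> \<open>Subtracting p times m n = m 1 + (n - 1) d from the first representation lowers
      its two coefficients by p and p (n - 1). Both bounds survive, but signs are lost; hence the
      passage to integers.\<close>
    define r where "r = int r1 - int p"
    define j where "j = int j1 - int p * N"
    have N: "N \<ge> 1" using n by (simp add: N_def)
    have rk: "r \<le> int k" using h1(2) pk by (simp add: r_def k_def)
    have jr: "j \<le> r * N"
    proof -
      have "int j1 \<le> int r1 * N" using h1(3) unfolding N_def by (metis of_nat_le_iff of_nat_mult)
      then show ?thesis by (simp add: j_def r_def algebra_simps)
    qed
    have aj: "int a = r * M + j * int d"
    proof -
      have "int a + int p * int (m n) = int r1 * M + int j1 * int d"
        using h1(4) unfolding M_def by (metis of_nat_add of_nat_mult)
      moreover have "int (m n) = M + N * int d" by (simp add: mn M_def N_def)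
      ultimately show ?thesis by (simp add: r_def j_def algebra_simps)
    qed
    have "int a = int r2 * M + int j2 * int d" by (simp add: h2(4) M_def)
    \<comment> \<open>Both sides represent a. As r <= k < r2, the second coefficient must go the
      other way: j > j2 >= 0. Then j <= r N rules out a negative r, and the shifted representation
      is admissible.\<close>
    with aj have eq: "(int r2 - r) * M = (j - int j2) * int d" by (simp add: algebra_simps)
    have "coprime M (int d)" using cop by (simp add: M_def coprime_iff_gcd_eq_1)
    have pos': "(int r2 - r) * M > 0" using False rk pos by (simp add: M_def)
    then have "(j - int j2) * int d > 0" using eq by simp
    then have "j > int j2" using pos by (simp add: zero_less_mult_iff)
    then have j0: "j \<ge> 0" by simp
    have r0: "r \<ge> 0"
    proof (rule ccontr)
      assume "\<not> r \<ge> 0"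
      then have "r * N < 0" using N by (simp add: mult_neg_pos)
      then show False using jr j0 by simp
    qed
    have "nat r \<le> k" using rk by simp
    moreover have "nat j \<le> nat r * (n - 1)"
    proof -
      have "int (nat j) \<le> int (nat r * (n - 1))" using jr j0 r0 by (simp add: N_def)
      then show ?thesis by (simp only: of_nat_le_iff)
    qed
    moreover have "a = nat r * m 1 + nat j * d"
    proof -
      have "int a = int (nat r * m 1 + nat j * d)" using aj j0 r0 by (simp add: M_def)
      then show ?thesis by (simp only: of_nat_eq_iff)
    qed
    ultimately show ?thesis unfolding char using k by blast
  qed
qed

theorem corollary2p3:
  fixes n d :: nat and m :: "nat \<Rightarrow> nat"
  assumes "infinite (UNIV :: 'k::field set)"
    and "n \<ge> 2"
    and "m 1 > 0" and "d > 0"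
    and "\<forall>i\<in>{1..n}. m i = m 1 + (i - 1) * d"
    and "gcd (m 1) d = 1"
  shows "cohen_macaulay_ring (curve_coordinate_ring n m :: 'k mpoly set ring)"
proof -
  let ?A = "curve_coordinate_ring n m :: 'k mpoly set ring"
  have "m n = m 1 + (n - 1) * d" by (rule bspec[OF assms(5)]) (use assms(2) in simp)
  then have mn: "m n > 0" using assms(3) by simp
  have n: "n \<ge> 1" using assms(2) by simp
  show ?thesis
  proof (rule plane_semigroup_ring_cohen_macaulay)
    show "plane_semigroup_ring ?A (\<lambda>F. the_elem (curve_map n m 1 2 ` F)) (curve_semigroup n m 1 2) (m n)"
      by (rule plane_semigroup_ring_curve) (use n mn in auto)
    show "plane_semigroup_ring ?A (\<lambda>F. the_elem (curve_map n m 2 1 ` F)) (curve_semigroup n m 2 1) (m n)"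
      by (rule plane_semigroup_ring_curve) (use n mn in auto)
    show "(i, j) \<in> curve_semigroup n m 1 2"
      if "(i + k * m n, j) \<in> curve_semigroup n m 1 2" "(i, j + l * m n) \<in> curve_semigroup n m 1 2" for i j k l
      using curve_semigroup_saturated[OF assms(2-6) that] .
  next
    fix F :: "'k mpoly set" and i j
    assume F: "F \<in> carrier ?A"
    \<comment> \<open>Both embeddings of a coset are evaluated at the same representative, which
      reduces the exchange of u and v to that of the two nestings of one polynomial.\<close>
    have elem: "the_elem (curve_map n m a b ` F) = curve_map n m a b p"
      if ab: "(a, b) \<in> {(1, 2), (2, 1)}" and p: "p \<in> carrier (mpoly_ring {1..n + 1})"
        "F = curve_ideal n m +>\<^bsub>mpoly_ring {1..n + 1}\<^esub> p" for a b p
      using p ring_hom_ring.the_elem_simp[OF curve_map_hom p(1), of m a b]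
      by (simp add: curve_ideal_eq_kernel[OF ab])
    obtain p where p: "p \<in> carrier (mpoly_ring {1..n + 1})" "F = curve_ideal n m +>\<^bsub>mpoly_ring {1..n + 1}\<^esub> p"
      using F by (auto simp: curve_coordinate_ring_def FactRing_def A_RCOSETS_def')
    show "coeff (coeff (the_elem (curve_map n m 2 1 ` F)) i) j = coeff (coeff (the_elem (curve_map n m 1 2 ` F)) j) i"
      using elem[OF _ p, of 1 2] elem[OF _ p, of 2 1] two_var_swap[of 2 1]
      by (simp add: curve_map_def)
  qed
qed

end
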